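(* Let $\rho$ be any $n$-qubit quantum state and $\psi=|\psi\rangle\langle\psi|$ a pure state on at most 3 qubits. Let $k,m$ be positive integers, $p\in(0,1]$, $\varepsilon\in[0,1)$. Suppose there is a probabilistic stabilizer operation $\mathcal O$ with $\mathcal O(\rho^{\otimes k})=p\tau$, where $\tau$ is a state with $\langle\psi^{\otimes m}|\tau|\psi^{\otimes m}\rangle\ge1-\varepsilon$. Then $$k\ \ge\ \frac{\log p+\log(1-\varepsilon)+m\log F(\psi)^{-1}}{\log\Lambda^+(\rho)}\qquad\text{and}\qquad k\ \ge\ p\left(\frac{\log(1-\varepsilon)+m\log F(\psi)^{-1}}{\log\Lambda^+(\rho)}\right).$$
   Context: $\mathrm{S}_n$ denotes the set of pure $n$-qubit stabilizer states and $\bar{\mathrm S}_n=\mathrm{conv}\{|\phi\rangle\langle\phi|:|\phi\rangle\in\mathrm S_n\}$ the mixed stabilizer states. A probabilistic stabilizer operation is a completely positive, not necessarily trace-preserving (trace non-increasing) map $\mathcal O$ that is stabilizer preserving in the sense that $\mathcal O(\sigma)$ is proportional to an element of $\bar{\mathrm S}$ for every $\sigma\in\bar{\mathrm S}$ (forming one branch of a trace-preserving collection of such maps). The generalized robustness is $\Lambda^+(\rho)=\min\{\lambda:\rho\le\lambda\sigma,\ \sigma\in\bar{\mathrm S}_n\}$. The stabilizer fidelity of a pure state is $F(\psi)=\max_{|\phi\rangle\in\mathrm S}|\langle\psi|\phi\rangle|^2$, the maximum over pure stabilizer states on the same number of qubits as $\psi$. *)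

theory Defs
  imports "Jordan_Normal_Form.Matrix"
begin

definition adj :: "complex mat \<Rightarrow> complex mat" where
  "adj A = mat (dim_col A) (dim_row A) (\<lambda>(i,j). cnj (A $$ (j,i)))"

definition tr :: "complex mat \<Rightarrow> complex" where
  "tr A = (\<Sum>i<dim_row A. A $$ (i,i))"

definition kron :: "complex mat \<Rightarrow> complex mat \<Rightarrow> complex mat" where
  "kron A B = mat (dim_row A * dim_row B) (dim_col A * dim_col B)
     (\<lambda>(i,j). A $$ (i div dim_row B, j div dim_col B) * B $$ (i mod dim_row B, j mod dim_col B))"

fun kron_pow :: "complex mat \<Rightarrow> nat \<Rightarrow> complex mat" where
  "kron_pow A 0 = 1\<^sub>m 1"
| "kron_pow A (Suc k) = kron A (kron_pow A k)"

definition psd :: "nat \<Rightarrow> complex mat \<Rightarrow> bool" where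
  "psd d A \<longleftrightarrow> A \<in> carrier_mat d d \<and>
     (\<forall>v \<in> carrier_mat d 1. Im ((adj v * A * v) $$ (0,0)) = 0 \<and> Re ((adj v * A * v) $$ (0,0)) \<ge> 0)"

definition density :: "nat \<Rightarrow> complex mat \<Rightarrow> bool" where
  "density n \<rho> \<longleftrightarrow> psd (2^n) \<rho> \<and> tr \<rho> = 1"

definition unit_ket :: "nat \<Rightarrow> complex mat \<Rightarrow> bool" where
  "unit_ket n v \<longleftrightarrow> v \<in> carrier_mat (2^n) 1 \<and> (adj v * v) $$ (0,0) = 1"

definition braket :: "complex mat \<Rightarrow> complex mat \<Rightarrow> complex" where
  "braket u v = (adj u * v) $$ (0,0)"

definition proj :: "complex mat \<Rightarrow> complex mat" where
  "proj v = v * adj v"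

definition msum :: "nat \<Rightarrow> complex mat list \<Rightarrow> complex mat" where
  "msum d As = foldr (+) As (0\<^sub>m d d)"

definition pauli :: "nat \<Rightarrow> complex mat" where
  "pauli a = (if a = 1 then mat_of_rows_list 2 [[0,1],[1,0]]
         else if a = 2 then mat_of_rows_list 2 [[0,-\<i>],[\<i>,0]]
         else if a = 3 then mat_of_rows_list 2 [[1,0],[0,-1]]
         else 1\<^sub>m 2)"

fun pauli_string :: "nat list \<Rightarrow> complex mat" where
  "pauli_string [] = 1\<^sub>m 1"
| "pauli_string (a # as) = kron (pauli a) (pauli_string as)"

definition pauli_group :: "nat \<Rightarrow> complex mat set" where
  "pauli_group n = {(\<i> ^ c) \<cdot>\<^sub>m pauli_string ws | c ws. c < 4 \<and> length ws = n \<and> set ws \<subseteq> {0..3}}"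

text \<open>A pure stabilizer state: a unit vector stabilized (fixed) by a subgroup of the Pauli
  group of order 2^n (the set of Pauli operators fixing a vector is automatically a group).\<close>
definition stab_state :: "nat \<Rightarrow> complex mat \<Rightarrow> bool" where
  "stab_state n \<phi> \<longleftrightarrow> unit_ket n \<phi> \<and>
     (\<exists>S. S \<subseteq> pauli_group n \<and> card S = 2^n \<and> (\<forall>P\<in>S. P * \<phi> = \<phi>))"

definition mixed_stab :: "nat \<Rightarrow> complex mat \<Rightarrow> bool" where
  "mixed_stab n \<sigma> \<longleftrightarrow> (\<exists>ws \<phi>s. length ws = length \<phi>s \<and> (\<forall>w\<in>set ws. w \<ge> 0) \<and> sum_list ws = (1::real)
      \<and> (\<forall>\<phi>\<in>set \<phi>s. stab_state n \<phi>)
      \<and> \<sigma> = msum (2^n) (map (\<lambda>(w,\<phi>). complex_of_real w \<cdot>\<^sub>m proj \<phi>) (zip ws \<phi>s)))"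

definition kraus_apply :: "nat \<Rightarrow> complex mat list \<Rightarrow> complex mat \<Rightarrow> complex mat" where
  "kraus_apply dout Ks X = msum dout (map (\<lambda>K. K * X * adj K) Ks)"

definition kraus_ops :: "nat \<Rightarrow> nat \<Rightarrow> complex mat list \<Rightarrow> bool" where
  "kraus_ops nin nout Ks \<longleftrightarrow> set Ks \<subseteq> carrier_mat (2^nout) (2^nin)"

definition stab_preserving :: "nat \<Rightarrow> nat \<Rightarrow> complex mat list \<Rightarrow> bool" where
  "stab_preserving nin nout Ks \<longleftrightarrow> (\<forall>\<sigma>. mixed_stab nin \<sigma> \<longrightarrow>
     (\<exists>c::real. c \<ge> 0 \<and> (\<exists>\<tau>. mixed_stab nout \<tau> \<and> kraus_apply (2^nout) Ks \<sigma> = complex_of_real c \<cdot>\<^sub>m \<tau>)))"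

text \<open>A probabilistic stabilizer operation: a CP stabilizer-preserving map that is one branch of
  a trace-preserving collection of CP stabilizer-preserving maps (hence trace non-increasing).\<close>
definition prob_stab_op :: "nat \<Rightarrow> nat \<Rightarrow> complex mat list \<Rightarrow> bool" where
  "prob_stab_op nin nout Ks \<longleftrightarrow> kraus_ops nin nout Ks \<and> stab_preserving nin nout Ks \<and>
     (\<exists>Kss. (\<forall>Ks'\<in>set Kss. kraus_ops nin nout Ks' \<and> stab_preserving nin nout Ks') \<and>
        msum (2^nin) (map (\<lambda>K. adj K * K) (concat (Ks # Kss))) = 1\<^sub>m (2^nin))"

definition gen_robustness :: "nat \<Rightarrow> complex mat \<Rightarrow> real" where
  "gen_robustness n \<rho> = Inf {l::real. \<exists>\<sigma>. mixed_stab n \<sigma> \<and> psd (2^n) (complex_of_real l \<cdot>\<^sub>m \<sigma> - \<rho>)}"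

definition stab_fidelity :: "nat \<Rightarrow> complex mat \<Rightarrow> real" where
  "stab_fidelity n \<psi> = (SUP \<phi>\<in>{\<phi>. stab_state n \<phi>}. (cmod (braket \<psi> \<phi>))^2)"

end

theory Submission
  imports Defs
begin

text \<open>
  Let \<open>\<rho> \<le> l \<sigma>\<close> with \<open>\<sigma>\<close> a mixed stabilizer state, and \<open>L = l ^ k\<close>. The k-th tensor power of \<open>\<rho>\<close> is
  dominated by \<open>L\<close> times that of \<open>\<sigma>\<close>, which the operation maps to \<open>c\<close> times a stabilizer state, \<open>c \<le> 1\<close>.
  With \<open>y = (1 - \<epsilon>) / F ^ m\<close> this gives \<open>p y \<le> L c\<close>, and the traces of the complementary branches
  give \<open>1 - p \<le> L (1 - c)\<close>. The first inequality yields the first bound; both together yield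
  \<open>p ln y \<le> ln L\<close>, because the relative entropy of \<open>(p, 1 - p)\<close> and \<open>(c, 1 - c)\<close> is nonnegative.

  At most 3 qubits are needed for the multiplicativity of the stabilizer fidelity F. A bipartite
  stabilizer state contracted with a vector of one side lies in a stabilizer code of the other side,
  and both local codes have the same number \<open>r \<le> 3\<close> of logical qubits. Every unit vector of
  such a code has squared overlap at least \<open>1 / sqrt (2 ^ r)\<close> with a stabilizer state in the code: the
  squared expectations of the nontrivial logical Paulis average to \<open>1 / (2 ^ r + 1)\<close>, so projecting
  onto an eigenspace of the largest one retains a factor \<open>(1 + 1 / sqrt (2 ^ r + 1)) / 2\<close> of the squared norm
  and leaves \<open>r - 1\<close> logical qubits; the product of these factors suffices for \<open>r \<le> 3\<close>.
\<close>

(* Simp must not rewrite the 1 of carrier_mat D 1 to Suc 0. *)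
declare One_nat_def [simp del]

text \<open>Where the limit 3 comes from: let \<open>v\<close> and \<open>w\<close> be the
  projections of the two factors onto the local codes of a bipartite stabilizer state. Contracting
  the state with \<open>v\<close> leaves a vector of squared norm \<open>nsq v / 2 ^ r\<close>, so
  Cauchy-Schwarz bounds the squared overlap by \<open>nsq v * nsq w / 2 ^ r\<close>. The greedy
  extension bounds the two fidelities from below by \<open>greedy_const r\<close> times
  \<open>nsq v\<close> and \<open>nsq w\<close>. Multiplicativity follows as soon as
  \<open>1 \<le> 2 ^ r * (greedy_const r)\<^sup>2\<close>; the right-hand side is about 1.16 at
  \<open>r = 3\<close> but only about 0.89 at \<open>r = 4\<close>. The size of the left factor
  already bounds \<open>r\<close>, so only the single copy that is split off has to be small; the
  other factor is the whole remaining tensor power. The robustness is an infimum. All estimates are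
  made for an arbitrary feasible \<open>l\<close>, and the infimum is taken at the very end, inside
  the logarithm.\<close>

lemma mat_mult_entry:
  "A \<in> carrier_mat a b \<Longrightarrow> B \<in> carrier_mat b c \<Longrightarrow> i < a \<Longrightarrow> j < c \<Longrightarrow>
   (A * B) $$ (i,j) = (\<Sum>k<b. A $$ (i,k) * B $$ (k,j))"
  by (auto simp: scalar_prod_def lessThan_atLeast0 intro!: sum.cong)

lemma adj_carrier [simp]: "A \<in> carrier_mat a b \<Longrightarrow> adj A \<in> carrier_mat b a"
  by (auto simp: adj_def)

lemma dim_adj [simp]: "dim_row (adj A) = dim_col A" "dim_col (adj A) = dim_row A"
  by (auto simp: adj_def)

lemma adj_entry [simp]:
  "i < dim_col A \<Longrightarrow> j < dim_row A \<Longrightarrow> adj A $$ (i,j) = cnj (A $$ (j,i))"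
  by (auto simp: adj_def)

lemma adj_adj [simp]: "adj (adj A) = A"
  by (intro eq_matI) auto

lemma adj_mult:
  assumes "A \<in> carrier_mat a b" "B \<in> carrier_mat b c"
  shows "adj (A * B) = adj B * adj A"
proof (rule eq_matI)
  fix i j assume ij: "i < dim_row (adj B * adj A)" "j < dim_col (adj B * adj A)"
  then show "adj (A * B) $$ (i,j) = (adj B * adj A) $$ (i,j)"
    using assms mat_mult_entry[OF assms, of j i]
      mat_mult_entry[OF adj_carrier[OF assms(2)] adj_carrier[OF assms(1)], of i j]
    by (auto simp: mult.commute simp del: index_mult_mat(1))
qed (use assms in auto)

section \<open>Inner products, quadratic forms and Cauchy-Schwarz\<close>

lemma braket_sum:
  assumes "u \<in> carrier_mat D 1" "v \<in> carrier_mat D 1"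
  shows "braket u v = (\<Sum>i<D. cnj (u $$ (i,0)) * v $$ (i,0))"
  unfolding braket_def
  by (subst mat_mult_entry[OF adj_carrier[OF assms(1)] assms(2)]) (use assms in auto)

lemma braket_mat:
  assumes "u \<in> carrier_mat D 1" "A \<in> carrier_mat D E" "v \<in> carrier_mat E 1"
  shows "braket u (A * v) = (\<Sum>i<D. \<Sum>j<E. cnj (u $$ (i,0)) * A $$ (i,j) * v $$ (j,0))"
  by (subst braket_sum[of _ D]; use assms in \<open>simp add: mat_mult_entry[of _ D E _ 1] sum_distrib_left mult.assoc
      del: index_mult_mat(1)\<close>)

lemma braket_adjoint:
  assumes "u \<in> carrier_mat D 1" "A \<in> carrier_mat D E" "v \<in> carrier_mat E 1"
  shows "braket u (A * v) = braket (adj A * u) v"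
  unfolding braket_def using assms
  by (simp add: adj_mult[OF adj_carrier[OF assms(2)] assms(1)]
      assoc_mult_mat[OF adj_carrier[OF assms(1)] assms(2,3)])

lemma braket_add_right:
  assumes "u \<in> carrier_mat D 1" "v \<in> carrier_mat D 1" "w \<in> carrier_mat D 1"
  shows "braket u (v + w) = braket u v + braket u w"
  using assms by (simp add: braket_sum[of _ D] distrib_left sum.distrib)

lemma braket_smult_right:
  assumes "u \<in> carrier_mat D 1" "v \<in> carrier_mat D 1"
  shows "braket u (c \<cdot>\<^sub>m v) = c * braket u v"
  using assms by (simp add: braket_sum[of _ D] sum_distrib_left mult_ac)

lemma braket_cnj:
  assumes "u \<in> carrier_mat D 1" "v \<in> carrier_mat D 1"
  shows "braket v u = cnj (braket u v)"
  using assms by (simp add: braket_sum[of _ D] mult_ac)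

lemma braket_add_left:
  assumes "u \<in> carrier_mat D 1" "v \<in> carrier_mat D 1" "w \<in> carrier_mat D 1"
  shows "braket (v + w) u = braket v u + braket w u"
  using assms by (simp add: braket_sum[of _ D] distrib_right sum.distrib)

lemma braket_smult_left:
  assumes "u \<in> carrier_mat D 1" "v \<in> carrier_mat D 1"
  shows "braket (c \<cdot>\<^sub>m v) u = cnj c * braket v u"
  using assms by (simp add: braket_sum[of _ D] sum_distrib_left mult_ac)

definition nsq :: "complex mat \<Rightarrow> real" where
  "nsq v = (\<Sum>i<dim_row v. (cmod (v $$ (i,0)))\<^sup>2)"

lemma braket_self: "v \<in> carrier_mat D 1 \<Longrightarrow> braket v v = complex_of_real (nsq v)"
  by (auto simp: braket_sum[of _ D] nsq_def complex_norm_square mult.commute simp del: of_real_power intro!: sum.cong)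

lemma nsq_nonneg [simp]: "0 \<le> nsq v"
  by (simp add: nsq_def sum_nonneg)

lemma nsq_eq_0_iff: "v \<in> carrier_mat D 1 \<Longrightarrow> nsq v = 0 \<longleftrightarrow> v = 0\<^sub>m D 1"
  by (auto simp: nsq_def sum_nonneg_eq_0_iff intro!: eq_matI)

lemma nsq_smult: "v \<in> carrier_mat D 1 \<Longrightarrow> nsq (c \<cdot>\<^sub>m v) = (cmod c)\<^sup>2 * nsq v"
  by (auto simp: nsq_def norm_mult power_mult_distrib sum_distrib_left)

lemma unit_ket_iff: "unit_ket n v \<longleftrightarrow> v \<in> carrier_mat (2^n) 1 \<and> nsq v = 1"
proof (cases "v \<in> carrier_mat (2^n) 1")
  case True
  have "(adj v * v) $$ (0,0) = complex_of_real (nsq v)"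
    using braket_self[OF True] by (simp add: braket_def)
  then show ?thesis
    unfolding unit_ket_def using True by (metis of_real_1 of_real_eq_iff)
qed (auto simp: unit_ket_def)

lemma psd_iff:
  "psd D A \<longleftrightarrow> A \<in> carrier_mat D D \<and> (\<forall>v \<in> carrier_mat D 1. Im (braket v (A * v)) = 0 \<and> Re (braket v (A * v)) \<ge> 0)"
proof -
  have "adj v * A * v = adj v * (A * v)" if "A \<in> carrier_mat D D" "v \<in> carrier_mat D 1" for v
    using that by (intro assoc_mult_mat[of _ 1 D]) auto
  then show ?thesis unfolding psd_def braket_def by (intro conj_cong ball_cong refl) (simp_all only:)
qed

text \<open>The discriminant step of Cauchy-Schwarz, where \<open>X\<close> is the squared modulus
  of the cross term. The minimum is at \<open>s = 1/a\<close>; for \<open>a = 0\<close> the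
  expression is linear in \<open>s\<close> and needs its own argument.\<close>

lemma quadratic_nonneg_imp_le:
  fixes a b X :: real
  assumes "\<And>s. b - 2 * s * X + s\<^sup>2 * X * a \<ge> 0" "a \<ge> 0" "X \<ge> 0"
  shows "X \<le> a * b"
proof (cases "a = 0")
  case True
  have "X = 0"
  proof (rule ccontr)
    assume "X \<noteq> 0"
    \<comment> \<open>This choice of \<open>s\<close> would force \<open>b \<le> -2\<close>, whereas
      \<open>s = 0\<close> gives \<open>b \<ge> 0\<close>.\<close>
    then have "b - 2 * (b + 1) \<ge> 0" using assms(1)[of "(b + 1) / X"] True by simp
    then show False using assms(1)[of 0] by simp
  qed
  then show ?thesis using True by simp
next
  case False
  then show ?thesis using assms(1)[of "1/a"] assms(2) by (simp add: field_simps power2_eq_square)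
qed

lemma braket_mat_add:
  assumes A: "A \<in> carrier_mat D D" and u: "u \<in> carrier_mat D 1" and v: "v \<in> carrier_mat D 1"
  shows "braket (v + c \<cdot>\<^sub>m u) (A * (v + c \<cdot>\<^sub>m u)) =
    braket v (A * v) + c * braket v (A * u) + cnj c * braket u (A * v) + cnj c * c * braket u (A * u)"
proof -
  have [simp]: "A * v \<in> carrier_mat D 1" "A * u \<in> carrier_mat D 1" using assms by auto
  have "A * (v + c \<cdot>\<^sub>m u) = A * v + c \<cdot>\<^sub>m (A * u)"
    using assms by (simp add: mult_add_distrib_mat[of _ D D _ 1] mult_smult_distrib[of _ D D _ 1])
  then show ?thesis using u v
    by (simp add: braket_add_right[of _ D] braket_add_left[of _ D] braket_smult_right[of _ D]
        braket_smult_left[of _ D] algebra_simps)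
qed

text \<open>Polarization: \<open>psd\<close> only speaks of the diagonal of the form, and its
  reality at \<open>v + u\<close> and at \<open>v + \<i> u\<close> yields the imaginary and the real
  part of the symmetry.\<close>

lemma psd_hermitian_form:
  assumes "psd D A" "u \<in> carrier_mat D 1" "v \<in> carrier_mat D 1"
  shows "braket v (A * u) = cnj (braket u (A * v))"
proof -
  have A: "A \<in> carrier_mat D D" and im: "\<And>v. v \<in> carrier_mat D 1 \<Longrightarrow> Im (braket v (A * v)) = 0"
    using assms(1) by (auto simp: psd_iff)
  have 1: "Im (braket v (A * u) + braket u (A * v)) = 0"
    using im[of "v + 1 \<cdot>\<^sub>m u"] im[of u] im[of v] assms(2,3) by (simp add: braket_mat_add[OF A])
  have 2: "Im (\<i> * braket v (A * u) - \<i> * braket u (A * v)) = 0"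
    using im[of "v + \<i> \<cdot>\<^sub>m u"] im[of u] im[of v] assms(2,3) by (simp add: braket_mat_add[OF A])
  show ?thesis using 1 2 by (intro complex_eqI) auto
qed

lemma psd_cauchy_schwarz:
  assumes P: "psd D A" and u: "u \<in> carrier_mat D 1" and v: "v \<in> carrier_mat D 1"
  shows "(cmod (braket u (A * v)))\<^sup>2 \<le> Re (braket u (A * u)) * Re (braket v (A * v))"
proof -
  have A: "A \<in> carrier_mat D D" and im: "\<And>v. v \<in> carrier_mat D 1 \<Longrightarrow> Im (braket v (A * v)) = 0"
    and re: "\<And>v. v \<in> carrier_mat D 1 \<Longrightarrow> Re (braket v (A * v)) \<ge> 0"
    using P by (auto simp: psd_iff)
  let ?x = "braket u (A * v)"
  have h: "braket v (A * u) = cnj ?x" by (rule psd_hermitian_form[OF P u v])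
  show ?thesis
  proof (rule quadratic_nonneg_imp_le)
    fix s :: real
    \<comment> \<open>The factor \<open>?x\<close> cancels the phase of the cross term, so that a
      real parameter \<open>s\<close> is enough.\<close>
    let ?c = "- complex_of_real s * ?x"
    have "Re (braket (v + ?c \<cdot>\<^sub>m u) (A * (v + ?c \<cdot>\<^sub>m u))) =
      Re (braket v (A * v)) - 2 * s * (cmod ?x)\<^sup>2 + s\<^sup>2 * (cmod ?x)\<^sup>2 * Re (braket u (A * u))"
      using im[OF u]
      by (simp add: braket_mat_add[OF A u v] h cmod_power2) (simp add: algebra_simps power2_eq_square)
    then show "0 \<le> Re (braket v (A * v)) - 2 * s * (cmod ?x)\<^sup>2 + s\<^sup>2 * (cmod ?x)\<^sup>2 * Re (braket u (A * u))"
      using re[of "v + ?c \<cdot>\<^sub>m u"] u v by simp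
  qed (use re[OF u] in auto)
qed

lemma psd_one: "psd D (1\<^sub>m D)"
  by (auto simp: psd_iff braket_self[of _ D] left_mult_one_mat[of _ D 1])

lemma braket_cauchy_schwarz:
  assumes "u \<in> carrier_mat D 1" "v \<in> carrier_mat D 1"
  shows "(cmod (braket u v))\<^sup>2 \<le> nsq u * nsq v"
  using psd_cauchy_schwarz[OF psd_one assms] assms
  by (simp add: braket_self[of _ D] left_mult_one_mat[of _ D 1])


section \<open>Kronecker products\<close>

lemma sum_lessThan_mult:
  "(\<Sum>i<a*b. f i) = (\<Sum>p<a. \<Sum>q<b. f (p * b + q))" for f :: "nat \<Rightarrow> 'a::comm_monoid_add"
proof -
  have "(\<Sum>q<b. f (p * b + q)) = sum f {p*b..<p*b+b}" for p
    by (rule sum.reindex_bij_witness[where i="\<lambda>x. x - p*b" and j="\<lambda>q. p*b+q"]) auto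
  then show ?thesis by (simp add: sum.nat_group)
qed

lemma mult_add_less: "p < a \<Longrightarrow> q < b \<Longrightarrow> p * b + q < a * (b::nat)"
proof -
  assume "p < a" "q < b"
  then have "p * b + q < Suc p * b" "Suc p * b \<le> a * b" by (simp, intro mult_le_mono1 Suc_leI)
  then show ?thesis by (rule less_le_trans)
qed

lemma kron_carrier:
  "A \<in> carrier_mat a b \<Longrightarrow> B \<in> carrier_mat c d \<Longrightarrow> kron A B \<in> carrier_mat (a*c) (b*d)"
  by (auto simp: kron_def)

lemma dim_kron [simp]: "dim_row (kron A B) = dim_row A * dim_row B" "dim_col (kron A B) = dim_col A * dim_col B"
  by (auto simp: kron_def)

lemma kron_entry:
  assumes "A \<in> carrier_mat a b" "B \<in> carrier_mat c d" "p < a" "q < c" "r < b" "s < d"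
  shows "kron A B $$ (p * c + q, r * d + s) = A $$ (p,r) * B $$ (q,s)"
  using assms mult_add_less[of p a q c] mult_add_less[of r b s d] by (auto simp: kron_def)

lemma kron_index:
  assumes "i < dim_row A * dim_row B" "j < dim_col A * dim_col B"
  shows "kron A B $$ (i,j) = A $$ (i div dim_row B, j div dim_col B) * B $$ (i mod dim_row B, j mod dim_col B)"
  using assms by (auto simp: kron_def)

lemma div_mod_less_mult:
  assumes "i < a * (b::nat)" shows "i div b < a" "i mod b < b"
  using assms by (auto simp: less_mult_imp_div_less intro!: mod_less_divisor gr0I)

text \<open>Every index below a product has the form \<open>p * c + q\<close>; in this form
  \<open>kron_entry\<close> applies and no \<open>div\<close> or \<open>mod\<close> is left.\<close>

lemma kron_eqI:
  assumes "A \<in> carrier_mat (a*c) (b*d)" "B \<in> carrier_mat (a*c) (b*d)"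
    "\<And>p q r s. p < a \<Longrightarrow> q < c \<Longrightarrow> r < b \<Longrightarrow> s < d \<Longrightarrow> A $$ (p * c + q, r * d + s) = B $$ (p * c + q, r * d + s)"
  shows "A = B"
proof (rule eq_matI)
  fix i j assume "i < dim_row B" "j < dim_col B"
  then have ij: "i < a * c" "j < b * d" using assms by auto
  from div_mod_less_mult[OF ij(1)] div_mod_less_mult[OF ij(2)]
  show "A $$ (i,j) = B $$ (i,j)" using assms(3)[of "i div c" "i mod c" "j div d" "j mod d"] by simp
qed (use assms in auto)

lemma kron_mult:
  assumes A: "A \<in> carrier_mat a b" and C: "C \<in> carrier_mat b c"
    and B: "B \<in> carrier_mat e f" and D: "D \<in> carrier_mat f g"
  shows "kron A B * kron C D = kron (A * C) (B * D)"
proof (rule kron_eqI[where a=a and b=c and c=e and d=g])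
  fix p q r s assume i: "p < a" "q < e" "r < c" "s < g"
  have "(kron A B * kron C D) $$ (p * e + q, r * g + s) =
    (\<Sum>x<b. \<Sum>y<f. kron A B $$ (p * e + q, x * f + y) * kron C D $$ (x * f + y, r * g + s))"
    using i by (subst mat_mult_entry[OF kron_carrier[OF A B] kron_carrier[OF C D]])
      (auto simp: mult_add_less sum_lessThan_mult)
  also have "\<dots> = (\<Sum>x<b. \<Sum>y<f. (A $$ (p,x) * C $$ (x,r)) * (B $$ (q,y) * D $$ (y,s)))"
    using i by (intro sum.cong refl) (simp add: kron_entry[OF A B] kron_entry[OF C D])
  also have "\<dots> = (A * C) $$ (p,r) * (B * D) $$ (q,s)"
    using i by (simp add: mat_mult_entry[OF A C] mat_mult_entry[OF B D] sum_product del: index_mult_mat(1))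
  also have "\<dots> = kron (A * C) (B * D) $$ (p * e + q, r * g + s)"
    using i A B C D by (intro kron_entry[symmetric]) auto
  finally show "(kron A B * kron C D) $$ (p * e + q, r * g + s) = kron (A * C) (B * D) $$ (p * e + q, r * g + s)" .
qed (use assms in \<open>auto intro!: mult_carrier_mat kron_carrier\<close>)

lemma adj_kron: "adj (kron A B) = kron (adj A) (adj B)"
proof (rule eq_matI)
  fix i j assume "i < dim_row (kron (adj A) (adj B))" "j < dim_col (kron (adj A) (adj B))"
  then have ij: "i < dim_col A * dim_col B" "j < dim_row A * dim_row B" by auto
  show "adj (kron A B) $$ (i,j) = kron (adj A) (adj B) $$ (i,j)"
    using ij div_mod_less_mult[OF ij(1)] div_mod_less_mult[OF ij(2)] by (simp add: kron_index)
qed auto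

lemma kron_smult_left: "kron (c \<cdot>\<^sub>m A) B = c \<cdot>\<^sub>m kron A B"
proof (rule eq_matI)
  fix i j assume "i < dim_row (c \<cdot>\<^sub>m kron A B)" "j < dim_col (c \<cdot>\<^sub>m kron A B)"
  then have ij: "i < dim_row A * dim_row B" "j < dim_col A * dim_col B" by auto
  show "kron (c \<cdot>\<^sub>m A) B $$ (i,j) = (c \<cdot>\<^sub>m kron A B) $$ (i,j)"
    using ij div_mod_less_mult[OF ij(1)] div_mod_less_mult[OF ij(2)] by (simp add: kron_index)
qed auto

lemma kron_smult_right: "kron A (c \<cdot>\<^sub>m B) = c \<cdot>\<^sub>m kron A B"
proof (rule eq_matI)
  fix i j assume "i < dim_row (c \<cdot>\<^sub>m kron A B)" "j < dim_col (c \<cdot>\<^sub>m kron A B)"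
  then have ij: "i < dim_row A * dim_row B" "j < dim_col A * dim_col B" by auto
  show "kron A (c \<cdot>\<^sub>m B) $$ (i,j) = (c \<cdot>\<^sub>m kron A B) $$ (i,j)"
    using ij div_mod_less_mult[OF ij(1)] div_mod_less_mult[OF ij(2)] by (simp add: kron_index)
qed auto

lemma kron_add_left:
  assumes "A \<in> carrier_mat a b" "B \<in> carrier_mat a b"
  shows "kron (A + B) C = kron A C + kron B C"
proof (rule eq_matI)
  fix i j assume "i < dim_row (kron A C + kron B C)" "j < dim_col (kron A C + kron B C)"
  then have ij: "i < a * dim_row C" "j < b * dim_col C" using assms by auto
  show "kron (A + B) C $$ (i,j) = (kron A C + kron B C) $$ (i,j)"
    using assms ij div_mod_less_mult[OF ij(1)] div_mod_less_mult[OF ij(2)] by (simp add: kron_index distrib_right)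
qed (use assms in auto)

lemma kron_add_right:
  assumes "A \<in> carrier_mat a b" "B \<in> carrier_mat a b"
  shows "kron C (A + B) = kron C A + kron C B"
proof (rule eq_matI)
  fix i j assume "i < dim_row (kron C A + kron C B)" "j < dim_col (kron C A + kron C B)"
  then have ij: "i < dim_row C * a" "j < dim_col C * b" using assms by auto
  show "kron C (A + B) $$ (i,j) = (kron C A + kron C B) $$ (i,j)"
    using assms ij div_mod_less_mult[OF ij(1)] div_mod_less_mult[OF ij(2)] by (simp add: kron_index distrib_left)
qed (use assms in auto)

lemma kron_one: "kron (1\<^sub>m a) (1\<^sub>m b) = 1\<^sub>m (a * b)"
proof (rule kron_eqI[where a=a and b=a and c=b and d=b])
  fix p q r s assume i: "p < a" "q < b" "r < a" "s < b"
  have "p * b + q = r * b + s \<longleftrightarrow> p = r \<and> q = s"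
    using i by (metis add.commute div_mult_self3 div_less add_0_right less_nat_zero_code mod_mult_self1 mod_less)
  then show "kron (1\<^sub>m a) (1\<^sub>m b) $$ (p * b + q, r * b + s) = 1\<^sub>m (a * b) $$ (p * b + q, r * b + s)"
    using i by (simp add: kron_entry[of _ a a _ b b] mult_add_less)
qed (auto intro: kron_carrier)

lemma kron_one_one_left: "kron (1\<^sub>m 1) B = B"
  by (rule eq_matI) (auto simp: kron_index)

lemma kron_assoc: "kron (kron A B) C = kron A (kron B C)"
proof (rule eq_matI)
  fix i j assume "i < dim_row (kron A (kron B C))" "j < dim_col (kron A (kron B C))"
  then have ij: "i < dim_row A * dim_row B * dim_row C" "j < dim_col A * dim_col B * dim_col C"
    "i < dim_row A * (dim_row B * dim_row C)" "j < dim_col A * (dim_col B * dim_col C)" by (auto simp: mult.assoc)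
  have *: "i div c div b = i div (b * c)" "i div c mod b = i mod (b * c) div c" "i mod c = i mod (b * c) mod c" for i b c :: nat
    by (cases "c = 0"; simp add: div_mult2_eq[symmetric] mod_mult2_eq[of i c b] mult.commute[of b c])+
  show "kron (kron A B) C $$ (i,j) = kron A (kron B C) $$ (i,j)"
    using ij div_mod_less_mult[OF ij(1)] div_mod_less_mult[OF ij(2)]
      div_mod_less_mult[OF ij(3)] div_mod_less_mult[OF ij(4)]
      *[of i "dim_row C" "dim_row B"] *[of j "dim_col C" "dim_col B"]
    by (simp add: kron_index)
qed (auto simp: mult.assoc)

lemma braket_kron:
  assumes "u \<in> carrier_mat a 1" "u' \<in> carrier_mat a 1" "v \<in> carrier_mat b 1" "v' \<in> carrier_mat b 1"
  shows "braket (kron u v) (kron u' v') = braket u u' * braket v v'"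
proof -
  have "adj (kron u v) * kron u' v' = kron (adj u * u') (adj v * v')"
    using assms by (simp add: adj_kron kron_mult[of _ 1 a _ 1 _ 1 b _ 1])
  then show ?thesis using assms by (simp add: braket_def kron_index)
qed

lemma nsq_kron:
  assumes "u \<in> carrier_mat a 1" "v \<in> carrier_mat b 1"
  shows "nsq (kron u v) = nsq u * nsq v"
proof -
  have "complex_of_real (nsq (kron u v)) = complex_of_real (nsq u * nsq v)"
    using braket_kron[OF assms(1,1,2,2)] kron_carrier[OF assms] assms
    by (simp add: braket_self[of _ "a * b"] braket_self[of _ a] braket_self[of _ b])
  then show ?thesis by (simp only: of_real_eq_iff)
qed

lemma tr_kron:
  assumes "A \<in> carrier_mat a a" "B \<in> carrier_mat b b"
  shows "tr (kron A B) = tr A * tr B"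
  using assms by (simp add: tr_def sum_lessThan_mult kron_entry[OF assms] sum_product)


section \<open>Pauli strings\<close>

definition words :: "nat \<Rightarrow> nat list set" where
  "words n = {ws. length ws = n \<and> set ws \<subseteq> {0..3}}"

abbreviation zeros :: "nat \<Rightarrow> nat list" where
  "zeros n \<equiv> replicate n 0"

text \<open>1 if the Pauli matrices with these labels commute, -1 if they anticommute.\<close>

definition letter_sign :: "nat \<Rightarrow> nat \<Rightarrow> int" where
  "letter_sign a b = (if a = 0 \<or> b = 0 \<or> a = b then 1 else - 1)"

text \<open>The scalar in the product of two Pauli matrices; the listed cyclic pairs come from XY =
  iZ and its rotations.\<close>

definition letter_phase :: "nat \<Rightarrow> nat \<Rightarrow> complex" where
  "letter_phase a b = (if a = 0 \<or> b = 0 \<or> a = b then 1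
     else if (a, b) \<in> {(1,2), (2,3), (3,1)} then \<i> else - \<i>)"

text \<open>On the labels 0 to 3, bitwise \<open>xor\<close> is the group law of the Pauli matrices
  modulo phase: two distinct nonzero labels give the third one.\<close>

definition wxor :: "nat list \<Rightarrow> nat list \<Rightarrow> nat list" where
  "wxor u w = map2 xor u w"

definition comm_sign :: "nat list \<Rightarrow> nat list \<Rightarrow> int" where
  "comm_sign u w = prod_list (map2 letter_sign u w)"

definition phase :: "nat list \<Rightarrow> nat list \<Rightarrow> complex" where
  "phase u w = prod_list (map2 letter_phase u w)"

lemma word_op_simps [simp]:
  "wxor (a # u) (b # w) = (xor a b) # wxor u w" "wxor [] w = []" "wxor u [] = []"
  "comm_sign (a # u) (b # w) = letter_sign a b * comm_sign u w" "comm_sign [] w = 1" "comm_sign u [] = 1"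
  "phase (a # u) (b # w) = letter_phase a b * phase u w" "phase [] w = 1" "phase u [] = 1"
  by (auto simp: wxor_def comm_sign_def phase_def)

lemma letter_cases:
  assumes "a \<in> {0..3::nat}" obtains "a = 0" | "a = 1" | "a = 2" | "a = 3"
proof -
  have "a = 0 \<or> a = 1 \<or> a = 2 \<or> a = 3" using assms unfolding atLeastAtMost_iff by linarith
  then show thesis using that by blast
qed

lemma sum_letters: "(\<Sum>a\<in>{0..3::nat}. f a) = f 0 + f 1 + f 2 + f 3" for f :: "nat \<Rightarrow> 'a::comm_monoid_add"
proof -
  have "{0..3::nat} = {0,1,2,3}" by auto
  then show ?thesis by (simp add: add.assoc)
qed

lemma words_0 [simp]: "words 0 = {[]}"
  by (auto simp: words_def)

lemma words_Suc: "words (Suc n) = (\<lambda>(a,w). a # w) ` ({0..3} \<times> words n)"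
  by (auto simp: words_def image_iff length_Suc_conv)

lemma words_induct [consumes 1, case_names Nil Cons]:
  assumes "w \<in> words n" "P 0 []"
    "\<And>n a w. a \<in> {0..3} \<Longrightarrow> w \<in> words n \<Longrightarrow> P n w \<Longrightarrow> P (Suc n) (a # w)"
  shows "P n w"
  using assms(1)
proof (induction n arbitrary: w)
  case 0
  then show ?case using assms(2) by simp
next
  case (Suc n)
  then show ?case using assms(3) by (auto simp: words_Suc)
qed

lemma words_Cons [simp]: "a # w \<in> words (Suc n) \<longleftrightarrow> a \<in> {0..3} \<and> w \<in> words n"
  by (auto simp: words_def)

lemma finite_words [simp]: "finite (words n)"
  by (induction n) (auto simp: words_Suc)

lemma sum_words_Suc:
  "(\<Sum>w\<in>words (Suc n). f w) = (\<Sum>a\<in>{0..3}. \<Sum>w\<in>words n. f (a # w))" for f :: "nat list \<Rightarrow> 'a::comm_monoid_add"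
proof -
  have "inj_on (\<lambda>(a,w). a # w) ({0..3::nat} \<times> words n)" by (auto simp: inj_on_def)
  then show ?thesis unfolding words_Suc
    by (simp add: sum.reindex sum.cartesian_product case_prod_unfold comp_def)
qed

lemma card_words: "card (words n) = 4 ^ n"
proof (induction n)
  case (Suc n)
  have "inj_on (\<lambda>(a,w). a # w) ({0..3::nat} \<times> words n)" by (auto simp: inj_on_def)
  then show ?case using Suc by (simp add: words_Suc card_image card_cartesian_product)
qed simp

lemma zeros_words [simp]: "zeros n \<in> words n"
  by (auto simp: words_def)

lemma append_words [simp]: "u \<in> words m \<Longrightarrow> w \<in> words n \<Longrightarrow> u @ w \<in> words (m + n)"
  by (auto simp: words_def)

lemma take_drop_words:
  assumes "g \<in> words (m + n)" shows "take m g \<in> words m" "drop m g \<in> words n"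
  using assms by (auto simp: words_def dest: in_set_takeD in_set_dropD)

lemma length_words: "w \<in> words n \<Longrightarrow> length w = n"
  by (simp add: words_def)

lemma xor_letter: "a \<in> {0..3} \<Longrightarrow> b \<in> {0..3} \<Longrightarrow> (xor a b :: nat) \<in> {0..3}"
  by (elim letter_cases) (auto simp: One_nat_def)

lemma wxor_words [simp]: "u \<in> words n \<Longrightarrow> w \<in> words n \<Longrightarrow> wxor u w \<in> words n"
proof (induction u arbitrary: w rule: words_induct)
  case (Cons n a u)
  then show ?case using xor_letter by (cases w) (auto simp: words_def)
qed (auto simp: words_def)

lemma wxor_self [simp]: "u \<in> words n \<Longrightarrow> wxor u u = zeros n"
  by (induction u rule: words_induct) auto

lemma wxor_zeros_left [simp]: "u \<in> words n \<Longrightarrow> wxor (zeros n) u = u"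
  by (induction u rule: words_induct) auto

lemma wxor_assoc: "length u = length v \<Longrightarrow> length v = length w \<Longrightarrow> wxor (wxor u v) w = wxor u (wxor v w)"
  by (induction u v w rule: list_induct3) (auto simp: xor.assoc)

lemma wxor_cancel_left [simp]: "u \<in> words n \<Longrightarrow> w \<in> words n \<Longrightarrow> wxor u (wxor u w) = w"
  by (subst wxor_assoc[symmetric]) (auto simp: length_words)

lemma wxor_commute: "wxor u v = wxor v u"
  by (induction u v rule: list_induct2') (auto simp: xor.commute)

lemma wxor_append: "length u = length u' \<Longrightarrow> wxor (u @ w) (u' @ w') = wxor u u' @ wxor w w'"
  by (induction u u' rule: list_induct2) auto

lemma wxor_append_zeros: "length u = length w \<Longrightarrow> wxor (u @ zeros n) (w @ zeros n) = wxor u w @ zeros n"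
  by (simp only: wxor_append wxor_self[OF zeros_words])

lemma letter_sign_cases: "letter_sign a b = 1 \<or> letter_sign a b = -1"
  by (auto simp: letter_sign_def)

lemma comm_sign_cases: "comm_sign u w = 1 \<or> comm_sign u w = -1"
proof (induction u w rule: list_induct2')
  case (4 a u b w)
  then show ?case using letter_sign_cases[of a b] by auto
qed auto

lemma letter_sign_xor:
  "a \<in> {0..3} \<Longrightarrow> b \<in> {0..3} \<Longrightarrow> c \<in> {0..3} \<Longrightarrow> letter_sign (xor a b) c = letter_sign a c * letter_sign b c"
  by (elim letter_cases) (auto simp: letter_sign_def One_nat_def)

lemma comm_sign_wxor:
  "u \<in> words n \<Longrightarrow> v \<in> words n \<Longrightarrow> w \<in> words n \<Longrightarrow> comm_sign (wxor u v) w = comm_sign u w * comm_sign v w"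
proof (induction u arbitrary: v w rule: words_induct)
  case (Cons n a u)
  then show ?case by (cases v; cases w) (auto simp: letter_sign_xor words_def)
qed (auto simp: words_def)

lemma comm_sign_append:
  "length u = length u' \<Longrightarrow> comm_sign (u @ w) (u' @ w') = comm_sign u u' * comm_sign w w'"
  by (induction u u' rule: list_induct2) auto

lemma comm_sign_zeros [simp]: "comm_sign (zeros n) w = 1"
proof (induction n arbitrary: w)
  case (Suc n)
  then show ?case by (cases w) (auto simp: letter_sign_def)
qed simp

text \<open>Orthogonality of characters. The sum factors over the letters, and a nonzero letter
  commutes with exactly two of the four letters.\<close>

lemma sum_comm_sign:
  "g \<in> words n \<Longrightarrow> (\<Sum>w\<in>words n. comm_sign g w) = (if g = zeros n then 4 ^ n else 0)"
proof (induction g rule: words_induct)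
  case (Cons n a g)
  have "(\<Sum>w\<in>words (Suc n). comm_sign (a # g) w) =
    (\<Sum>b\<in>{0..3}. letter_sign a b) * (\<Sum>w\<in>words n. comm_sign g w)"
    by (simp add: sum_words_Suc sum_product)
  moreover have "(\<Sum>b\<in>{0..3}. letter_sign a b) = (if a = 0 then 4 else 0)"
    using \<open>a \<in> {0..3}\<close> by (elim letter_cases) (auto simp: sum_letters letter_sign_def)
  ultimately show ?case using Cons by auto
qed simp

section \<open>Pauli matrices and their tensor products\<close>

lemma pauli_carrier [simp]: "pauli a \<in> carrier_mat 2 2"
  by (auto simp: pauli_def mat_of_rows_list_def)

lemma pauli_0: "pauli 0 = 1\<^sub>m 2"
  by (simp add: pauli_def)

lemma pauli_entries:
  "pauli 0 $$ (0,0) = 1" "pauli 0 $$ (0,1) = 0" "pauli 0 $$ (1,0) = 0" "pauli 0 $$ (1,1) = 1"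
  "pauli 1 $$ (0,0) = 0" "pauli 1 $$ (0,1) = 1" "pauli 1 $$ (1,0) = 1" "pauli 1 $$ (1,1) = 0"
  "pauli 2 $$ (0,0) = 0" "pauli 2 $$ (0,1) = - \<i>" "pauli 2 $$ (1,0) = \<i>" "pauli 2 $$ (1,1) = 0"
  "pauli 3 $$ (0,0) = 1" "pauli 3 $$ (0,1) = 0" "pauli 3 $$ (1,0) = 0" "pauli 3 $$ (1,1) = - 1"
  by (auto simp: pauli_def mat_of_rows_list_def)

lemma less_2_nat: "i < (2::nat) \<longleftrightarrow> i = 0 \<or> i = 1"
  by auto

lemma mat2_eqI:
  assumes "A \<in> carrier_mat 2 2" "B \<in> carrier_mat 2 2"
    "A $$ (0,0) = B $$ (0,0)" "A $$ (0,1) = B $$ (0,1)" "A $$ (1,0) = B $$ (1,0)" "A $$ (1,1) = B $$ (1,1)"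
  shows "A = B"
  using assms by (intro eq_matI) (auto simp: less_2_nat)

lemma sum_less_2: "(\<Sum>k<2. f k) = f 0 + f (1::nat)" for f :: "nat \<Rightarrow> 'a::comm_monoid_add"
  by (simp add: numeral_2_eq_2 One_nat_def)

lemma mat2_mult_entry:
  "i < 2 \<Longrightarrow> j < 2 \<Longrightarrow> (pauli a * pauli b) $$ (i,j) = pauli a $$ (i,0) * pauli b $$ (0,j) + pauli a $$ (i,1) * pauli b $$ (1,j)"
  by (subst mat_mult_entry[of _ 2 2 _ 2]) (auto simp: sum_less_2)

lemma pauli_smult_entry:
  "i < 2 \<Longrightarrow> j < 2 \<Longrightarrow> (c \<cdot>\<^sub>m pauli a) $$ (i,j) = c * pauli a $$ (i,j)"
  using carrier_matD[OF pauli_carrier[of a]] by simp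

lemma nat_xor_letters:
  "xor (1::nat) 1 = 0" "xor (1::nat) 2 = 3" "xor (1::nat) 3 = 2"
  "xor (2::nat) 1 = 3" "xor (2::nat) 2 = 0" "xor (2::nat) 3 = 1"
  "xor (3::nat) 1 = 2" "xor (3::nat) 2 = 1" "xor (3::nat) 3 = 0"
  by (auto simp: One_nat_def)

lemma pauli_mult:
  assumes "a \<in> {0..3}" "b \<in> {0..3}"
  shows "pauli a * pauli b = letter_phase a b \<cdot>\<^sub>m pauli (xor a b)"
proof (rule mat2_eqI)
  show "pauli a * pauli b \<in> carrier_mat 2 2" by (rule mult_carrier_mat[of _ 2 2]) auto
qed (use assms in \<open>elim letter_cases;
    simp add: mat2_mult_entry pauli_smult_entry pauli_entries letter_phase_def nat_xor_letters del: index_mult_mat index_smult_mat\<close>)+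

lemma letter_phase_commute:
  "letter_phase a b = of_int (letter_sign a b) * letter_phase b a" if "a \<in> {0..3}" "b \<in> {0..3}"
  using that by (elim letter_cases) (auto simp: letter_phase_def letter_sign_def)

lemma pauli_adj: "a \<in> {0..3} \<Longrightarrow> adj (pauli a) = pauli a"
  by (rule mat2_eqI; (elim letter_cases)?)
    (auto simp: pauli_entries carrier_matD[OF pauli_carrier])

lemma smult_smult_assoc_mat: "a \<cdot>\<^sub>m (b \<cdot>\<^sub>m A) = (a * b) \<cdot>\<^sub>m A" for A :: "complex mat"
  by (rule eq_matI) auto

lemma smult_one_mat [simp]: "1 \<cdot>\<^sub>m A = A" for A :: "complex mat"
  by (rule eq_matI) auto

lemma pauli_string_carrier: "pauli_string w \<in> carrier_mat (2 ^ length w) (2 ^ length w)"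
proof (induction w)
  case (Cons a w)
  then show ?case using kron_carrier[OF pauli_carrier Cons] by simp
qed simp

lemma pauli_string_dim [simp]: "w \<in> words n \<Longrightarrow> pauli_string w \<in> carrier_mat (2 ^ n) (2 ^ n)"
  using pauli_string_carrier[of w] by (simp add: length_words)

lemma pauli_string_adj [simp]: "w \<in> words n \<Longrightarrow> adj (pauli_string w) = pauli_string w"
proof (induction w rule: words_induct)
  case Nil
  show ?case by (rule eq_matI) auto
qed (auto simp: adj_kron pauli_adj)

lemma pauli_string_mult:
  "u \<in> words n \<Longrightarrow> w \<in> words n \<Longrightarrow>
    pauli_string u * pauli_string w = phase u w \<cdot>\<^sub>m pauli_string (wxor u w)"
proof (induction u arbitrary: w rule: words_induct)
  case Nil
  then show ?case by (simp add: smult_one_mat)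
next
  case (Cons n a u)
  then obtain b v where w: "w = b # v" "b \<in> {0..3}" "v \<in> words n" by (auto simp: words_Suc)
  have "pauli_string (a # u) * pauli_string w = kron (pauli a * pauli b) (pauli_string u * pauli_string v)"
    using Cons w by (simp add: kron_mult[of _ 2 2 _ 2 _ "2^n" "2^n" _ "2^n"])
  then show ?case using Cons w
    by (simp add: pauli_mult kron_smult_left kron_smult_right smult_smult_assoc_mat mult.commute)
qed

lemma phase_commute:
  "u \<in> words n \<Longrightarrow> w \<in> words n \<Longrightarrow> phase u w = of_int (comm_sign u w) * phase w u"
proof (induction u arbitrary: w rule: words_induct)
  case (Cons n a u)
  then obtain b v where w: "w = b # v" "b \<in> {0..3}" "v \<in> words n" by (auto simp: words_Suc)
  show ?case using Cons w letter_phase_commute[of a b] by (simp del: atLeastAtMost_iff)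
qed simp

lemma phase_nonzero: "phase u w \<noteq> 0"
  by (induction u w rule: list_induct2') (auto simp: letter_phase_def)

lemma phase_self [simp]: "phase w w = 1"
  by (induction w) (auto simp: letter_phase_def)

lemma pauli_string_zeros [simp]: "pauli_string (zeros n) = 1\<^sub>m (2 ^ n)"
  by (induction n) (auto simp: pauli_0 kron_one)

lemma pauli_string_append: "pauli_string (u @ w) = kron (pauli_string u) (pauli_string w)"
  by (induction u) (auto simp: kron_assoc kron_one_one_left)

lemma sum_pauli_entries:
  assumes "i < 2" "j < 2" "k < 2" "l < 2"
  shows "(\<Sum>a\<in>{0..3}. pauli a $$ (i,j) * pauli a $$ (k,l)) = (if i = l \<and> j = k then 2 else 0)"
  using assms unfolding less_2_nat by (elim disjE) (simp_all add: sum_letters pauli_entries)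

text \<open>In entries, the identity that P tensor P, summed over all Pauli strings P, is
  \<open>2^n\<close> times the swap operator.\<close>

lemma sum_pauli_string_entries:
  "i < 2^n \<Longrightarrow> j < 2^n \<Longrightarrow> k < 2^n \<Longrightarrow> l < 2^n \<Longrightarrow>
    (\<Sum>w\<in>words n. pauli_string w $$ (i,j) * pauli_string w $$ (k,l)) = (if i = l \<and> j = k then 2^n else 0)"
proof (induction n arbitrary: i j k l)
  case 0
  then show ?case by (simp add: One_nat_def)
next
  case (Suc n)
  let ?d = "\<lambda>i::nat. i div 2^n" and ?m = "\<lambda>i::nat. i mod 2^n"
  have d: "?d i < 2" "?d j < 2" "?d k < 2" "?d l < 2"
    and m: "?m i < 2^n" "?m j < 2^n" "?m k < 2^n" "?m l < 2^n"
    using Suc.prems by (auto intro: less_mult_imp_div_less)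
  have e: "pauli_string (a # w) $$ (i,j) = pauli a $$ (?d i, ?d j) * pauli_string w $$ (?m i, ?m j)"
    if "w \<in> words n" "i < 2^Suc n" "j < 2^Suc n" for a w i j
    using that carrier_matD[OF pauli_string_dim[OF that(1)]] carrier_matD[OF pauli_carrier[of a]]
    by (simp add: kron_index)
  have "(\<Sum>w\<in>words (Suc n). pauli_string w $$ (i,j) * pauli_string w $$ (k,l)) =
     (\<Sum>a\<in>{0..3}. pauli a $$ (?d i,?d j) * pauli a $$ (?d k,?d l)) *
     (\<Sum>w\<in>words n. pauli_string w $$ (?m i,?m j) * pauli_string w $$ (?m k,?m l))"
    unfolding sum_words_Suc sum_product using Suc.prems
    by (intro sum.cong refl) (simp add: e del: pauli_string.simps power_Suc)
  also have "\<dots> = (if (?d i = ?d l \<and> ?m i = ?m l) \<and> (?d j = ?d k \<and> ?m j = ?m k) then 2^Suc n else 0)"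
    using Suc.IH[OF m] sum_pauli_entries[OF d] by simp
  also have "\<dots> = (if i = l \<and> j = k then 2^Suc n else 0)"
    by (metis div_mult_mod_eq)
  finally show ?case .
qed

text \<open>The swap identity between product vectors, which exchanges \<open>b\<close> and
  \<open>d\<close>. With four equal vectors it gives the sum of all squared Pauli expectations; with
  two pairs it computes the norm of a contraction.\<close>

lemma pauli_completeness:
  assumes "a \<in> carrier_mat (2^n) 1" "b \<in> carrier_mat (2^n) 1" "c \<in> carrier_mat (2^n) 1" "d \<in> carrier_mat (2^n) 1"
  shows "(\<Sum>w\<in>words n. braket a (pauli_string w * b) * braket c (pauli_string w * d)) = 2^n * braket a d * braket c b"
proof -
  let ?D = "2^n :: nat"
  let ?f = "\<lambda>i j k l. cnj (a $$ (i,0)) * b $$ (j,0) * (cnj (c $$ (k,0)) * d $$ (l,0))"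
  have "(\<Sum>w\<in>words n. braket a (pauli_string w * b) * braket c (pauli_string w * d)) =
    (\<Sum>w\<in>words n. \<Sum>i<?D. \<Sum>k<?D. \<Sum>j<?D. \<Sum>l<?D. ?f i j k l * (pauli_string w $$ (i,j) * pauli_string w $$ (k,l)))"
    using assms by (intro sum.cong refl) (simp add: braket_mat[of _ ?D _ ?D] sum_product mult_ac)
  also have "\<dots> = (\<Sum>i<?D. \<Sum>k<?D. \<Sum>j<?D. \<Sum>l<?D. ?f i j k l * (\<Sum>w\<in>words n. pauli_string w $$ (i,j) * pauli_string w $$ (k,l)))"
    by (simp add: sum.swap[of _ _ "words n"] sum_distrib_left)
  also have "\<dots> = (\<Sum>i<?D. \<Sum>k<?D. \<Sum>j<?D. \<Sum>l<?D. (if i = l then if j = k then ?f i j k l * 2^n else 0 else 0))"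
    by (intro sum.cong refl) (simp add: sum_pauli_string_entries)
  also have "\<dots> = (\<Sum>i<?D. \<Sum>k<?D. ?f i k k i * 2^n)"
    by (intro sum.cong refl) simp
  also have "\<dots> = 2^n * braket a d * braket c b"
    using assms by (simp add: braket_sum[of _ ?D] sum_product sum_distrib_left mult_ac)
  finally show ?thesis .
qed


section \<open>Stabilizer groups\<close>

text \<open>Pauli words are taken up to phase; the sign of a stabilizer is recovered from the vector it fixes.\<close>

definition stabs :: "nat \<Rightarrow> complex mat \<Rightarrow> nat list set" where
  "stabs n v = {w \<in> words n. \<exists>s. (s = 1 \<or> s = - 1) \<and> pauli_string w * v = s \<cdot>\<^sub>m v}"

definition word_group :: "nat \<Rightarrow> nat list set \<Rightarrow> bool" where
  "word_group n G \<longleftrightarrow> G \<subseteq> words n \<and> zeros n \<in> G \<and> (\<forall>u\<in>G. \<forall>w\<in>G. wxor u w \<in> G)"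

definition centralizer :: "nat \<Rightarrow> nat list set \<Rightarrow> nat list set" where
  "centralizer n G = {w \<in> words n. \<forall>g\<in>G. comm_sign g w = 1}"

lemma comm_sign_neq_1: "comm_sign u w \<noteq> 1 \<Longrightarrow> comm_sign u w = -1"
  using comm_sign_cases by blast

text \<open>Double counting of the character sum over all pairs of a word and a group element.\<close>

lemma card_centralizer:
  assumes "word_group n G"
  shows "card (centralizer n G) * card G = 4 ^ n"
proof -
  have G: "G \<subseteq> words n" "zeros n \<in> G" and cl: "\<And>u w. u \<in> G \<Longrightarrow> w \<in> G \<Longrightarrow> wxor u w \<in> G"
    using assms by (auto simp: word_group_def)
  then have fin: "finite G" using finite_subset finite_words by blast
  have row: "(\<Sum>g\<in>G. comm_sign g w) = (if w \<in> centralizer n G then int (card G) else 0)" if w: "w \<in> words n" for w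
  proof (cases "w \<in> centralizer n G")
    case True
    then show ?thesis by (simp add: centralizer_def)
  next
    case False
    then obtain h where h: "h \<in> G" "comm_sign h w = -1"
      using w comm_sign_neq_1 unfolding centralizer_def by blast
    \<comment> \<open>Translation by \<open>h\<close> permutes the group and negates every term, so
      the sum equals its own negative.\<close>
    have "(\<Sum>g\<in>G. comm_sign g w) = (\<Sum>g\<in>G. comm_sign (wxor h g) w)"
      by (rule sum.reindex_bij_witness[of _ "wxor h" "wxor h"])
        (simp_all add: h cl wxor_cancel_left[OF subsetD[OF G(1)] subsetD[OF G(1)]])
    also have "\<dots> = (\<Sum>g\<in>G. - comm_sign g w)"
      using h w by (intro sum.cong refl) (simp add: comm_sign_wxor[OF subsetD[OF G(1)] subsetD[OF G(1)]])
    finally have "(\<Sum>g\<in>G. comm_sign g w) = 0" by (simp add: sum_negf)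
    then show ?thesis using False by simp
  qed
  have "int (card (centralizer n G) * card G) = (\<Sum>w\<in>centralizer n G. int (card G))" by simp
  also have "\<dots> = (\<Sum>w\<in>words n. if w \<in> centralizer n G then int (card G) else 0)"
    by (rule sum.mono_neutral_cong_left) (auto simp: centralizer_def)
  also have "\<dots> = (\<Sum>w\<in>words n. \<Sum>g\<in>G. comm_sign g w)"
    by (intro sum.cong refl) (simp add: row)
  also have "\<dots> = (\<Sum>g\<in>G. \<Sum>w\<in>words n. comm_sign g w)" by (rule sum.swap)
  also have "\<dots> = (\<Sum>g\<in>G. if g = zeros n then 4 ^ n else 0)"
    by (intro sum.cong refl) (simp add: sum_comm_sign[OF subsetD[OF G(1)]])
  also have "\<dots> = int (4 ^ n)" using G fin by simp
  finally show ?thesis by (simp only: of_nat_eq_iff)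
qed

text \<open>Words have order two, so adjoining a new word adds exactly one coset. This doubling
  drives both the counting of group orders and the greedy extension.\<close>

lemma word_group_extend:
  assumes "word_group n G" "w \<in> words n" "w \<notin> G"
  shows "word_group n (G \<union> wxor w ` G)" "card (G \<union> wxor w ` G) = 2 * card G"
proof -
  have G: "G \<subseteq> words n" "zeros n \<in> G" and cl: "\<And>u w. u \<in> G \<Longrightarrow> w \<in> G \<Longrightarrow> wxor u w \<in> G"
    using assms by (auto simp: word_group_def)
  then have fin: "finite G" using finite_subset finite_words by blast
  have len: "\<And>g. g \<in> G \<Longrightarrow> length g = n" "length w = n" by (simp_all add: length_words[OF subsetD[OF G(1)]] length_words[OF assms(2)])
  have 1: "wxor g (wxor w h) = wxor w (wxor g h)" if "g \<in> G" "h \<in> G" for g h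
  proof -
    have "wxor g (wxor w h) = wxor (wxor g w) h" using that len by (simp add: wxor_assoc)
    also have "\<dots> = wxor (wxor w g) h" by (simp only: wxor_commute)
    also have "\<dots> = wxor w (wxor g h)" using that len by (simp add: wxor_assoc)
    finally show ?thesis .
  qed
  have 2: "wxor (wxor w g) (wxor w h) = wxor g h" if "g \<in> G" "h \<in> G" for g h
  proof -
    have h: "h \<in> words n" using that G by auto
    have "length (wxor w h) = n" using wxor_words[OF assms(2) h] by (rule length_words)
    then have "wxor (wxor g w) (wxor w h) = wxor g (wxor w (wxor w h))"
      using that len by (simp add: wxor_assoc)
    then show ?thesis using assms(2) h by (simp add: wxor_commute[of w g])
  qed
  show "word_group n (G \<union> wxor w ` G)"
    unfolding word_group_def
  proof (intro conjI ballI)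
    fix x y assume "x \<in> G \<union> wxor w ` G" "y \<in> G \<union> wxor w ` G"
    moreover have "wxor (wxor w g) h = wxor w (wxor g h)" if "g \<in> G" "h \<in> G" for g h
      using that len by (simp add: wxor_assoc)
    ultimately show "wxor x y \<in> G \<union> wxor w ` G" using cl 1 2 by (elim UnE imageE) auto
  qed (use G assms(2) in auto)
  have "inj_on (wxor w) G"
    by (rule inj_on_inverseI[where g="wxor w"]) (use G assms(2) in auto)
  moreover have "G \<inter> wxor w ` G = {}"
  proof (rule ccontr)
    assume "G \<inter> wxor w ` G \<noteq> {}"
    then obtain g where g: "g \<in> G" "wxor w g \<in> G" by auto
    then have "wxor g (wxor g w) \<in> G" using cl wxor_commute by metis
    then show False using g G assms by (auto simp: subset_iff)
  qed
  ultimately show "card (G \<union> wxor w ` G) = 2 * card G"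
    using fin by (simp add: card_Un_disjoint card_image)
qed

text \<open>A largest subgroup whose order is a power of two must be everything, since otherwise it
  could be doubled. This makes the number of logical qubits an integer.\<close>

lemma card_word_group:
  assumes G: "word_group n G" shows "\<exists>t. card G = 2 ^ t"
proof -
  have fin: "finite G" using G by (auto simp: word_group_def intro: finite_subset[OF _ finite_words])
  let ?P = "\<lambda>H. word_group n H \<and> H \<subseteq> G \<and> (\<exists>t. card H = 2 ^ t)"
  have base: "?P {zeros n}" using G by (auto simp: word_group_def intro: exI[of _ 0])
  have "\<forall>H. ?P H \<longrightarrow> card H < Suc (card G)" using fin by (auto simp: less_Suc_eq_le card_mono)
  from ex_has_greatest_nat[of ?P "{zeros n}" card "Suc (card G)", OF base this]
  obtain H where H: "?P H" and max: "\<And>H'. ?P H' \<Longrightarrow> card H' \<le> card H" by blast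
  have "H = G"
  proof (rule ccontr)
    assume "H \<noteq> G"
    then obtain w where w: "w \<in> G" "w \<notin> H" using H by auto
    then have ww: "w \<in> words n" using G by (auto simp: word_group_def)
    have "H \<union> wxor w ` H \<subseteq> G" using H G w by (auto simp: word_group_def)
    moreover from H obtain t where "card H = 2 ^ t" by blast
    ultimately have "?P (H \<union> wxor w ` H)"
      using word_group_extend[of n H w] ww w(2) H by (auto intro: exI[of _ "Suc t"])
    from max[OF this] show False using word_group_extend(2)[of n H w] ww w(2) H by auto
  qed
  then show ?thesis using H by blast
qed

section \<open>The action of Pauli strings on vectors\<close>

lemma pauli_vec_carrier [simp]:
  "w \<in> words n \<Longrightarrow> v \<in> carrier_mat (2^n) 1 \<Longrightarrow> pauli_string w * v \<in> carrier_mat (2^n) 1"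
  by (rule mult_carrier_mat[OF pauli_string_dim])

lemma pauli_vec_mult:
  assumes "u \<in> words n" "w \<in> words n" "v \<in> carrier_mat (2^n) 1"
  shows "pauli_string u * (pauli_string w * v) = phase u w \<cdot>\<^sub>m (pauli_string (wxor u w) * v)"
  using assms assoc_mult_mat[OF pauli_string_dim[OF assms(1)] pauli_string_dim[OF assms(2)] assms(3), symmetric]
  by (simp add: pauli_string_mult mult_smult_assoc_mat[of _ "2^n" "2^n" _ 1] del: assoc_mult_mat)

lemma pauli_vec_invol [simp]:
  assumes "w \<in> words n" "v \<in> carrier_mat (2^n) 1"
  shows "pauli_string w * (pauli_string w * v) = v"
proof -
  have "wxor w w = zeros n" using assms by simp
  then show ?thesis using assms by (simp add: pauli_vec_mult[of w n w] left_mult_one_mat[of _ "2^n" 1] del: wxor_self)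
qed

lemma pauli_vec_commute:
  assumes "u \<in> words n" "w \<in> words n" "v \<in> carrier_mat (2^n) 1"
  shows "pauli_string u * (pauli_string w * v) = of_int (comm_sign u w) \<cdot>\<^sub>m (pauli_string w * (pauli_string u * v))"
  using assms by (simp add: pauli_vec_mult[of u n w] pauli_vec_mult[of w n u] wxor_commute[of w u] phase_commute[of u n w]
      smult_smult_assoc_mat)

lemma pauli_vec_smult:
  "w \<in> words n \<Longrightarrow> v \<in> carrier_mat (2^n) 1 \<Longrightarrow> pauli_string w * (c \<cdot>\<^sub>m v) = c \<cdot>\<^sub>m (pauli_string w * v)"
  by (rule mult_smult_distrib[OF pauli_string_dim])

lemma pauli_vec_add:
  "w \<in> words n \<Longrightarrow> u \<in> carrier_mat (2^n) 1 \<Longrightarrow> v \<in> carrier_mat (2^n) 1 \<Longrightarrow>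
    pauli_string w * (u + v) = pauli_string w * u + pauli_string w * v"
  by (rule mult_add_distrib_mat[OF pauli_string_dim])

lemma pauli_vec_hermitian:
  "w \<in> words n \<Longrightarrow> u \<in> carrier_mat (2^n) 1 \<Longrightarrow> v \<in> carrier_mat (2^n) 1 \<Longrightarrow>
    braket u (pauli_string w * v) = braket (pauli_string w * u) v"
  using braket_adjoint[of u "2^n" "pauli_string w" "2^n" v] by simp

lemma pauli_expectation_real:
  assumes "w \<in> words n" "v \<in> carrier_mat (2^n) 1"
  shows "braket v (pauli_string w * v) = complex_of_real (Re (braket v (pauli_string w * v)))"
proof -
  have "braket v (pauli_string w * v) = cnj (braket v (pauli_string w * v))"
    using braket_cnj[of v "2^n" "pauli_string w * v"] pauli_vec_hermitian[OF assms(1,2,2)] assms by simp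
  then show ?thesis by (metis Reals_cnj_iff of_real_Re)
qed

lemma nonzero_entry:
  assumes "v \<in> carrier_mat D 1" "v \<noteq> 0\<^sub>m D 1"
  obtains i where "i < D" "v $$ (i,0) \<noteq> 0"
proof -
  have "\<exists>i<D. v $$ (i,0) \<noteq> 0"
  proof (rule ccontr)
    assume "\<not> (\<exists>i<D. v $$ (i,0) \<noteq> 0)"
    then have "v = 0\<^sub>m D 1" using assms(1) by (intro eq_matI) auto
    then show False using assms by simp
  qed
  then show thesis using that by blast
qed

lemma smult_vec_inj:
  fixes v :: "complex mat"
  assumes "v \<in> carrier_mat D 1" "v \<noteq> 0\<^sub>m D 1" "a \<cdot>\<^sub>m v = b \<cdot>\<^sub>m v"
  shows "a = b"
proof -
  obtain i where i: "i < D" "v $$ (i,0) \<noteq> 0" using nonzero_entry assms by blast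
  from arg_cong[OF assms(3), of "\<lambda>M. M $$ (i,0)"] have "a * v $$ (i,0) = b * v $$ (i,0)"
    using i(1) carrier_matD[OF assms(1)] by simp
  then show ?thesis using i(2) by simp
qed

lemma pauli_eigenvalue:
  assumes "w \<in> words n" "v \<in> carrier_mat (2^n) 1" "v \<noteq> 0\<^sub>m (2^n) 1" "pauli_string w * v = c \<cdot>\<^sub>m v"
  shows "c = 1 \<or> c = - 1"
proof -
  have "1 \<cdot>\<^sub>m v = (c * c) \<cdot>\<^sub>m v"
    using pauli_vec_invol[OF assms(1,2)] assms
    by (simp add: pauli_vec_smult smult_smult_assoc_mat)
  from smult_vec_inj[OF assms(2,3) this] show ?thesis by (metis square_eq_1_iff)
qed

section \<open>The stabilizer group of a vector and its expectations\<close>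

lemma stabs_words: "w \<in> stabs n v \<Longrightarrow> w \<in> words n"
  by (simp add: stabs_def)

lemma finite_stabs [simp]: "finite (stabs n v)"
  by (rule finite_subset[of _ "words n"]) (auto simp: stabs_def)

lemma stabsE:
  assumes "w \<in> stabs n v"
  obtains s where "s = 1 \<or> s = - 1" "pauli_string w * v = s \<cdot>\<^sub>m v" "w \<in> words n"
  using assms by (auto simp: stabs_def)

text \<open>The product of two stabilizers is a Pauli string up to a phase, which a priori could be
  imaginary. The eigenvalue is still a sign, because Pauli strings square to the identity.\<close>

lemma word_group_stabs:
  assumes v: "v \<in> carrier_mat (2^n) 1" "v \<noteq> 0\<^sub>m (2^n) 1"
  shows "word_group n (stabs n v)"
  unfolding word_group_def
proof (intro conjI ballI)
  show "zeros n \<in> stabs n v" using v(1) left_mult_one_mat[OF v(1)] by (auto simp: stabs_def intro!: exI[of _ 1])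
  fix u w assume u: "u \<in> stabs n v" and w: "w \<in> stabs n v"
  obtain s where s: "pauli_string u * v = s \<cdot>\<^sub>m v" and [simp]: "u \<in> words n"
    using u by (rule stabsE)
  obtain t where t: "pauli_string w * v = t \<cdot>\<^sub>m v" and [simp]: "w \<in> words n"
    using w by (rule stabsE)
  have "phase u w \<cdot>\<^sub>m (pauli_string (wxor u w) * v) = (t * s) \<cdot>\<^sub>m v"
    using pauli_vec_mult[of u n w v] pauli_vec_smult[of u n v t] v(1) s t
    by (simp only: \<open>u \<in> words n\<close> \<open>w \<in> words n\<close> smult_smult_assoc_mat simp_thms)
  then have "(inverse (phase u w) * phase u w) \<cdot>\<^sub>m (pauli_string (wxor u w) * v) = (inverse (phase u w) * (t * s)) \<cdot>\<^sub>m v"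
    by (metis smult_smult_assoc_mat)
  then have *: "pauli_string (wxor u w) * v = (inverse (phase u w) * (t * s)) \<cdot>\<^sub>m v"
    by (simp add: phase_nonzero)
  then show "wxor u w \<in> stabs n v"
    using pauli_eigenvalue[OF _ v *] by (auto simp: stabs_def)
qed (auto simp: stabs_def)

text \<open>Two anticommuting words with the common eigenvector \<open>v\<close> would give
  \<open>v\<close> equal to its negative.\<close>

lemma stabs_commute:
  assumes v: "v \<in> carrier_mat (2^n) 1" "v \<noteq> 0\<^sub>m (2^n) 1" and "u \<in> stabs n v" "w \<in> stabs n v"
  shows "comm_sign u w = 1"
proof -
  obtain s where s: "s = 1 \<or> s = - 1" "pauli_string u * v = s \<cdot>\<^sub>m v" and [simp]: "u \<in> words n"
    using assms(3) by (rule stabsE)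
  obtain t where t: "t = 1 \<or> t = - 1" "pauli_string w * v = t \<cdot>\<^sub>m v" and [simp]: "w \<in> words n"
    using assms(4) by (rule stabsE)
  have "(t * s) \<cdot>\<^sub>m v = (of_int (comm_sign u w) * (s * t)) \<cdot>\<^sub>m v"
    using pauli_vec_commute[of u n w v] pauli_vec_smult[of u n v t] pauli_vec_smult[of w n v s] v(1) s(2) t(2)
    by (simp only: \<open>u \<in> words n\<close> \<open>w \<in> words n\<close> smult_smult_assoc_mat simp_thms)
  from smult_vec_inj[OF v this] show ?thesis using s(1) t(1) comm_sign_cases[of u w] by auto
qed

text \<open>Applying \<open>g\<close> to \<open>v\<close> changes only its sign and so preserves the
  expectation, while moving \<open>g\<close> through \<open>w\<close> negates it.\<close>

lemma expectation_zero:
  assumes v: "v \<in> carrier_mat (2^n) 1" and w: "w \<in> words n" and g: "g \<in> stabs n v" and c: "comm_sign g w = -1"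
  shows "braket v (pauli_string w * v) = 0"
proof -
  obtain s where s: "s = 1 \<or> s = - 1" "pauli_string g * v = s \<cdot>\<^sub>m v" and [simp]: "g \<in> words n"
    using g by (rule stabsE)
  let ?x = "braket v (pauli_string w * v)"
  have gv: "pauli_string g * v \<in> carrier_mat (2^n) 1" and wv: "pauli_string w * v \<in> carrier_mat (2^n) 1"
    using v w by auto
  have "pauli_string g * (pauli_string w * (pauli_string g * v)) =
      of_int (comm_sign g w) \<cdot>\<^sub>m (pauli_string w * (pauli_string g * (pauli_string g * v)))"
    by (rule pauli_vec_commute[OF \<open>g \<in> words n\<close> w gv])
  then have 1: "pauli_string g * (pauli_string w * (pauli_string g * v)) = (- 1) \<cdot>\<^sub>m (pauli_string w * v)"
    by (simp only: c pauli_vec_invol[OF \<open>g \<in> words n\<close> v] of_int_minus of_int_1)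
  have "cnj s * s * ?x = braket (s \<cdot>\<^sub>m v) (s \<cdot>\<^sub>m (pauli_string w * v))"
    using v wv by (simp add: braket_smult_right[of _ "2^n"] braket_smult_left[of _ "2^n"])
  also have "\<dots> = braket (pauli_string g * v) (pauli_string w * (pauli_string g * v))"
    by (simp only: s(2) pauli_vec_smult[OF w v])
  also have "\<dots> = braket v (pauli_string g * (pauli_string w * (pauli_string g * v)))"
    using v w gv by (intro pauli_vec_hermitian[symmetric]) auto
  also have "\<dots> = - ?x" unfolding 1 using braket_smult_right[OF v wv, of "-1"] by simp
  finally show ?thesis using s(1) by auto
qed

text \<open>An averaging argument, with \<open>g\<close> the order of the stabilizer group. All
  squared expectations sum to \<open>2^n * (nsq v)\<^sup>2\<close>; words outside the centralizer
  contribute nothing, and the group itself contributes \<open>g * (nsq v)\<^sup>2\<close>. The rest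
  is spread over \<open>4^n / g - g\<close> words, so in units of \<open>(nsq v)\<^sup>2\<close> the
  average is \<open>g / (2^n + g)\<close>, which is at least \<open>1 / (2^r + 1)\<close>.\<close>

lemma exists_large_expectation:
  assumes v: "v \<in> carrier_mat (2^n) 1" "v \<noteq> 0\<^sub>m (2^n) 1"
    and small: "card (stabs n v) < 2^n" and r: "2^n \<le> card (stabs n v) * 2^r"
  shows "\<exists>w\<in>centralizer n (stabs n v) - stabs n v.
    (nsq v)\<^sup>2 \<le> (2^r + 1) * (Re (braket v (pauli_string w * v)))\<^sup>2"
proof (rule ccontr)
  assume neg: "\<not> ?thesis"
  let ?G = "stabs n v" and ?e = "\<lambda>w. (Re (braket v (pauli_string w * v)))\<^sup>2"
  let ?C = "centralizer n ?G"
  have grp: "word_group n ?G" by (rule word_group_stabs[OF v])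
  have GC: "?G \<subseteq> ?C" using stabs_commute[OF v] by (auto simp: centralizer_def stabs_words)
  have finC: "finite ?C" by (rule finite_subset[of _ "words n"]) (auto simp: centralizer_def)
  have pos: "nsq v > 0" using nsq_eq_0_iff[OF v(1)] v(2) nsq_nonneg[of v] by linarith
  have "(\<Sum>w\<in>words n. complex_of_real (?e w)) = (\<Sum>w\<in>words n. braket v (pauli_string w * v) * braket v (pauli_string w * v))"
    using v(1) by (intro sum.cong refl) (metis of_real_power pauli_expectation_real power2_eq_square)
  also have "\<dots> = complex_of_real (2^n * (nsq v)\<^sup>2)"
    using v by (simp add: pauli_completeness braket_self[of _ "2^n"] power2_eq_square)
  finally have "complex_of_real (\<Sum>w\<in>words n. ?e w) = complex_of_real (2^n * (nsq v)\<^sup>2)"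
    by (simp only: of_real_sum)
  then have tot: "(\<Sum>w\<in>words n. ?e w) = 2^n * (nsq v)\<^sup>2"
    by (simp only: of_real_eq_iff)
  have "(\<Sum>w\<in>words n. ?e w) = (\<Sum>w\<in>?C. ?e w)"
  proof (rule sum.mono_neutral_right)
    show "\<forall>w\<in>words n - ?C. ?e w = 0"
    proof
      fix w assume "w \<in> words n - ?C"
      then obtain g where "g \<in> ?G" "comm_sign g w = -1" "w \<in> words n"
        using comm_sign_neq_1 unfolding centralizer_def by blast
      then show "?e w = 0" using expectation_zero[OF v(1)] by simp
    qed
  qed (auto simp: centralizer_def)
  also have "\<dots> = (\<Sum>w\<in>?C - ?G. ?e w) + (\<Sum>w\<in>?G. ?e w)"
    using GC finC by (simp add: sum.subset_diff)
  also have "(\<Sum>w\<in>?G. ?e w) = (\<Sum>w\<in>?G. (nsq v)\<^sup>2)"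
  proof (intro sum.cong refl)
    fix w assume "w \<in> ?G"
    then obtain s where "s = 1 \<or> s = - 1" "pauli_string w * v = s \<cdot>\<^sub>m v" by (rule stabsE)
    then show "?e w = (nsq v)\<^sup>2"
      using v(1) by (auto simp: braket_smult_right[of _ "2^n"] braket_self[of _ "2^n"])
  qed
  finally have sumC: "(\<Sum>w\<in>?C - ?G. ?e w) = (2^n - real (card ?G)) * (nsq v)\<^sup>2"
    using tot by (simp add: algebra_simps)
  define g where "g = real (card ?G)"
  define c where "c = real (card ?C)"
  have gpos: "g > 0" using grp by (auto simp: g_def word_group_def card_gt_0_iff)
  have cg: "c * g = 2^n * 2^n"
  proof -
    have "c * g = real (4^n)" unfolding c_def g_def card_centralizer[OF grp, symmetric] by simp
    also have "\<dots> = 2^n * 2^n" by (simp add: power_mult_distrib[symmetric])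
    finally show ?thesis .
  qed
  have gl: "g < 2^n" using of_nat_less_iff[where 'a=real, THEN iffD2, OF small] by (simp add: g_def)
  have gr: "2^n \<le> g * 2^r" using of_nat_mono[where 'a=real, OF r] by (simp add: g_def)
  have cardCG: "real (card (?C - ?G)) = c - g"
    using GC finC by (simp add: card_Diff_subset c_def g_def of_nat_diff card_mono)
  have ne: "?C - ?G \<noteq> {}"
  proof
    assume "?C - ?G = {}"
    then have "c = g" using cardCG by (simp only: card.empty of_nat_0 right_minus_eq eq_commute)
    then have "2^n * 2^n = g * g" using cg by (simp only:)
    moreover have "g * g < 2^n * 2^n" using gl gpos by (intro mult_strict_mono) auto
    ultimately show False by simp
  qed
  have "(\<Sum>w\<in>?C - ?G. (2^r + 1) * ?e w) < (\<Sum>w\<in>?C - ?G. (nsq v)\<^sup>2)"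
    using neg ne finC by (intro sum_strict_mono) (auto simp: not_le)
  then have "(2^r + 1) * ((2^n - g) * (nsq v)\<^sup>2) < (c - g) * (nsq v)\<^sup>2"
    using sumC cardCG by (simp add: sum_distrib_left[symmetric] g_def)
  then have "(2^r + 1) * (2^n - g) < c - g"
    using pos by (simp add: mult.assoc[symmetric] mult_less_cancel_right_pos)
  then have "((2^r + 1) * (2^n - g)) * g < (c - g) * g" using gpos by (rule mult_strict_right_mono)
  \<comment> \<open>By \<open>cg\<close> the number of remaining words is a difference of squares
    over \<open>g\<close>, so the factor \<open>2^n - g\<close> cancels.\<close>
  also have "(c - g) * g = (2^n + g) * (2^n - g)" using cg by (simp add: algebra_simps)
  finally have "((2^r + 1) * g) * (2^n - g) < (2^n + g) * (2^n - g)" by (simp add: mult_ac)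
  then have "(2^r + 1) * g < 2^n + g" using gl by (simp add: mult_less_cancel_right_pos)
  then show False using gr by (simp add: algebra_simps)
qed


section \<open>Greedy extension of a stabilizer group\<close>

text \<open>Says that \<open>u\<close> lies in the stabilizer code of \<open>v\<close>.\<close>

definition inherits :: "nat \<Rightarrow> complex mat \<Rightarrow> complex mat \<Rightarrow> bool" where
  "inherits n v u \<longleftrightarrow> (\<forall>w\<in>words n. \<forall>s. s = 1 \<or> s = - 1 \<longrightarrow>
     pauli_string w * v = s \<cdot>\<^sub>m v \<longrightarrow> pauli_string w * u = s \<cdot>\<^sub>m u)"

text \<open>For \<open>s\<close> equal to 1 or -1 this is the orthogonal projection of
  \<open>v\<close> onto the eigenspace of the Pauli string with eigenvalue \<open>s\<close>.\<close>

definition half_step :: "nat list \<Rightarrow> complex \<Rightarrow> complex mat \<Rightarrow> complex mat" where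
  "half_step w s v = (1/2) \<cdot>\<^sub>m (v + s \<cdot>\<^sub>m (pauli_string w * v))"

lemma inherits_trans: "inherits n u v \<Longrightarrow> inherits n v w \<Longrightarrow> inherits n u w"
  unfolding inherits_def by blast

lemma inherits_refl: "inherits n v v"
  unfolding inherits_def by blast

lemma stabs_mono: "inherits n v u \<Longrightarrow> stabs n v \<subseteq> stabs n u"
  unfolding inherits_def stabs_def by blast

lemma half_step_carrier:
  "w \<in> words n \<Longrightarrow> v \<in> carrier_mat (2^n) 1 \<Longrightarrow> half_step w s v \<in> carrier_mat (2^n) 1"
  unfolding half_step_def by (intro smult_carrier_mat add_carrier_mat pauli_vec_carrier)

lemma pauli_half_step:
  assumes w: "w \<in> words n" and v: "v \<in> carrier_mat (2^n) 1" and h: "h \<in> words n"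
  shows "pauli_string h * half_step w s v =
    (1/2) \<cdot>\<^sub>m (pauli_string h * v + s \<cdot>\<^sub>m (pauli_string h * (pauli_string w * v)))"
proof -
  have c: "pauli_string w * v \<in> carrier_mat (2^n) 1" by (rule pauli_vec_carrier[OF w v])
  then have d: "s \<cdot>\<^sub>m (pauli_string w * v) \<in> carrier_mat (2^n) 1" by (rule smult_carrier_mat)
  show ?thesis
    unfolding half_step_def pauli_vec_smult[OF h add_carrier_mat[OF d]] pauli_vec_add[OF h v d] pauli_vec_smult[OF h c] ..
qed

lemma half_step_eigen:
  assumes w: "w \<in> words n" and v: "v \<in> carrier_mat (2^n) 1" and s: "s = 1 \<or> s = - 1"
  shows "pauli_string w * half_step w s v = s \<cdot>\<^sub>m half_step w s v"
proof -
  have c: "pauli_string w * v \<in> carrier_mat (2^n) 1" by (rule pauli_vec_carrier[OF w v])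
  have "pauli_string w * half_step w s v = (1/2) \<cdot>\<^sub>m (pauli_string w * v + s \<cdot>\<^sub>m v)"
    unfolding pauli_half_step[OF w v w] pauli_vec_invol[OF w v] ..
  also have "\<dots> = s \<cdot>\<^sub>m half_step w s v"
    unfolding half_step_def using s carrier_matD[OF v] carrier_matD[OF c]
    by (intro eq_matI) (auto simp del: index_mult_mat(1))
  finally show ?thesis .
qed

lemma half_step_preserves:
  assumes w: "w \<in> words n" and v: "v \<in> carrier_mat (2^n) 1" and h: "h \<in> words n"
    and c: "comm_sign h w = 1" and t: "pauli_string h * v = t \<cdot>\<^sub>m v"
  shows "pauli_string h * half_step w s v = t \<cdot>\<^sub>m half_step w s v"
proof -
  have wv: "pauli_string w * v \<in> carrier_mat (2^n) 1" by (rule pauli_vec_carrier[OF w v])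
  have "pauli_string h * (pauli_string w * v) = t \<cdot>\<^sub>m (pauli_string w * v)"
    unfolding pauli_vec_commute[OF h w v] t pauli_vec_smult[OF w v] c by simp
  then have "pauli_string h * half_step w s v = (1/2) \<cdot>\<^sub>m (t \<cdot>\<^sub>m v + s \<cdot>\<^sub>m (t \<cdot>\<^sub>m (pauli_string w * v)))"
    unfolding pauli_half_step[OF w v h] t by (simp only:)
  also have "\<dots> = t \<cdot>\<^sub>m half_step w s v"
    unfolding half_step_def using carrier_matD[OF v] carrier_matD[OF wv]
    by (intro eq_matI) (auto simp: algebra_simps simp del: index_mult_mat(1))
  finally show ?thesis .
qed

text \<open>The projection is self-adjoint and fixes \<open>u\<close>, so it can be moved to the
  left and disappears.\<close>

lemma braket_half_step:
  assumes w: "w \<in> words n" and v: "v \<in> carrier_mat (2^n) 1" and u: "u \<in> carrier_mat (2^n) 1"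
    and s: "s = 1 \<or> s = - 1" and e: "pauli_string w * u = s \<cdot>\<^sub>m u"
  shows "braket u (half_step w s v) = braket u v"
proof -
  have c: "pauli_string w * v \<in> carrier_mat (2^n) 1" by (rule pauli_vec_carrier[OF w v])
  have d: "s \<cdot>\<^sub>m (pauli_string w * v) \<in> carrier_mat (2^n) 1" using c by (rule smult_carrier_mat)
  have "braket u (half_step w s v) = 1/2 * (braket u v + s * braket u (pauli_string w * v))"
    unfolding half_step_def braket_smult_right[OF u add_carrier_mat[OF d]] braket_add_right[OF u v d] braket_smult_right[OF u c] ..
  also have "braket u (pauli_string w * v) = cnj s * braket u v"
    unfolding pauli_vec_hermitian[OF w u v] e braket_smult_left[OF v u] ..
  finally show ?thesis using s by auto
qed

lemma nsq_half_step:
  assumes w: "w \<in> words n" and v: "v \<in> carrier_mat (2^n) 1" and s: "s = 1 \<or> s = - (1::real)"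
  shows "nsq (half_step w (complex_of_real s) v) = (nsq v + s * Re (braket v (pauli_string w * v))) / 2"
proof -
  let ?s = "complex_of_real s"
  let ?u = "half_step w ?s v"
  have s': "?s = 1 \<or> ?s = - 1" using s by auto
  have u: "?u \<in> carrier_mat (2^n) 1" by (rule half_step_carrier[OF w v])
  have c: "pauli_string w * v \<in> carrier_mat (2^n) 1" by (rule pauli_vec_carrier[OF w v])
  have d: "?s \<cdot>\<^sub>m (pauli_string w * v) \<in> carrier_mat (2^n) 1" using c by (rule smult_carrier_mat)
  \<comment> \<open>The projected vector lies in the eigenspace itself, so one of its two copies may
    be replaced by \<open>v\<close>.\<close>
  have "complex_of_real (nsq ?u) = braket ?u v"
    using braket_half_step[OF w v u s' half_step_eigen[OF w v s']] braket_self[OF u] by simp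
  also have "\<dots> = cnj (braket v ?u)" by (rule braket_cnj[OF v u])
  also have "braket v ?u = 1/2 * (braket v v + ?s * braket v (pauli_string w * v))"
    unfolding half_step_def braket_smult_right[OF v add_carrier_mat[OF d]] braket_add_right[OF v v d] braket_smult_right[OF v c] ..
  finally have "Re (complex_of_real (nsq ?u)) = Re (cnj (1/2 * (braket v v + ?s * braket v (pauli_string w * v))))"
    by (rule arg_cong)
  then show ?thesis by (simp add: braket_self[OF v])
qed

text \<open>Factor \<open>i\<close> bounds the share of the squared norm kept in the step from
  \<open>Suc i\<close> to \<open>i\<close> logical qubits; hence the exponent
  \<open>Suc i\<close>.\<close>

definition greedy_const :: "nat \<Rightarrow> real" where
  "greedy_const r = (\<Prod>i<r. (1 + 1 / sqrt (2 ^ Suc i + 1)) / 2)"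

lemma greedy_const_pos: "greedy_const r > 0"
  unfolding greedy_const_def by (intro prod_pos) (auto intro!: add_pos_nonneg)

lemma greedy_const_le_1: "greedy_const r \<le> 1"
  unfolding greedy_const_def
proof (intro prod_le_1 conjI)
  fix i :: nat
  have "(1 + 1 / y) / 2 \<le> 1" if "1 \<le> y" for y :: real using that by (simp add: field_simps)
  then show "(1 + 1 / sqrt (2 ^ Suc i + 1)) / 2 \<le> 1" by this simp
qed (auto intro!: add_nonneg_nonneg)

lemma greedy_const_Suc: "greedy_const (Suc r) = greedy_const r * ((1 + 1 / sqrt (2 ^ Suc r + 1)) / 2)"
  by (simp add: greedy_const_def)

text \<open>The numerical condition behind multiplicativity. Rounding the factors down to 0.78, 0.72
  and 0.66 leaves enough room: the last case becomes \<open>8 * 0.36\<^sup>2\<close>, about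
  1.04.\<close>

lemma greedy_const_bound:
  assumes "r \<le> 3" shows "1 \<le> 2 ^ r * (greedy_const r)\<^sup>2"
proof -
  \<comment> \<open>The root is removed by squaring, so that each decimal bound is a rational
    comparison.\<close>
  have f: "x \<le> (1 + 1 / sqrt y) / 2" if "(2 * x - 1)\<^sup>2 * y \<le> 1" "y > 0" "x \<ge> 1/2" for x y :: real
  proof -
    have "((2 * x - 1) * sqrt y)\<^sup>2 \<le> 1\<^sup>2" using that by (simp add: power_mult_distrib)
    then have "(2 * x - 1) * sqrt y \<le> 1" by (rule power2_le_imp_le) simp
    then show ?thesis using that by (simp add: field_simps)
  qed
  have 1: "78/100 \<le> (1 + 1 / sqrt (3::real)) / 2" by (rule f) (auto simp: power2_eq_square)
  have 2: "72/100 \<le> (1 + 1 / sqrt (5::real)) / 2" by (rule f) (auto simp: power2_eq_square)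
  have 3: "66/100 \<le> (1 + 1 / sqrt (9::real)) / 2" by (rule f) (auto simp: power2_eq_square)
  have c0: "greedy_const 0 = 1" by (simp add: greedy_const_def)
  have e: "greedy_const 1 = (1 + 1 / sqrt 3) / 2" "greedy_const 2 = greedy_const 1 * ((1 + 1 / sqrt 5) / 2)"
    "greedy_const 3 = greedy_const 2 * ((1 + 1 / sqrt 9) / 2)"
    using greedy_const_Suc[of 0] greedy_const_Suc[of 1] greedy_const_Suc[of 2] c0
    by (simp_all add: numeral_2_eq_2 numeral_3_eq_3 One_nat_def del: real_sqrt_eq_iff)
  have c1: "78/100 \<le> greedy_const 1" using 1 e(1) by simp
  have "78/100 * (72/100) \<le> greedy_const 2"
    unfolding e(2) by (intro mult_mono c1 2 less_imp_le[OF greedy_const_pos]) simp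
  then have c2: "56/100 \<le> greedy_const 2" by simp
  have "56/100 * (66/100) \<le> greedy_const 3"
    unfolding e(3) by (intro mult_mono c2 3 less_imp_le[OF greedy_const_pos]) simp
  then have c3: "36/100 \<le> greedy_const 3" by simp
  have sq: "x\<^sup>2 \<le> (greedy_const r)\<^sup>2" if "0 \<le> x" "x \<le> greedy_const r" for x r
    using that by (rule power_mono[rotated])
  consider "r = 0" | "r = 1" | "r = 2" | "r = 3" using assms by linarith
  then show ?thesis
  proof cases
    case 2 then show ?thesis using sq[OF _ c1] by (simp add: power2_eq_square)
  next
    case 3 then show ?thesis using sq[OF _ c2] by (simp add: power2_eq_square)
  next
    case 4 then show ?thesis using sq[OF _ c3] by (simp add: power2_eq_square)
  qed (simp add: c0)
qed

text \<open>Each step projects onto an eigenspace of a new commuting word and doubles the stabilizer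
  group. The last conjunct records that \<open>u\<close> is a projection of \<open>v\<close>:
  vectors in the final code cannot tell them apart. With \<open>x = u\<close> it converts the norm
  of \<open>u\<close> into an overlap with \<open>v\<close>.\<close>

lemma greedy:
  assumes "v \<in> carrier_mat (2^n) 1" "v \<noteq> 0\<^sub>m (2^n) 1" "2^n \<le> card (stabs n v) * 2^r"
  shows "\<exists>u\<in>carrier_mat (2^n) 1. 2^n \<le> card (stabs n u) \<and> inherits n v u \<and> greedy_const r * nsq v \<le> nsq u \<and>
    (\<forall>x\<in>carrier_mat (2^n) 1. inherits n u x \<longrightarrow> braket x u = braket x v)"
  using assms
proof (induction r arbitrary: v)
  case 0
  then show ?case by (intro bexI[of _ v]) (auto simp: greedy_const_def inherits_refl)
next
  case (Suc r)
  note v = Suc.prems(1,2)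
  show ?case
  proof (cases "card (stabs n v) < 2^n")
    \<comment> \<open>\<open>r\<close> only bounds the number of missing generators, so the group
      may be complete early; the unspent factors are at most 1.\<close>
    case False
    moreover have "greedy_const (Suc r) * nsq v \<le> 1 * nsq v" by (intro mult_right_mono greedy_const_le_1) simp
    ultimately show ?thesis using v by (intro bexI[of _ v]) (auto simp: inherits_refl)
  next
    case True
    from exists_large_expectation[OF v True Suc.prems(3)]
    obtain w where w: "w \<in> centralizer n (stabs n v)" "w \<notin> stabs n v"
      and big: "(nsq v)\<^sup>2 \<le> (2^Suc r + 1) * (Re (braket v (pauli_string w * v)))\<^sup>2" by blast
    have ww: "w \<in> words n" using w(1) by (simp add: centralizer_def)
    define x where "x = Re (braket v (pauli_string w * v))"
    \<comment> \<open>The eigenspace that holds the larger part of \<open>v\<close>.\<close>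
    define s :: real where "s = (if x \<ge> 0 then 1 else - 1)"
    have s: "s = 1 \<or> s = - 1" "s * x = \<bar>x\<bar>" by (auto simp: s_def)
    have s': "complex_of_real s = 1 \<or> complex_of_real s = - 1" using s(1) by auto
    define u where "u = half_step w (complex_of_real s) v"
    have u: "u \<in> carrier_mat (2^n) 1" unfolding u_def by (rule half_step_carrier[OF ww v(1)])
    have nsq_u: "nsq u = (nsq v + \<bar>x\<bar>) / 2"
      unfolding u_def nsq_half_step[OF ww v(1) s(1)] x_def[symmetric] s(2) ..
    have "sqrt ((nsq v)\<^sup>2) \<le> sqrt ((2^Suc r + 1) * x\<^sup>2)" using big unfolding x_def by (rule real_sqrt_le_mono)
    then have "nsq v \<le> sqrt (2^Suc r + 1) * \<bar>x\<bar>" by (simp add: real_sqrt_mult)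
    moreover have sp: "sqrt (2^Suc r + 1) > 0" by (simp add: add_pos_pos)
    ultimately have "nsq v / sqrt (2^Suc r + 1) \<le> \<bar>x\<bar>" by (simp add: divide_le_eq mult.commute)
    then have "(nsq v + nsq v / sqrt (2^Suc r + 1)) / 2 \<le> nsq u" unfolding nsq_u by (intro divide_right_mono add_left_mono) simp_all
    moreover have "(1 + 1 / y) / 2 * a = (a + a / y) / 2" for a y :: real by (simp add: distrib_right)
    ultimately have grow: "(1 + 1 / sqrt (2^Suc r + 1)) / 2 * nsq v \<le> nsq u" by (simp only:)
    have "nsq v > 0" using nsq_eq_0_iff[OF v(1)] v(2) nsq_nonneg[of v] by linarith
    then have "nsq u > 0" unfolding nsq_u by (simp add: add_pos_nonneg)
    then have u0: "u \<noteq> 0\<^sub>m (2^n) 1" using nsq_eq_0_iff[OF u] by auto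
    have eig: "pauli_string w * u = complex_of_real s \<cdot>\<^sub>m u"
      unfolding u_def by (rule half_step_eigen[OF ww v(1) s'])
    have inh: "inherits n v u"
      unfolding inherits_def
    proof (intro ballI allI impI)
      fix h t assume h: "h \<in> words n" "t = 1 \<or> t = (- 1::complex)" "pauli_string h * v = t \<cdot>\<^sub>m v"
      then have "comm_sign h w = 1" using w(1) unfolding centralizer_def stabs_def by blast
      then show "pauli_string h * u = t \<cdot>\<^sub>m u"
        unfolding u_def by (rule half_step_preserves[OF ww v(1) h(1) _ h(3)])
    qed
    have grp: "word_group n (stabs n v)" "word_group n (stabs n u)"
      by (rule word_group_stabs[OF v], rule word_group_stabs[OF u u0])
    have wu: "w \<in> stabs n u" using ww s' eig unfolding stabs_def by blast
    \<comment> \<open>Since \<open>w\<close> commutes with the old stabilizers, they all survive,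
      and \<open>w\<close> adds a second coset.\<close>
    have "stabs n v \<union> wxor w ` stabs n v \<subseteq> stabs n u"
      using stabs_mono[OF inh] grp(2) wu unfolding word_group_def by blast
    then have "2 * card (stabs n v) \<le> card (stabs n u)"
      using card_mono[OF finite_stabs] word_group_extend(2)[OF grp(1) ww w(2)] by metis
    then have "2 * card (stabs n v) * 2^r \<le> card (stabs n u) * 2^r" by (rule mult_le_mono1)
    moreover have "card (stabs n v) * 2^Suc r = 2 * card (stabs n v) * 2^r" by simp
    ultimately have "2^n \<le> card (stabs n u) * 2^r" using Suc.prems(3) by (simp only:)
    from Suc.IH[OF u u0 this] obtain z where z: "z \<in> carrier_mat (2^n) 1" "2^n \<le> card (stabs n z)" "inherits n u z"
      "greedy_const r * nsq u \<le> nsq z" "\<And>x. x \<in> carrier_mat (2^n) 1 \<Longrightarrow> inherits n z x \<Longrightarrow> braket x z = braket x u" by blast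
    have "greedy_const (Suc r) * nsq v = greedy_const r * ((1 + 1 / sqrt (2^Suc r + 1)) / 2 * nsq v)"
      by (simp add: greedy_const_Suc)
    also have "\<dots> \<le> greedy_const r * nsq u" using grow greedy_const_pos by (intro mult_left_mono) (auto intro: less_imp_le)
    also have "\<dots> \<le> nsq z" by (rule z(4))
    finally have g: "greedy_const (Suc r) * nsq v \<le> nsq z" .
    have "braket x z = braket x v" if x: "x \<in> carrier_mat (2^n) 1" "inherits n z x" for x
    proof -
      have "inherits n u x" using z(3) x(2) by (rule inherits_trans)
      then have "pauli_string w * x = complex_of_real s \<cdot>\<^sub>m x" using ww s' eig unfolding inherits_def by blast
      from braket_half_step[OF ww v(1) x(1) s' this] show ?thesis using z(5)[OF x] unfolding u_def by simp
    qed
    then show ?thesis using z(1,2) g inherits_trans[OF inh z(3)] by blast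
  qed
qed


section \<open>Pure stabilizer states\<close>

lemma pauli_vec_nonzero:
  assumes w: "w \<in> words n" and v: "v \<in> carrier_mat (2^n) 1" "v \<noteq> 0\<^sub>m (2^n) 1"
  shows "pauli_string w * v \<noteq> 0\<^sub>m (2^n) 1"
proof
  assume "pauli_string w * v = 0\<^sub>m (2^n) 1"
  then have "v = pauli_string w * 0\<^sub>m (2^n) 1" using pauli_vec_invol[OF w v(1)] by simp
  then show False using v(2) right_mult_zero_mat[OF pauli_string_dim[OF w]] by simp
qed

text \<open>A scalar commutes with every Pauli string, so the character sum of \<open>g\<close> is
  maximal, which singles out the identity word. The vector \<open>v\<close> supplies a nonzero
  vector on which scalars can be compared.\<close>

lemma scalar_pauli_string:
  fixes v :: "complex mat"
  assumes g: "g \<in> words n" and e: "\<And>x. x \<in> carrier_mat (2^n) 1 \<Longrightarrow> pauli_string g * x = c \<cdot>\<^sub>m x"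
    and v: "v \<in> carrier_mat (2^n) 1" "v \<noteq> 0\<^sub>m (2^n) 1"
  shows "g = zeros n"
proof -
  have c: "c = 1 \<or> c = - 1" by (rule pauli_eigenvalue[OF g v e[OF v(1)]])
  have "comm_sign g u = 1" if u: "u \<in> words n" for u
  proof -
    have uv: "pauli_string u * v \<in> carrier_mat (2^n) 1" by (rule pauli_vec_carrier[OF u v(1)])
    have "c \<cdot>\<^sub>m (pauli_string u * v) = of_int (comm_sign g u) \<cdot>\<^sub>m (c \<cdot>\<^sub>m (pauli_string u * v))"
      using pauli_vec_commute[OF g u v(1)] unfolding e[OF uv] e[OF v(1)] pauli_vec_smult[OF u v(1)] .
    from smult_vec_inj[OF uv pauli_vec_nonzero[OF u v] this[unfolded smult_smult_assoc_mat]]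
    show ?thesis using c by auto
  qed
  then have "(\<Sum>u\<in>words n. comm_sign g u) = (\<Sum>u\<in>words n. 1)" by (intro sum.cong) auto
  then show ?thesis using sum_comm_sign[OF g] by (auto simp: card_words split: if_splits)
qed

text \<open>Proportional strings multiply to a scalar, so their \<open>wxor\<close> is the identity
  word. Distinct words thus remain distinct operators whatever phases are attached.\<close>

lemma pauli_string_inj:
  fixes v :: "complex mat"
  assumes w: "w \<in> words n" and w': "w' \<in> words n" and e: "pauli_string w = c \<cdot>\<^sub>m pauli_string w'"
    and v: "v \<in> carrier_mat (2^n) 1" "v \<noteq> 0\<^sub>m (2^n) 1"
  shows "w = w'"
proof -
  have "wxor w w' = zeros n"
  proof (rule scalar_pauli_string[OF wxor_words[OF w w'] _ v])
    fix x :: "complex mat" assume x: "x \<in> carrier_mat (2^n) 1"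
    have "pauli_string w * (pauli_string w' * x) = c \<cdot>\<^sub>m x"
      unfolding e mult_smult_assoc_mat[OF pauli_string_dim[OF w'] pauli_vec_carrier[OF w' x]] pauli_vec_invol[OF w' x] ..
    then have "(inverse (phase w w') * phase w w') \<cdot>\<^sub>m (pauli_string (wxor w w') * x) = (inverse (phase w w') * c) \<cdot>\<^sub>m x"
      unfolding pauli_vec_mult[OF w w' x] by (metis smult_smult_assoc_mat)
    then show "pauli_string (wxor w w') * x = (inverse (phase w w') * c) \<cdot>\<^sub>m x" by (simp add: phase_nonzero)
  qed
  then have "w' = wxor w (zeros n)" using wxor_cancel_left[OF w w'] by simp
  then show ?thesis using wxor_zeros_left[OF w] wxor_commute[of w "zeros n"] by simp
qed

lemma unit_ket_nonzero: "unit_ket n v \<Longrightarrow> v \<noteq> 0\<^sub>m (2^n) 1"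
  by (auto simp: unit_ket_iff nsq_def)

lemma pauli_group_iff: "P \<in> pauli_group n \<longleftrightarrow> (\<exists>c<4. \<exists>w\<in>words n. P = (\<i> ^ c) \<cdot>\<^sub>m pauli_string w)"
  unfolding pauli_group_def words_def by blast

text \<open>Passes from the phased operators of \<open>pauli_group\<close> to words without phase;
  the counts match because at most one phase of a string fixes a given nonzero vector. The right
  side is a lower bound because that is what the greedy extension delivers.\<close>

lemma stab_state_iff: "stab_state n \<phi> \<longleftrightarrow> unit_ket n \<phi> \<and> 2^n \<le> card (stabs n \<phi>)"
proof (cases "unit_ket n \<phi>")
  case True
  then have v: "\<phi> \<in> carrier_mat (2^n) 1" "\<phi> \<noteq> 0\<^sub>m (2^n) 1"
    using unit_ket_nonzero by (auto simp: unit_ket_iff)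
  have app: "(c \<cdot>\<^sub>m pauli_string w) * \<phi> = c \<cdot>\<^sub>m (pauli_string w * \<phi>)" if "w \<in> words n" for c w
    by (rule mult_smult_assoc_mat[OF pauli_string_dim[OF that] v(1)])
  show ?thesis
  proof
    assume "stab_state n \<phi>"
    then obtain S where S: "S \<subseteq> pauli_group n" "card S = 2^n" "\<And>P. P \<in> S \<Longrightarrow> P * \<phi> = \<phi>"
      by (auto simp: stab_state_def)
    have "\<forall>P\<in>S. \<exists>w. w \<in> words n \<and> (\<exists>c. P = c \<cdot>\<^sub>m pauli_string w)"
      using S(1) unfolding subset_iff pauli_group_iff by blast
    then obtain f where f: "\<And>P. P \<in> S \<Longrightarrow> f P \<in> words n \<and> (\<exists>c. P = c \<cdot>\<^sub>m pauli_string (f P))"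
      by (metis bchoice)
    have fx: "c \<cdot>\<^sub>m (pauli_string (f P) * \<phi>) = \<phi>" if "P \<in> S" "P = c \<cdot>\<^sub>m pauli_string (f P)" for P c
      using S(3)[OF that(1)] app[of "f P" c] f[OF that(1)] that(2) by metis
    have "inj_on f S"
    proof (rule inj_onI)
      fix P Q assume PQ: "P \<in> S" "Q \<in> S" "f P = f Q"
      obtain c c' where c: "P = c \<cdot>\<^sub>m pauli_string (f P)" and c': "Q = c' \<cdot>\<^sub>m pauli_string (f Q)"
        using f PQ by blast
      have w: "f P \<in> words n" using f PQ by blast
      have "c \<cdot>\<^sub>m (pauli_string (f P) * \<phi>) = c' \<cdot>\<^sub>m (pauli_string (f P) * \<phi>)"
        using fx[OF PQ(1) c] fx[OF PQ(2) c'] PQ(3) by simp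
      from smult_vec_inj[OF pauli_vec_carrier[OF w v(1)] pauli_vec_nonzero[OF w v] this]
      show "P = Q" using c c' PQ(3) by metis
    qed
    moreover have "f ` S \<subseteq> stabs n \<phi>"
    proof (rule image_subsetI)
      fix P assume P: "P \<in> S"
      then obtain c where c: "P = c \<cdot>\<^sub>m pauli_string (f P)" and w: "f P \<in> words n" using f by blast
      have e: "c \<cdot>\<^sub>m (pauli_string (f P) * \<phi>) = \<phi>" by (rule fx[OF P c])
      have "c \<noteq> 0"
      proof
        assume "c = 0"
        then have "nsq \<phi> = 0" using nsq_smult[OF pauli_vec_carrier[OF w v(1)], of c] unfolding e by simp
        then show False using v nsq_eq_0_iff[OF v(1)] by simp
      qed
      then have "pauli_string (f P) * \<phi> = inverse c \<cdot>\<^sub>m \<phi>"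
        using arg_cong[OF e, of "\<lambda>x. inverse c \<cdot>\<^sub>m x"] by (simp add: smult_smult_assoc_mat)
      then show "f P \<in> stabs n \<phi>" using pauli_eigenvalue[OF w v] w unfolding stabs_def by blast
    qed
    ultimately show "unit_ket n \<phi> \<and> 2^n \<le> card (stabs n \<phi>)"
      using True S(2) card_inj_on_le[of f S "stabs n \<phi>"] by simp
  next
    assume "unit_ket n \<phi> \<and> 2^n \<le> card (stabs n \<phi>)"
    then obtain T where T: "T \<subseteq> stabs n \<phi>" "card T = 2^n"
      using obtain_subset_with_card_n by metis
    \<comment> \<open>Exponent 2 attaches the sign -1 to strings with eigenvalue -1, so that
      \<open>F w\<close> fixes \<open>\<phi>\<close>.\<close>
    define F where "F w = (\<i> ^ (if pauli_string w * \<phi> = \<phi> then 0 else 2)) \<cdot>\<^sub>m pauli_string w" for w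
    have Tw: "w \<in> words n" if "w \<in> T" for w using that T(1) stabs_words by blast
    have "inj_on F T"
    proof (rule inj_onI)
      fix w w' assume w: "w \<in> T" "w' \<in> T" "F w = F w'"
      let ?s = "\<lambda>w. \<i> ^ (if pauli_string w * \<phi> = \<phi> then 0 else 2)"
      have "(inverse (?s w) * ?s w) \<cdot>\<^sub>m pauli_string w = (inverse (?s w) * ?s w') \<cdot>\<^sub>m pauli_string w'"
        using arg_cong[OF w(3), of "\<lambda>x. inverse (?s w) \<cdot>\<^sub>m x"] unfolding F_def smult_smult_assoc_mat .
      then have "pauli_string w = (inverse (?s w) * ?s w') \<cdot>\<^sub>m pauli_string w'" by simp
      from pauli_string_inj[OF Tw[OF w(1)] Tw[OF w(2)] this v] show "w = w'" .
    qed
    then have "card (F ` T) = 2^n" using T(2) by (simp add: card_image)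
    moreover have "F ` T \<subseteq> pauli_group n"
    proof (rule image_subsetI)
      fix w assume "w \<in> T"
      moreover have "(if pauli_string w * \<phi> = \<phi> then 0 else 2) < (4::nat)" by simp
      ultimately show "F w \<in> pauli_group n" unfolding F_def pauli_group_iff using Tw by blast
    qed
    moreover have "P * \<phi> = \<phi>" if P: "P \<in> F ` T" for P
    proof -
      obtain w where w: "w \<in> T" "P = F w" using P by blast
      have "w \<in> stabs n \<phi>" using w T(1) by blast
      then obtain s where s: "s = 1 \<or> s = - 1" "pauli_string w * \<phi> = s \<cdot>\<^sub>m \<phi>" by (rule stabsE)
      show ?thesis
      proof (cases "pauli_string w * \<phi> = \<phi>")
        case True
        then show ?thesis using w(2) app[OF Tw[OF w(1)]] by (simp add: F_def)
      next
        case False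
        then have "s = - 1" using s by auto
        then show ?thesis using w(2) app[OF Tw[OF w(1)]] False s(2) by (simp add: F_def smult_smult_assoc_mat)
      qed
    qed
    ultimately show "stab_state n \<phi>" using True unfolding stab_state_def by blast
  qed
qed (auto simp: stab_state_def)

lemma stabs_smult:
  assumes "v \<in> carrier_mat (2^n) 1" "c \<noteq> 0"
  shows "stabs n v \<subseteq> stabs n (c \<cdot>\<^sub>m v)"
proof
  fix w assume "w \<in> stabs n v"
  then obtain s where s: "s = 1 \<or> s = - 1" "pauli_string w * v = s \<cdot>\<^sub>m v" and w: "w \<in> words n" by (rule stabsE)
  have "pauli_string w * (c \<cdot>\<^sub>m v) = s \<cdot>\<^sub>m (c \<cdot>\<^sub>m v)"
    unfolding pauli_vec_smult[OF w assms(1)] s(2) smult_smult_assoc_mat by (simp only: mult.commute)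
  then show "w \<in> stabs n (c \<cdot>\<^sub>m v)" using s(1) w unfolding stabs_def by blast
qed

text \<open>The greedy vector \<open>u\<close> satisfies
  \<open>braket u u = braket u v = braket u \<psi>\<close>. After normalization it is a stabilizer
  state whose squared overlap with \<open>\<psi>\<close> is exactly \<open>nsq u\<close>.\<close>

lemma stab_overlap_bound:
  assumes \<psi>: "\<psi> \<in> carrier_mat (2^n) 1" and v: "v \<in> carrier_mat (2^n) 1"
    and r: "2^n \<le> card (stabs n v) * 2^r"
    and proj: "\<And>u. u \<in> carrier_mat (2^n) 1 \<Longrightarrow> inherits n v u \<Longrightarrow> braket u v = braket u \<psi>"
    and f: "0 \<le> f" "\<And>\<phi>. stab_state n \<phi> \<Longrightarrow> (cmod (braket \<psi> \<phi>))\<^sup>2 \<le> f"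
  shows "greedy_const r * nsq v \<le> f"
proof (cases "v = 0\<^sub>m (2^n) 1")
  \<comment> \<open>In the applications \<open>v\<close> is the projection of \<open>\<psi>\<close>
    onto a code, which vanishes if \<open>\<psi>\<close> is orthogonal to that code.\<close>
  case True
  then have "nsq v = 0" using nsq_eq_0_iff[OF v] by simp
  then show ?thesis using f by simp
next
  case False
  from greedy[OF v False r] obtain u where u: "u \<in> carrier_mat (2^n) 1" "2^n \<le> card (stabs n u)" "inherits n v u"
    "greedy_const r * nsq v \<le> nsq u" "braket u u = braket u v" using inherits_refl by blast
  have "nsq v > 0" using nsq_eq_0_iff[OF v] False nsq_nonneg[of v] by linarith
  then have pos: "nsq u > 0" using u(4) greedy_const_pos[of r] by (meson less_le_trans mult_pos_pos)
  define c where "c = complex_of_real (1 / sqrt (nsq u))"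
  have c0: "c \<noteq> 0" and cm: "(cmod c)\<^sup>2 = 1 / nsq u" using pos by (auto simp: c_def norm_divide power_divide)
  have cu: "c \<cdot>\<^sub>m u \<in> carrier_mat (2^n) 1" by (rule smult_carrier_mat[OF u(1)])
  have "nsq (c \<cdot>\<^sub>m u) = 1" unfolding nsq_smult[OF u(1)] cm using pos by simp
  moreover have "card (stabs n u) \<le> card (stabs n (c \<cdot>\<^sub>m u))"
    by (rule card_mono[OF finite_stabs stabs_smult[OF u(1) c0]])
  ultimately have "stab_state n (c \<cdot>\<^sub>m u)" using cu u(2) unfolding stab_state_iff unit_ket_iff by linarith
  from f(2)[OF this] have "(cmod (c * braket \<psi> u))\<^sup>2 \<le> f" unfolding braket_smult_right[OF \<psi> u(1)] .
  moreover have "braket \<psi> u = complex_of_real (nsq u)"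
    unfolding braket_cnj[OF u(1) \<psi>] proj[OF u(1,3), symmetric] u(5)[symmetric] braket_self[OF u(1)] by simp
  ultimately have "1 / nsq u * (nsq u)\<^sup>2 \<le> f" using cm by (simp add: norm_mult power_mult_distrib)
  then show ?thesis using u(4) pos by (simp add: power2_eq_square)
qed

text \<open>The vector \<open>v\<close> is the orthogonal projection of \<open>\<psi>\<close> onto the code with signs \<open>s\<close>.\<close>

lemma code_projection:
  assumes "finite H" "H \<subseteq> words n" "\<And>g h. g \<in> H \<Longrightarrow> h \<in> H \<Longrightarrow> comm_sign g h = 1"
    and "\<And>h. h \<in> H \<Longrightarrow> s h = 1 \<or> s h = - 1" and \<psi>: "\<psi> \<in> carrier_mat (2^n) 1"
  shows "\<exists>v\<in>carrier_mat (2^n) 1. (\<forall>h\<in>H. pauli_string h * v = s h \<cdot>\<^sub>m v) \<and>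
    (\<forall>u\<in>carrier_mat (2^n) 1. (\<forall>h\<in>H. pauli_string h * u = s h \<cdot>\<^sub>m u) \<longrightarrow> braket u v = braket u \<psi>)"
  using assms(1-4)
proof (induction H rule: finite_induct)
  case empty
  then show ?case using \<psi> by blast
next
  case (insert w H)
  then obtain v where v: "v \<in> carrier_mat (2^n) 1" "\<And>h. h \<in> H \<Longrightarrow> pauli_string h * v = s h \<cdot>\<^sub>m v"
    "\<And>u. u \<in> carrier_mat (2^n) 1 \<Longrightarrow> (\<forall>h\<in>H. pauli_string h * u = s h \<cdot>\<^sub>m u) \<Longrightarrow> braket u v = braket u \<psi>"
    by (metis insert_iff insert_subset)
  have w: "w \<in> words n" and sw: "s w = 1 \<or> s w = - 1" using insert.prems by auto
  let ?v = "half_step w (s w) v"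
  have "pauli_string h * ?v = s h \<cdot>\<^sub>m ?v" if "h \<in> insert w H" for h
  proof (cases "h = w")
    case True
    then show ?thesis using half_step_eigen[OF w v(1) sw] by simp
  next
    case False
    then have "h \<in> H" "h \<in> words n" "comm_sign h w = 1" using that insert.prems by auto
    then show ?thesis using half_step_preserves[OF w v(1)] v(2) by blast
  qed
  moreover have "braket u ?v = braket u \<psi>"
    if u: "u \<in> carrier_mat (2^n) 1" "\<forall>h\<in>insert w H. pauli_string h * u = s h \<cdot>\<^sub>m u" for u
    using braket_half_step[OF w v(1) u(1) sw] v(3)[OF u(1)] u(2) by simp
  ultimately show ?case using half_step_carrier[OF w v(1)] by blast
qed


section \<open>Contraction of a bipartite vector\<close>

text \<open>The component of \<open>\<Phi>\<close> along basis vector \<open>j\<close> of the right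
  factor, in the index convention of \<open>kron\<close>.\<close>

definition slice :: "nat \<Rightarrow> nat \<Rightarrow> complex mat \<Rightarrow> nat \<Rightarrow> complex mat" where
  "slice a b \<Phi> j = mat a 1 (\<lambda>(i,_). \<Phi> $$ (i * b + j, 0))"

text \<open>The partial inner product with \<open>\<psi>\<close> on the left factor, a vector of the
  right factor.\<close>

definition contract :: "nat \<Rightarrow> nat \<Rightarrow> complex mat \<Rightarrow> complex mat \<Rightarrow> complex mat" where
  "contract a b \<psi> \<Phi> = mat b 1 (\<lambda>(j,_). braket \<psi> (slice a b \<Phi> j))"

lemma slice_carrier [simp]: "slice a b \<Phi> j \<in> carrier_mat a 1"
  by (simp add: slice_def)

lemma contract_carrier [simp]: "contract a b \<psi> \<Phi> \<in> carrier_mat b 1"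
  by (simp add: contract_def)

lemma slice_entry: "i < a \<Longrightarrow> slice a b \<Phi> j $$ (i,0) = \<Phi> $$ (i * b + j, 0)"
  by (simp add: slice_def)

lemma contract_entry: "j < b \<Longrightarrow> contract a b \<psi> \<Phi> $$ (j,0) = braket \<psi> (slice a b \<Phi> j)"
  by (simp add: contract_def)

lemma zero_less_1_nat: "0 < (1::nat)"
  by simp

lemma kron_vec_entry:
  assumes A: "A \<in> carrier_mat a a" and B: "B \<in> carrier_mat b b" and \<Phi>: "\<Phi> \<in> carrier_mat (a * b) 1"
    and i: "i < a" and j: "j < b"
  shows "(kron A B * \<Phi>) $$ (i * b + j, 0) = (\<Sum>x<a. \<Sum>y<b. A $$ (i,x) * B $$ (j,y) * \<Phi> $$ (x * b + y, 0))"
  unfolding mat_mult_entry[OF kron_carrier[OF A B] \<Phi> mult_add_less[OF i j] zero_less_1_nat] sum_lessThan_mult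
  using i j by (intro sum.cong refl) (simp add: kron_entry[OF A B])

lemma slice_kron_one:
  assumes A: "A \<in> carrier_mat a a" and \<Phi>: "\<Phi> \<in> carrier_mat (a * b) 1" and j: "j < b"
  shows "slice a b (kron A (1\<^sub>m b) * \<Phi>) j = A * slice a b \<Phi> j"
proof (rule eq_matI)
  fix i k assume "i < dim_row (A * slice a b \<Phi> j)" "k < dim_col (A * slice a b \<Phi> j)"
  then have i: "i < a" and k: "k = 0" using carrier_matD[OF A] carrier_matD[OF slice_carrier[of a b \<Phi> j]] by auto
  have "slice a b (kron A (1\<^sub>m b) * \<Phi>) j $$ (i,0) = (\<Sum>x<a. \<Sum>y<b. A $$ (i,x) * 1\<^sub>m b $$ (j,y) * \<Phi> $$ (x * b + y, 0))"
    unfolding slice_entry[OF i] by (rule kron_vec_entry[OF A one_carrier_mat \<Phi> i j])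
  also have "\<dots> = (\<Sum>x<a. \<Sum>y<b. if y = j then A $$ (i,x) * \<Phi> $$ (x * b + y, 0) else 0)"
    using j by (intro sum.cong refl) auto
  also have "\<dots> = (\<Sum>x<a. A $$ (i,x) * \<Phi> $$ (x * b + j, 0))" using j by simp
  also have "\<dots> = (A * slice a b \<Phi> j) $$ (i,0)"
    unfolding mat_mult_entry[OF A slice_carrier i zero_less_1_nat] by (intro sum.cong refl) (simp add: slice_entry)
  finally show "slice a b (kron A (1\<^sub>m b) * \<Phi>) j $$ (i,k) = (A * slice a b \<Phi> j) $$ (i,k)" using k by simp
qed (use carrier_matD[OF A] carrier_matD[OF slice_carrier] in auto)

lemma braket_slices:
  assumes "\<Phi> \<in> carrier_mat (a * b) 1" "\<Psi> \<in> carrier_mat (a * b) 1"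
  shows "braket \<Phi> \<Psi> = (\<Sum>j<b. braket (slice a b \<Phi> j) (slice a b \<Psi> j))"
  unfolding braket_sum[OF assms] braket_sum[OF slice_carrier slice_carrier] sum_lessThan_mult
  by (subst sum.swap) (intro sum.cong refl, simp add: slice_entry)

lemma braket_kron_contract:
  assumes \<psi>: "\<psi> \<in> carrier_mat a 1" and \<chi>: "\<chi> \<in> carrier_mat b 1" and \<Phi>: "\<Phi> \<in> carrier_mat (a * b) 1"
  shows "braket (kron \<psi> \<chi>) \<Phi> = braket \<chi> (contract a b \<psi> \<Phi>)"
proof -
  have k: "kron \<psi> \<chi> \<in> carrier_mat (a * b) 1" using kron_carrier[OF \<psi> \<chi>] by simp
  have e: "kron \<psi> \<chi> $$ (i * b + j, 0) = \<psi> $$ (i,0) * \<chi> $$ (j,0)" if "i < a" "j < b" for i j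
    using kron_entry[OF \<psi> \<chi> that(1) that(2), of 0 0] by simp
  have "braket (kron \<psi> \<chi>) \<Phi> = (\<Sum>j<b. \<Sum>i<a. cnj (kron \<psi> \<chi> $$ (i * b + j, 0)) * \<Phi> $$ (i * b + j, 0))"
    unfolding braket_sum[OF k \<Phi>] sum_lessThan_mult by (rule sum.swap)
  also have "\<dots> = (\<Sum>j<b. cnj (\<chi> $$ (j,0)) * (\<Sum>i<a. cnj (\<psi> $$ (i,0)) * \<Phi> $$ (i * b + j, 0)))"
    unfolding sum_distrib_left by (intro sum.cong refl) (simp add: e)
  also have "\<dots> = braket \<chi> (contract a b \<psi> \<Phi>)"
    unfolding braket_sum[OF \<chi> contract_carrier]
    by (intro sum.cong refl) (simp add: contract_entry braket_sum[OF \<psi> slice_carrier] slice_entry)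
  finally show ?thesis .
qed

lemma mult_contract:
  assumes B: "B \<in> carrier_mat b b" and \<psi>: "\<psi> \<in> carrier_mat a 1" and \<Phi>: "\<Phi> \<in> carrier_mat (a * b) 1"
  shows "B * contract a b \<psi> \<Phi> = contract a b \<psi> (kron (1\<^sub>m a) B * \<Phi>)"
proof (rule eq_matI)
  fix k l assume "k < dim_row (contract a b \<psi> (kron (1\<^sub>m a) B * \<Phi>))" "l < dim_col (contract a b \<psi> (kron (1\<^sub>m a) B * \<Phi>))"
  then have k: "k < b" and l: "l = 0" by (auto simp: contract_def)
  have e: "(kron (1\<^sub>m a) B * \<Phi>) $$ (i * b + k, 0) = (\<Sum>j<b. B $$ (k,j) * \<Phi> $$ (i * b + j, 0))" if i: "i < a" for i
  proof -
    have "(kron (1\<^sub>m a) B * \<Phi>) $$ (i * b + k, 0) = (\<Sum>x<a. \<Sum>y<b. 1\<^sub>m a $$ (i,x) * B $$ (k,y) * \<Phi> $$ (x * b + y, 0))"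
      by (rule kron_vec_entry[OF one_carrier_mat B \<Phi> i k])
    also have "\<dots> = (\<Sum>x<a. if x = i then \<Sum>y<b. B $$ (k,y) * \<Phi> $$ (x * b + y, 0) else 0)"
      using i by (intro sum.cong refl) auto
    finally show ?thesis using i by simp
  qed
  have "(B * contract a b \<psi> \<Phi>) $$ (k,0) = (\<Sum>j<b. \<Sum>i<a. B $$ (k,j) * (cnj (\<psi> $$ (i,0)) * \<Phi> $$ (i * b + j, 0)))"
    unfolding mat_mult_entry[OF B contract_carrier k zero_less_1_nat] sum_distrib_left[symmetric]
    by (intro sum.cong refl) (simp add: contract_entry braket_sum[OF \<psi> slice_carrier] slice_entry)
  also have "\<dots> = (\<Sum>i<a. cnj (\<psi> $$ (i,0)) * (\<Sum>j<b. B $$ (k,j) * \<Phi> $$ (i * b + j, 0)))"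
    unfolding sum_distrib_left by (subst sum.swap) (intro sum.cong refl, simp add: mult_ac)
  also have "\<dots> = contract a b \<psi> (kron (1\<^sub>m a) B * \<Phi>) $$ (k,0)"
    unfolding contract_entry[OF k] braket_sum[OF \<psi> slice_carrier]
    by (intro sum.cong refl) (simp add: slice_entry e)
  finally show "(B * contract a b \<psi> \<Phi>) $$ (k,l) = contract a b \<psi> (kron (1\<^sub>m a) B * \<Phi>) $$ (k,l)" using l by simp
qed (use carrier_matD[OF B] in \<open>auto simp: contract_def\<close>)

lemma contract_smult:
  assumes \<psi>: "\<psi> \<in> carrier_mat a 1" and \<Phi>: "\<Phi> \<in> carrier_mat (a * b) 1"
  shows "contract a b \<psi> (c \<cdot>\<^sub>m \<Phi>) = c \<cdot>\<^sub>m contract a b \<psi> \<Phi>"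
proof (rule eq_matI)
  fix k l assume "k < dim_row (c \<cdot>\<^sub>m contract a b \<psi> \<Phi>)" "l < dim_col (c \<cdot>\<^sub>m contract a b \<psi> \<Phi>)"
  then have k: "k < b" and l: "l = 0" by (auto simp: contract_def)
  have "slice a b (c \<cdot>\<^sub>m \<Phi>) k = c \<cdot>\<^sub>m slice a b \<Phi> k"
    using mult_add_less[OF _ k, of _ a] carrier_matD[OF \<Phi>] by (intro eq_matI) (auto simp: slice_def)
  then show "contract a b \<psi> (c \<cdot>\<^sub>m \<Phi>) $$ (k,l) = (c \<cdot>\<^sub>m contract a b \<psi> \<Phi>) $$ (k,l)"
    using k l carrier_matD[OF contract_carrier[of a b \<psi> \<Phi>]]
    by (simp add: contract_entry braket_smult_right[OF \<psi> slice_carrier])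
qed (auto simp: contract_def)

text \<open>Slice by slice, \<open>pauli_completeness\<close> turns the sum over \<open>P\<close>
  into the squared modulus of an entry of the contraction. The expectations of a stabilizer state
  vanish outside its stabilizer group, so for such a state the sum can be evaluated.\<close>

lemma nsq_contract:
  assumes v: "v \<in> carrier_mat (2^d) 1" and \<Phi>: "\<Phi> \<in> carrier_mat (2^(d+N)) 1"
  shows "(\<Sum>P\<in>words d. braket v (pauli_string P * v) * braket \<Phi> (pauli_string (P @ zeros N) * \<Phi>)) =
    2^d * complex_of_real (nsq (contract (2^d) (2^N) v \<Phi>))"
proof -
  let ?c = "slice (2^d) (2^N) \<Phi>"
  have \<Phi>': "\<Phi> \<in> carrier_mat (2^d * 2^N) 1" using \<Phi> by (simp add: power_add)
  have e: "braket \<Phi> (pauli_string (P @ zeros N) * \<Phi>) = (\<Sum>j<2^N. braket (?c j) (pauli_string P * ?c j))"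
    if P: "P \<in> words d" for P
  proof -
    have c: "pauli_string (P @ zeros N) * \<Phi> \<in> carrier_mat (2^d * 2^N) 1"
      using pauli_vec_carrier[OF append_words[OF P zeros_words] \<Phi>] by (simp add: power_add)
    show ?thesis unfolding braket_slices[OF \<Phi>' c]
      by (intro sum.cong refl) (simp add: pauli_string_append slice_kron_one[OF pauli_string_dim[OF P] \<Phi>'])
  qed
  have "(\<Sum>P\<in>words d. braket v (pauli_string P * v) * braket \<Phi> (pauli_string (P @ zeros N) * \<Phi>)) =
    (\<Sum>P\<in>words d. \<Sum>j<2^N. braket v (pauli_string P * v) * braket (?c j) (pauli_string P * ?c j))"
    by (intro sum.cong refl) (simp add: e sum_distrib_left)
  also have "\<dots> = (\<Sum>j<2^N. \<Sum>P\<in>words d. braket v (pauli_string P * v) * braket (?c j) (pauli_string P * ?c j))"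
    by (rule sum.swap)
  also have "\<dots> = (\<Sum>j<2^N. 2^d * (cnj (braket v (?c j)) * braket v (?c j)))"
    unfolding pauli_completeness[OF v v slice_carrier slice_carrier]
    by (intro sum.cong refl) (simp add: braket_cnj[OF v slice_carrier] mult_ac)
  also have "\<dots> = 2^d * braket (contract (2^d) (2^N) v \<Phi>) (contract (2^d) (2^N) v \<Phi>)"
    unfolding braket_sum[OF contract_carrier contract_carrier] sum_distrib_left
    by (intro sum.cong refl) (simp add: contract_entry)
  finally show ?thesis unfolding braket_self[OF contract_carrier] .
qed


section \<open>Multiplicativity of the stabilizer fidelity\<close>

text \<open>The stabilizers that act as the identity on the right factor; they define the local code
  on the left.\<close>

definition left_part :: "nat \<Rightarrow> nat \<Rightarrow> nat list set \<Rightarrow> nat list set" where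
  "left_part d N G = {P \<in> words d. P @ zeros N \<in> G}"

definition right_part :: "nat \<Rightarrow> nat \<Rightarrow> nat list set \<Rightarrow> nat list set" where
  "right_part d N G = {Q \<in> words N. zeros d @ Q \<in> G}"

lemma word_group_left_part:
  assumes "word_group (d + N) G" shows "word_group d (left_part d N G)"
proof -
  have "zeros d @ zeros N \<in> G" using assms by (simp add: word_group_def replicate_add)
  moreover have "wxor P Q @ zeros N \<in> G" if "P @ zeros N \<in> G" "Q @ zeros N \<in> G" "P \<in> words d" "Q \<in> words d" for P Q
    using assms that wxor_append_zeros[of P Q N] unfolding word_group_def by (metis length_words)
  ultimately show ?thesis unfolding word_group_def left_part_def using wxor_words zeros_words by blast
qed

text \<open>Translating by one element \<open>g0\<close> of the fibre cancels the left halves and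
  embeds the fibre into the right part.\<close>

lemma card_fibre:
  assumes G: "word_group (d + N) G"
  shows "card {g \<in> G. take d g = a} \<le> card (right_part d N G)"
proof (cases "{g \<in> G. take d g = a} = {}")
  case False
  then obtain g0 where g0: "g0 \<in> G" "take d g0 = a" by blast
  have Gw: "g \<in> words (d + N)" if "g \<in> G" for g using G that by (auto simp: word_group_def)
  have a: "a \<in> words d" using take_drop_words(1)[OF Gw[OF g0(1)]] g0(2) by simp
  let ?f = "\<lambda>g. wxor (drop d g0) (drop d g)"
  have q0: "drop d g0 \<in> words N" by (rule take_drop_words(2)[OF Gw[OF g0(1)]])
  have "inj_on ?f {g \<in> G. take d g = a}"
  proof (rule inj_onI)
    fix g h assume g: "g \<in> {g \<in> G. take d g = a}" and h: "h \<in> {g \<in> G. take d g = a}" and e: "?f g = ?f h"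
    have "drop d g \<in> words N" "drop d h \<in> words N" using g h take_drop_words(2)[OF Gw] by auto
    then have "drop d g = drop d h" using wxor_cancel_left[OF q0] e by metis
    then show "g = h" using g h by (metis (mono_tags, lifting) append_take_drop_id mem_Collect_eq)
  qed
  moreover have "?f ` {g \<in> G. take d g = a} \<subseteq> right_part d N G"
  proof (rule image_subsetI)
    fix g assume g: "g \<in> {g \<in> G. take d g = a}"
    have q: "drop d g \<in> words N" using g take_drop_words(2)[OF Gw] by auto
    have e: "wxor (a @ drop d g0) (a @ drop d g) = zeros d @ ?f g"
      unfolding wxor_append[OF refl] wxor_self[OF a] ..
    have ag: "take d g = a" using g by simp
    have "wxor g0 g \<in> G" using G g0(1) g unfolding word_group_def by simp
    also have "wxor g0 g = wxor (a @ drop d g0) (a @ drop d g)"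
      using append_take_drop_id[of d g0] append_take_drop_id[of d g] unfolding g0(2) ag by (simp only:)
    finally have "zeros d @ ?f g \<in> G" unfolding e .
    then show "?f g \<in> right_part d N G" using wxor_words[OF q0 q] by (simp add: right_part_def)
  qed
  moreover have "finite (right_part d N G)"
    by (rule finite_subset[OF _ finite_words[of N]]) (auto simp: right_part_def)
  ultimately show ?thesis by (rule card_inj_on_le)
next
  case True
  then show ?thesis by (simp only: card.empty le0)
qed

text \<open>The restriction of the group to the left factor commutes with the left part, which bounds the
  number of fibres and forces the right code to be at most as large as the left one.\<close>

lemma card_parts:
  assumes G: "word_group (d + N) G" and comm: "\<And>g h. g \<in> G \<Longrightarrow> h \<in> G \<Longrightarrow> comm_sign g h = 1"
    and big: "2 ^ (d + N) \<le> card G" and r: "card (left_part d N G) * 2 ^ r = 2 ^ d"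
  shows "2 ^ N \<le> card (right_part d N G) * 2 ^ r"
proof -
  let ?A = "left_part d N G" and ?B = "right_part d N G"
  have Gw: "g \<in> words (d + N)" if "g \<in> G" for g using G that by (auto simp: word_group_def)
  have finG: "finite G" using Gw by (intro finite_subset[OF _ finite_words[of "d + N"]]) blast
  have sub: "take d ` G \<subseteq> centralizer d ?A"
  proof (rule image_subsetI)
    fix g assume g: "g \<in> G"
    have "comm_sign P (take d g) = 1" if P: "P \<in> ?A" for P
    proof -
      have "P @ zeros N \<in> G" "P \<in> words d" using P by (auto simp: left_part_def)
      then have "comm_sign (P @ zeros N) (take d g @ drop d g) = 1" using comm g by simp
      moreover have "length P = length (take d g)"
        using \<open>P \<in> words d\<close> take_drop_words(1)[OF Gw[OF g]] length_words by metis
      ultimately show ?thesis by (simp add: comm_sign_append del: append_take_drop_id)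
    qed
    then show "take d g \<in> centralizer d ?A" using take_drop_words(1)[OF Gw[OF g]] by (simp add: centralizer_def)
  qed
  have finC: "finite (centralizer d ?A)"
    by (rule finite_subset[OF _ finite_words[of d]]) (auto simp: centralizer_def)
  have "G = (\<Union>a\<in>take d ` G. {g \<in> G. take d g = a})" by blast
  then have "card G \<le> (\<Sum>a\<in>take d ` G. card {g \<in> G. take d g = a})"
    using card_UN_le[of "take d ` G" "\<lambda>a. {g \<in> G. take d g = a}"] finG by simp
  also have "\<dots> \<le> (\<Sum>a\<in>take d ` G. card ?B)" by (intro sum_mono card_fibre[OF G])
  also have "\<dots> = card (take d ` G) * card ?B" by simp
  also have "\<dots> \<le> card (centralizer d ?A) * card ?B" by (intro mult_le_mono1 card_mono sub finC)
  finally have 1: "2 ^ (d + N) \<le> card (centralizer d ?A) * card ?B" using big by (rule order_trans[rotated])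
  \<comment> \<open>The centralizer has order \<open>2 ^ d * 2 ^ r\<close>, which bounds the number
    of fibres; the factor \<open>2 ^ d\<close> then cancels.\<close>
  have "card (centralizer d ?A) * card ?A = 4 ^ d" by (rule card_centralizer[OF word_group_left_part[OF G]])
  then have "card (centralizer d ?A) * 2 ^ d = 4 ^ d * 2 ^ r" using r by (metis mult.assoc)
  also have "(4::nat) ^ d = 2 ^ d * 2 ^ d" by (simp add: power_mult_distrib[symmetric])
  finally have 2: "card (centralizer d ?A) = 2 ^ d * 2 ^ r" by simp
  show ?thesis using 1 unfolding 2 power_add by (simp add: mult_ac)
qed

text \<open>The bounds \<open>a\<close> and \<open>b\<close> stand for the two fidelities but are
  left arbitrary, so that the induction over copies can supply a power for the right factor.\<close>

lemma stab_fidelity_bound_kron: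
  assumes d: "d \<le> 3" and \<Phi>: "stab_state (d + N) \<Phi>"
    and \<psi>: "\<psi> \<in> carrier_mat (2^d) 1" and \<chi>: "\<chi> \<in> carrier_mat (2^N) 1"
    and a: "0 \<le> a" "\<And>\<phi>. stab_state d \<phi> \<Longrightarrow> (cmod (braket \<psi> \<phi>))\<^sup>2 \<le> a"
    and b: "0 \<le> b" "\<And>\<phi>. stab_state N \<phi> \<Longrightarrow> (cmod (braket \<chi> \<phi>))\<^sup>2 \<le> b"
  shows "(cmod (braket (kron \<psi> \<chi>) \<Phi>))\<^sup>2 \<le> a * b"
proof -
  have u: "unit_ket (d + N) \<Phi>" and big: "2 ^ (d + N) \<le> card (stabs (d + N) \<Phi>)" using \<Phi> by (auto simp: stab_state_iff)
  have F: "\<Phi> \<in> carrier_mat (2^(d+N)) 1" "\<Phi> \<noteq> 0\<^sub>m (2^(d+N)) 1" and nF: "nsq \<Phi> = 1"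
    using u unit_ket_nonzero[OF u] by (auto simp: unit_ket_iff)
  have F': "\<Phi> \<in> carrier_mat (2^d * 2^N) 1" using F(1) by (simp add: power_add)
  define G where "G = stabs (d + N) \<Phi>"
  define A where "A = left_part d N G"
  define B where "B = right_part d N G"
  have G: "word_group (d + N) G" unfolding G_def by (rule word_group_stabs[OF F])
  have comm: "comm_sign g h = 1" if "g \<in> G" "h \<in> G" for g h using stabs_commute[OF F] that unfolding G_def by blast
  have grpA: "word_group d A" unfolding A_def by (rule word_group_left_part[OF G])
  have Aw: "A \<subseteq> words d" and Bw: "B \<subseteq> words N" by (auto simp: A_def B_def left_part_def right_part_def)
  have finA: "finite A" and finB: "finite B" using Aw Bw finite_subset[OF _ finite_words] by blast+
  have commA: "comm_sign P Q = 1" if "P \<in> A" "Q \<in> A" for P Q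
  proof -
    have "comm_sign (P @ zeros N) (Q @ zeros N) = 1" using comm that by (simp add: A_def left_part_def)
    moreover have "length P = length Q" using that Aw length_words by (metis subsetD)
    ultimately show ?thesis by (simp add: comm_sign_append)
  qed
  have commB: "comm_sign P Q = 1" if "P \<in> B" "Q \<in> B" for P Q
  proof -
    have "comm_sign (zeros d @ P) (zeros d @ Q) = 1" using comm that by (simp add: B_def right_part_def)
    then show ?thesis by (simp add: comm_sign_append)
  qed
  obtain t where t: "card A = 2 ^ t" using card_word_group[OF grpA] by blast
  \<comment> \<open>A commuting group lies in its own centralizer, so its order is at most
    \<open>2 ^ d\<close> and the subtraction in \<open>r\<close> is exact.\<close>
  have "A \<subseteq> centralizer d A" using Aw commA by (auto simp: centralizer_def)
  moreover have "finite (centralizer d A)"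
    by (rule finite_subset[OF _ finite_words[of d]]) (auto simp: centralizer_def)
  ultimately have "card A * card A \<le> 4 ^ d"
    unfolding card_centralizer[OF grpA, symmetric] by (intro mult_le_mono1 card_mono)
  then have "(2 ^ t)\<^sup>2 \<le> ((2 ^ d)\<^sup>2 :: nat)" unfolding t by (simp add: power2_eq_square power_mult_distrib[symmetric])
  then have "t \<le> d" by (simp add: power2_nat_le_eq_le power_increasing_iff)
  define r where "r = d - t"
  have r: "card A * 2 ^ r = 2 ^ d" "r \<le> 3" using t \<open>t \<le> d\<close> d by (auto simp: r_def power_add[symmetric])
  have rB: "2 ^ N \<le> card B * 2 ^ r"
    unfolding B_def by (rule card_parts[OF G comm big[folded G_def] r(1)[unfolded A_def]])
  \<comment> \<open>Words carry no sign, so \<open>s\<close> reads it off \<open>\<Phi>\<close>;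
    padding with \<open>zeros\<close> transports it to the two local codes.\<close>
  define s where "s g = (if pauli_string g * \<Phi> = \<Phi> then 1 else (- 1 :: complex))" for g
  have s: "s g = 1 \<or> s g = - 1" for g by (simp add: s_def)
  have sG: "pauli_string g * \<Phi> = s g \<cdot>\<^sub>m \<Phi>" if "g \<in> G" for g
  proof -
    have "g \<in> stabs (d + N) \<Phi>" using that by (simp add: G_def)
    then obtain c where c: "c = 1 \<or> c = - 1" "pauli_string g * \<Phi> = c \<cdot>\<^sub>m \<Phi>" by (rule stabsE)
    then show ?thesis unfolding s_def by auto
  qed
  obtain v where v: "v \<in> carrier_mat (2^d) 1" "\<And>h. h \<in> A \<Longrightarrow> pauli_string h * v = s (h @ zeros N) \<cdot>\<^sub>m v"
    "\<And>u. u \<in> carrier_mat (2^d) 1 \<Longrightarrow> (\<And>h. h \<in> A \<Longrightarrow> pauli_string h * u = s (h @ zeros N) \<cdot>\<^sub>m u) \<Longrightarrow> braket u v = braket u \<psi>"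
    using code_projection[OF finA Aw commA s \<psi>, of "\<lambda>h. h @ zeros N"] by blast
  obtain w where w: "w \<in> carrier_mat (2^N) 1" "\<And>h. h \<in> B \<Longrightarrow> pauli_string h * w = s (zeros d @ h) \<cdot>\<^sub>m w"
    "\<And>u. u \<in> carrier_mat (2^N) 1 \<Longrightarrow> (\<And>h. h \<in> B \<Longrightarrow> pauli_string h * u = s (zeros d @ h) \<cdot>\<^sub>m u) \<Longrightarrow> braket u w = braket u \<chi>"
    using code_projection[OF finB Bw commB s \<chi>, of "\<lambda>h. zeros d @ h"] by blast
  have va: "greedy_const r * nsq v \<le> a"
  proof (rule stab_overlap_bound[OF \<psi> v(1) _ _ a])
    have "A \<subseteq> stabs d v" using v(2) Aw s unfolding stabs_def by blast
    then have "card A \<le> card (stabs d v)" by (rule card_mono[OF finite_stabs])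
    then show "2 ^ d \<le> card (stabs d v) * 2 ^ r" unfolding r(1)[symmetric] by (rule mult_le_mono1)
    fix u assume u: "u \<in> carrier_mat (2^d) 1" "inherits d v u"
    show "braket u v = braket u \<psi>"
      by (rule v(3)[OF u(1)]) (use u(2) v(2) Aw s in \<open>unfold inherits_def, blast\<close>)
  qed
  have wb: "greedy_const r * nsq w \<le> b"
  proof (rule stab_overlap_bound[OF \<chi> w(1) _ _ b])
    have "B \<subseteq> stabs N w" using w(2) Bw s unfolding stabs_def by blast
    then have "card B \<le> card (stabs N w)" by (rule card_mono[OF finite_stabs])
    then have "card B * 2 ^ r \<le> card (stabs N w) * 2 ^ r" by (rule mult_le_mono1)
    then show "2 ^ N \<le> card (stabs N w) * 2 ^ r" using rB by (rule order_trans[rotated])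
    fix u assume u: "u \<in> carrier_mat (2^N) 1" "inherits N w u"
    show "braket u w = braket u \<chi>"
      by (rule w(3)[OF u(1)]) (use u(2) w(2) Bw s in \<open>unfold inherits_def, blast\<close>)
  qed
  let ?c = "\<lambda>x. contract (2^d) (2^N) x \<Phi>"
  \<comment> \<open>Every slice of \<open>\<Phi>\<close> lies in the left code, where
    \<open>\<psi>\<close> and its projection \<open>v\<close> have the same overlaps.\<close>
  have cv: "?c \<psi> = ?c v"
  proof (rule eq_matI)
    fix j k assume "j < dim_row (?c v)" "k < dim_col (?c v)"
    then have j: "j < 2^N" and k: "k = 0" by (auto simp: contract_def)
    have "braket (slice (2^d) (2^N) \<Phi> j) v = braket (slice (2^d) (2^N) \<Phi> j) \<psi>"
    proof (rule v(3)[OF slice_carrier])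
      fix h assume h: "h \<in> A"
      then have hw: "h \<in> words d" and hG: "h @ zeros N \<in> G" by (auto simp: A_def left_part_def)
      have "pauli_string h * slice (2^d) (2^N) \<Phi> j = slice (2^d) (2^N) (s (h @ zeros N) \<cdot>\<^sub>m \<Phi>) j"
        using slice_kron_one[OF pauli_string_dim[OF hw] F' j] sG[OF hG] by (simp add: pauli_string_append)
      also have "\<dots> = s (h @ zeros N) \<cdot>\<^sub>m slice (2^d) (2^N) \<Phi> j"
        using mult_add_less[OF _ j, of _ "2^d"] carrier_matD[OF F'] by (intro eq_matI) (auto simp: slice_def)
      finally show "pauli_string h * slice (2^d) (2^N) \<Phi> j = s (h @ zeros N) \<cdot>\<^sub>m slice (2^d) (2^N) \<Phi> j" .
    qed
    then have "braket v (slice (2^d) (2^N) \<Phi> j) = braket \<psi> (slice (2^d) (2^N) \<Phi> j)"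
      unfolding braket_cnj[OF slice_carrier v(1)] braket_cnj[OF slice_carrier \<psi>] by (rule arg_cong)
    then show "?c \<psi> $$ (j,k) = ?c v $$ (j,k)" using j k by (simp add: contract_entry)
  qed (auto simp: contract_def)
  have "(\<Sum>P\<in>words d. braket v (pauli_string P * v) * braket \<Phi> (pauli_string (P @ zeros N) * \<Phi>)) =
    (\<Sum>P\<in>A. braket v (pauli_string P * v) * braket \<Phi> (pauli_string (P @ zeros N) * \<Phi>))"
  proof (rule sum.mono_neutral_right)
    show "\<forall>P\<in>words d - A. braket v (pauli_string P * v) * braket \<Phi> (pauli_string (P @ zeros N) * \<Phi>) = 0"
    proof
      fix P assume P: "P \<in> words d - A"
      then have PN: "P @ zeros N \<in> words (d + N)" "P @ zeros N \<notin> G" by (auto simp: A_def left_part_def)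
      \<comment> \<open>\<open>G\<close> has the maximal order of a commuting group and so equals
        its centralizer; a word outside it anticommutes with some stabilizer.\<close>
      have "P @ zeros N \<notin> centralizer (d + N) G"
      proof
        assume "P @ zeros N \<in> centralizer (d + N) G"
        moreover have "G \<subseteq> centralizer (d + N) G" using comm G by (auto simp: centralizer_def word_group_def)
        ultimately have "G \<subset> centralizer (d + N) G" using PN by blast
        moreover have fc: "finite (centralizer (d + N) G)"
          by (rule finite_subset[OF _ finite_words[of "d + N"]]) (auto simp: centralizer_def)
        ultimately have "card G < card (centralizer (d + N) G)" by (metis psubset_card_mono)
        then have "2 ^ (d + N) < card (centralizer (d + N) G)" using big unfolding G_def by linarith
        then have "2 ^ (d + N) * 2 ^ (d + N) < card (centralizer (d + N) G) * card G"
          using big unfolding G_def by (intro mult_less_le_imp_less) auto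
        moreover have "card (centralizer (d + N) G) * card G = 2 ^ (d + N) * 2 ^ (d + N)"
          unfolding card_centralizer[OF G] by (simp add: power_mult_distrib[symmetric])
        ultimately show False by simp
      qed
      then obtain g where "g \<in> G" "comm_sign g (P @ zeros N) = -1"
        using PN(1) comm_sign_neq_1 unfolding centralizer_def by blast
      then have "braket \<Phi> (pauli_string (P @ zeros N) * \<Phi>) = 0"
        using expectation_zero[OF F(1) PN(1)] unfolding G_def by blast
      then show "braket v (pauli_string P * v) * braket \<Phi> (pauli_string (P @ zeros N) * \<Phi>) = 0" by simp
    qed
  qed (use Aw in auto)
  \<comment> \<open>Each term contains the sign of \<open>P\<close> twice, once from
    \<open>v\<close> and once from \<open>\<Phi>\<close>.\<close>
  also have "\<dots> = (\<Sum>P\<in>A. complex_of_real (nsq v))"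
  proof (intro sum.cong refl)
    fix P assume P: "P \<in> A"
    then have PG: "P @ zeros N \<in> G" by (simp add: A_def left_part_def)
    show "braket v (pauli_string P * v) * braket \<Phi> (pauli_string (P @ zeros N) * \<Phi>) = complex_of_real (nsq v)"
      unfolding v(2)[OF P] sG[OF PG] braket_smult_right[OF v(1) v(1)] braket_smult_right[OF F(1) F(1)]
        braket_self[OF v(1)] braket_self[OF F(1)] nF using s[of "P @ zeros N"] by auto
  qed
  finally have "2 ^ d * complex_of_real (nsq (?c v)) = complex_of_real (real (card A) * nsq v)"
    unfolding nsq_contract[OF v(1) F(1)] by simp
  then have "complex_of_real (2 ^ d * nsq (?c v)) = complex_of_real (real (card A) * nsq v)" by simp
  then have "2 ^ d * nsq (?c v) = real (card A) * nsq v" by (simp only: of_real_eq_iff)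
  moreover have "(2::real) ^ d = real (card A) * 2 ^ r" using arg_cong[OF r(1), of real] by simp
  ultimately have "real (card A) * (2 ^ r * nsq (?c v)) = real (card A) * nsq v" by (simp add: mult_ac)
  then have nc: "2 ^ r * nsq (?c v) = nsq v" using t by simp
  have "braket (kron \<psi> \<chi>) \<Phi> = braket \<chi> (?c v)"
    unfolding braket_kron_contract[OF \<psi> \<chi> F'] cv ..
  \<comment> \<open>The contraction lies in the right code, so \<open>\<chi>\<close> may be replaced
    by its projection \<open>w\<close>.\<close>
  also have "\<dots> = braket w (?c v)"
  proof -
    have "braket (?c v) w = braket (?c v) \<chi>"
    proof (rule w(3)[OF contract_carrier])
      fix h assume "h \<in> B"
      then have hw: "h \<in> words N" and hG: "zeros d @ h \<in> G" by (auto simp: B_def right_part_def)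
      have "pauli_string h * ?c v = contract (2^d) (2^N) v (pauli_string (zeros d @ h) * \<Phi>)"
        unfolding pauli_string_append pauli_string_zeros by (rule mult_contract[OF pauli_string_dim[OF hw] v(1) F'])
      then show "pauli_string h * ?c v = s (zeros d @ h) \<cdot>\<^sub>m ?c v"
        unfolding sG[OF hG] contract_smult[OF v(1) F'] .
    qed
    then show ?thesis unfolding braket_cnj[OF contract_carrier w(1)] braket_cnj[OF contract_carrier \<chi>] by simp
  qed
  finally have "(cmod (braket (kron \<psi> \<chi>) \<Phi>))\<^sup>2 \<le> nsq w * nsq (?c v)"
    using braket_cauchy_schwarz[OF w(1) contract_carrier] by simp
  also have "\<dots> \<le> (2 ^ r * (greedy_const r)\<^sup>2) * (nsq w * nsq (?c v))"
    using mult_right_mono[OF greedy_const_bound[OF r(2)], of "nsq w * nsq (?c v)"] by simp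
  also have "\<dots> = (greedy_const r * nsq v) * (greedy_const r * nsq w)"
    unfolding nc[symmetric] by (simp add: power2_eq_square mult_ac)
  also have "\<dots> \<le> a * b"
    using va wb a(1) greedy_const_pos[of r] by (intro mult_mono) auto
  finally show ?thesis .
qed


section \<open>Positive semidefinite matrices\<close>

definition form :: "complex mat \<Rightarrow> complex mat \<Rightarrow> complex" where
  "form A v = braket v (A * v)"

lemma form_sum:
  assumes "A \<in> carrier_mat D D" "v \<in> carrier_mat D 1"
  shows "form A v = (\<Sum>i<D. \<Sum>j<D. cnj (v $$ (i,0)) * A $$ (i,j) * v $$ (j,0))"
  unfolding form_def by (rule braket_mat[OF assms(2,1,2)])

lemma form_add:
  assumes "A \<in> carrier_mat D D" "B \<in> carrier_mat D D" "v \<in> carrier_mat D 1"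
  shows "form (A + B) v = form A v + form B v"
  unfolding form_sum[OF assms(1,3)] form_sum[OF assms(2,3)] form_sum[OF add_carrier_mat[OF assms(2)] assms(3)]
  using carrier_matD[OF assms(1)] carrier_matD[OF assms(2)]
  by (simp add: sum.distrib[symmetric] algebra_simps)

lemma form_minus:
  assumes "A \<in> carrier_mat D D" "B \<in> carrier_mat D D" "v \<in> carrier_mat D 1"
  shows "form (A - B) v = form A v - form B v"
  unfolding form_sum[OF assms(1,3)] form_sum[OF assms(2,3)] form_sum[OF minus_carrier_mat[OF assms(2)] assms(3)]
  using carrier_matD[OF assms(1)] carrier_matD[OF assms(2)]
  by (simp add: sum_subtractf[symmetric] algebra_simps)

lemma form_smult:
  assumes "A \<in> carrier_mat D D" "v \<in> carrier_mat D 1"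
  shows "form (c \<cdot>\<^sub>m A) v = c * form A v"
  unfolding form_sum[OF assms] form_sum[OF smult_carrier_mat[OF assms(1)] assms(2)]
  using carrier_matD[OF assms(1)] by (simp add: sum_distrib_left mult_ac)

lemma form_zero: "v \<in> carrier_mat D 1 \<Longrightarrow> form (0\<^sub>m D D) v = 0"
  by (subst form_sum[OF zero_carrier_mat]) auto

lemma psd_carrier: "psd D A \<Longrightarrow> A \<in> carrier_mat D D"
  by (simp add: psd_def)

lemma psd_form: "psd D A \<longleftrightarrow> A \<in> carrier_mat D D \<and> (\<forall>v \<in> carrier_mat D 1. Im (form A v) = 0 \<and> Re (form A v) \<ge> 0)"
  unfolding psd_iff form_def ..

lemma psd_add:
  assumes "psd D A" "psd D B" shows "psd D (A + B)"
  using assms form_add[of A D B] by (simp add: psd_form add_carrier_mat)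

lemma psd_smult:
  assumes "psd D A" "0 \<le> c" shows "psd D (complex_of_real c \<cdot>\<^sub>m A)"
  using assms form_smult[of A D _ "complex_of_real c"] by (simp add: psd_form smult_carrier_mat)

lemma psd_zero: "psd D (0\<^sub>m D D)"
  by (simp add: psd_form form_zero)

lemma form_sandwich:
  assumes K: "K \<in> carrier_mat a b" and X: "X \<in> carrier_mat b b" and v: "v \<in> carrier_mat a 1"
  shows "form (K * X * adj K) v = form X (adj K * v)"
proof -
  have Kv: "adj K * v \<in> carrier_mat b 1" by (rule mult_carrier_mat[OF adj_carrier[OF K] v])
  have "K * X * adj K * v = K * X * (adj K * v)"
    by (rule assoc_mult_mat[OF mult_carrier_mat[OF K X] adj_carrier[OF K] v])
  also have "\<dots> = K * (X * (adj K * v))"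
    by (rule assoc_mult_mat[OF K X Kv])
  finally show ?thesis unfolding form_def
    using braket_adjoint[OF v K mult_carrier_mat[OF X Kv]] by simp
qed

lemma sandwich_carrier:
  "K \<in> carrier_mat a b \<Longrightarrow> X \<in> carrier_mat b b \<Longrightarrow> K * X * adj K \<in> carrier_mat a a"
  by (meson adj_carrier mult_carrier_mat)

lemma psd_sandwich:
  assumes "K \<in> carrier_mat a b" "psd b X" shows "psd a (K * X * adj K)"
  using assms(2) sandwich_carrier[OF assms(1) psd_carrier[OF assms(2)]]
    form_sandwich[OF assms(1) psd_carrier[OF assms(2)]] mult_carrier_mat[OF adj_carrier[OF assms(1)]]
  by (simp add: psd_form)

lemma proj_carrier: "x \<in> carrier_mat D 1 \<Longrightarrow> proj x \<in> carrier_mat D D"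
  unfolding proj_def by (meson adj_carrier mult_carrier_mat)

lemma proj_entry:
  assumes "x \<in> carrier_mat D 1" "i < D" "j < D"
  shows "proj x $$ (i,j) = x $$ (i,0) * cnj (x $$ (j,0))"
  unfolding proj_def mat_mult_entry[OF assms(1) adj_carrier[OF assms(1)] assms(2,3)]
  using carrier_matD[OF assms(1)] assms(3) by (simp add: lessThan_Suc One_nat_def)

lemma form_proj:
  assumes x: "x \<in> carrier_mat D 1" and v: "v \<in> carrier_mat D 1"
  shows "form (proj x) v = complex_of_real ((cmod (braket v x))\<^sup>2)"
proof -
  have "form (proj x) v = (\<Sum>i<D. \<Sum>j<D. (cnj (v $$ (i,0)) * x $$ (i,0)) * (cnj (x $$ (j,0)) * v $$ (j,0)))"
    unfolding form_sum[OF proj_carrier[OF x] v] by (intro sum.cong refl) (simp add: proj_entry[OF x])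
  also have "\<dots> = braket v x * braket x v"
    unfolding braket_sum[OF v x] braket_sum[OF x v] by (simp add: sum_product)
  finally show ?thesis unfolding braket_cnj[OF v x] complex_norm_square[symmetric] .
qed

lemma psd_proj: "x \<in> carrier_mat D 1 \<Longrightarrow> psd D (proj x)"
  by (simp add: psd_form proj_carrier form_proj)

lemma proj_kron:
  assumes "x \<in> carrier_mat a 1" "y \<in> carrier_mat b 1"
  shows "proj (kron x y) = kron (proj x) (proj y)"
  unfolding proj_def adj_kron by (rule kron_mult[OF assms(1) adj_carrier[OF assms(1)] assms(2) adj_carrier[OF assms(2)]])

text \<open>Conjugating \<open>B\<close> by the embedding \<open>kron x (1\<^sub>m b)\<close>
  produces this product, so \<open>psd_sandwich\<close> applies.\<close>

lemma psd_kron_proj: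
  assumes x: "x \<in> carrier_mat a 1" and B: "psd b B"
  shows "psd (a * b) (kron (proj x) B)"
proof -
  note Bc = psd_carrier[OF B]
  have K: "kron x (1\<^sub>m b) \<in> carrier_mat (a * b) b" using kron_carrier[OF x one_carrier_mat[of b]] by simp
  have "kron x (1\<^sub>m b) * B = kron x (1\<^sub>m b) * kron (1\<^sub>m 1) B" by (simp only: kron_one_one_left)
  also have "\<dots> = kron x B"
    unfolding kron_mult[OF x one_carrier_mat one_carrier_mat Bc] right_mult_one_mat[OF x] left_mult_one_mat[OF Bc] ..
  finally have "kron x (1\<^sub>m b) * B * adj (kron x (1\<^sub>m b)) = kron x B * kron (adj x) (adj (1\<^sub>m b))" by (simp only: adj_kron)
  also have "\<dots> = kron (proj x) (B * adj (1\<^sub>m b))"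
    unfolding proj_def by (rule kron_mult[OF x adj_carrier[OF x] Bc adj_carrier[OF one_carrier_mat]])
  also have "adj (1\<^sub>m b) = 1\<^sub>m b" by (rule eq_matI) auto
  finally show ?thesis using psd_sandwich[OF K B] unfolding right_mult_one_mat[OF Bc] by simp
qed

definition basis_ket :: "nat \<Rightarrow> nat \<Rightarrow> complex mat" where
  "basis_ket D k = mat D 1 (\<lambda>(i,_). if i = k then 1 else 0)"

lemma basis_ket_carrier [simp]: "basis_ket D k \<in> carrier_mat D 1"
  by (simp add: basis_ket_def)

lemma mat_basis_ket:
  assumes "A \<in> carrier_mat D D" "i < D" "k < D"
  shows "(A * basis_ket D k) $$ (i,0) = A $$ (i,k)"
proof -
  have "(A * basis_ket D k) $$ (i,0) = (\<Sum>j<D. if j = k then A $$ (i,j) else 0)"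
    unfolding mat_mult_entry[OF assms(1) basis_ket_carrier assms(2) zero_less_1_nat]
    by (intro sum.cong refl) (simp add: basis_ket_def)
  then show ?thesis using assms(3) by simp
qed

lemma braket_basis_ket:
  assumes "v \<in> carrier_mat D 1" "k < D" shows "braket (basis_ket D k) v = v $$ (k,0)"
proof -
  have "braket (basis_ket D k) v = (\<Sum>i<D. if i = k then v $$ (i,0) else 0)"
    unfolding braket_sum[OF basis_ket_carrier assms(1)] by (intro sum.cong refl) (simp add: basis_ket_def)
  then show ?thesis using assms(2) by simp
qed

lemma psd_entry:
  assumes "A \<in> carrier_mat D D" "i < D" "j < D"
  shows "braket (basis_ket D i) (A * basis_ket D j) = A $$ (i,j)"
  unfolding braket_basis_ket[OF mult_carrier_mat[OF assms(1) basis_ket_carrier] assms(2)]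
  by (rule mat_basis_ket[OF assms])

lemma psd_tr:
  assumes "psd D A" shows "Im (tr A) = 0" "0 \<le> Re (tr A)"
proof -
  note A = psd_carrier[OF assms]
  have "Im (A $$ (i,i)) = 0 \<and> 0 \<le> Re (A $$ (i,i))" if "i < D" for i
    using assms basis_ket_carrier[of D i] unfolding psd_iff psd_entry[OF A that that, symmetric] by blast
  then show "Im (tr A) = 0" "0 \<le> Re (tr A)" using carrier_matD[OF A] by (auto simp: tr_def intro!: sum_nonneg)
qed

text \<open>A psd matrix is peeled, one row at a time, into rank-one matrices (a Cholesky
  decomposition), for each of which the claim is a sandwich.\<close>

lemma psd_kron_peel:
  assumes "psd a A" "psd b B" "\<And>i j. i < a \<Longrightarrow> j < a \<Longrightarrow> i < k \<or> j < k \<Longrightarrow> A $$ (i,j) = 0" "k \<le> a"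
  shows "psd (a * b) (kron A B)"
  using assms
proof (induction "a - k" arbitrary: k A)
  case 0
  note A = psd_carrier[OF 0(2)] and B = psd_carrier[OF 0(3)]
  have "kron A B = 0\<^sub>m (a * b) (a * b)"
  proof (rule kron_eqI[where a=a and b=a and c=b and d=b])
    fix p q r s assume i: "p < a" "q < b" "r < a" "s < b"
    then have "A $$ (p,r) = 0" using 0 by simp
    then show "kron A B $$ (p * b + q, r * b + s) = 0\<^sub>m (a * b) (a * b) $$ (p * b + q, r * b + s)"
      using i by (simp add: kron_entry[OF A B] mult_add_less)
  qed (use kron_carrier[OF A B] in auto)
  then show ?case by (simp add: psd_zero)
next
  case (Suc m)
  note psdA = Suc(3) and psdB = Suc(4)
  note A = psd_carrier[OF psdA] and B = psd_carrier[OF psdB]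
  have k: "k < a" using Suc(2) by simp
  let ?e = "basis_ket a k"
  define x where "x = Re (A $$ (k,k))"
  have re: "Re (braket ?e (A * ?e)) = x" unfolding psd_entry[OF A k k] x_def ..
  have x0: "0 \<le> x" using psdA basis_ket_carrier[of a k] unfolding psd_iff re[symmetric] by blast
  have "Im (braket ?e (A * ?e)) = 0" using psdA basis_ket_carrier[of a k] unfolding psd_iff by blast
  then have imk: "A $$ (k,k) = complex_of_real x" unfolding psd_entry[OF A k k] x_def by (simp add: complex_eq_iff)
  have herm: "A $$ (j,i) = cnj (A $$ (i,j))" if "i < a" "j < a" for i j
    using psd_hermitian_form[OF psdA basis_ket_carrier[of a i] basis_ket_carrier[of a j]] that by (simp add: psd_entry[OF A])
  show ?case
  proof (cases "x = 0")
    case True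
    \<comment> \<open>A zero pivot forces its whole row to vanish by Cauchy-Schwarz, so nothing has
      to be subtracted.\<close>
    have row: "A $$ (k,j) = 0" if j: "j < a" for j
      using psd_cauchy_schwarz[OF psdA basis_ket_carrier[of a k] basis_ket_carrier[of a j]] True
      unfolding re psd_entry[OF A k j] by simp
    show ?thesis
    proof (rule Suc(1)[of "Suc k"])
      fix i j assume ij: "i < a" "j < a" "i < Suc k \<or> j < Suc k"
      then consider "i < k \<or> j < k" | "i = k" | "j = k" by linarith
      then show "A $$ (i,j) = 0" using Suc(5)[of i j] ij row herm[of k i] by cases auto
    qed (use Suc(2) k psdA psdB in auto)
  next
    case False
    then have xp: "x > 0" using x0 by simp
    \<comment> \<open>\<open>y\<close> is column \<open>k\<close> divided by the root of the pivot.
      Subtracting \<open>proj y\<close> clears row and column \<open>k\<close> and leaves the Schur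
      complement.\<close>
    define c where "c = complex_of_real (1 / sqrt x)"
    define y where "y = c \<cdot>\<^sub>m (A * ?e)"
    have Ae: "A * ?e \<in> carrier_mat a 1" by (rule mult_carrier_mat[OF A basis_ket_carrier])
    have y: "y \<in> carrier_mat a 1" unfolding y_def by (rule smult_carrier_mat[OF Ae])
    have cc: "(cmod c)\<^sup>2 = 1 / x" "c * cnj c = complex_of_real (1 / x)"
      using xp by (auto simp: c_def norm_divide power_divide power2_eq_square real_sqrt_mult_self simp flip: of_real_mult)
    have yent: "y $$ (i,0) = c * A $$ (i,k)" if "i < a" for i
      unfolding y_def using mat_basis_ket[OF A that k] carrier_matD[OF Ae] that by simp
    define A' where "A' = A - proj y"
    have A': "A' \<in> carrier_mat a a" unfolding A'_def by (rule minus_carrier_mat[OF proj_carrier[OF y]])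
    have A'ent: "A' $$ (i,j) = A $$ (i,j) - A $$ (i,k) * cnj (A $$ (j,k)) * complex_of_real (1 / x)" if "i < a" "j < a" for i j
      unfolding cc(2)[symmetric] A'_def using that carrier_matD[OF proj_carrier[OF y]]
      by (simp add: proj_entry[OF y] yent mult_ac)
    \<comment> \<open>Cauchy-Schwarz against \<open>?e\<close> says exactly that the subtracted form
      is at most the form of \<open>A\<close>.\<close>
    have psdA': "psd a A'"
      unfolding psd_form
    proof (intro conjI ballI A')
      fix v :: "complex mat" assume v: "v \<in> carrier_mat a 1"
      have f: "form A' v = form A v - complex_of_real ((cmod (braket v y))\<^sup>2)"
        unfolding A'_def form_minus[OF A proj_carrier[OF y] v] form_proj[OF y v] ..
      have "braket v y = c * braket v (A * ?e)" unfolding y_def by (rule braket_smult_right[OF v Ae])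
      also have "braket v (A * ?e) = cnj (braket ?e (A * v))"
        by (rule psd_hermitian_form[OF psdA basis_ket_carrier v])
      finally have "(cmod (braket v y))\<^sup>2 = (cmod (braket ?e (A * v)))\<^sup>2 / x"
        by (simp add: norm_mult power_mult_distrib cc)
      also have "\<dots> \<le> Re (form A v)"
        using psd_cauchy_schwarz[OF psdA basis_ket_carrier[of a k] v] xp unfolding re form_def
        by (simp add: divide_le_eq mult.commute)
      finally show "0 \<le> Re (form A' v)" unfolding f by simp
      show "Im (form A' v) = 0" unfolding f using psdA v by (simp add: psd_form)
    qed
    have "psd (a * b) (kron A' B)"
    proof (rule Suc(1)[of "Suc k", OF _ psdA' psdB])
      fix i j assume ij: "i < a" "j < a" "i < Suc k \<or> j < Suc k"
      then consider "i < k \<or> j < k" | "i = k" | "j = k" by linarith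
      then show "A' $$ (i,j) = 0"
      proof cases
        case 1
        \<comment> \<open>Rows and columns cleared earlier stay zero, because column
          \<open>k\<close> vanishes there as well.\<close>
        then have "A $$ (i,j) = 0" "A $$ (i,k) = 0 \<or> A $$ (j,k) = 0" using Suc(5) ij k by auto
        then show ?thesis by (auto simp: A'ent[OF ij(1,2)])
      next
        case 2
        then show ?thesis unfolding A'ent[OF ij(1,2)] using herm[OF ij(2) k] xp by (simp add: imk)
      next
        case 3
        then show ?thesis unfolding A'ent[OF ij(1,2)] using xp by (simp add: imk)
      qed
    qed (use Suc(2) k in auto)
    moreover have "A = proj y + A'"
      unfolding A'_def using carrier_matD[OF A] carrier_matD[OF proj_carrier[OF y]] by (intro eq_matI) auto
    then have "kron A B = kron (proj y) B + kron A' B" using kron_add_left[OF proj_carrier[OF y] A', of B] by simp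
    ultimately show ?thesis using psd_add[OF psd_kron_proj[OF y psdB]] by simp
  qed
qed

lemma psd_kron: "psd a A \<Longrightarrow> psd b B \<Longrightarrow> psd (a * b) (kron A B)"
  using psd_kron_peel[of a A b B 0] by simp


section \<open>Mixed stabilizer states\<close>

lemma msum_Nil [simp]: "msum d [] = 0\<^sub>m d d"
  by (simp add: msum_def)

lemma msum_Cons [simp]: "msum d (A # As) = A + msum d As"
  by (simp add: msum_def)

lemma msum_carrier: "set As \<subseteq> carrier_mat d d \<Longrightarrow> msum d As \<in> carrier_mat d d"
  by (induction As) (auto intro: add_carrier_mat)

lemma msum_append:
  "set As \<subseteq> carrier_mat d d \<Longrightarrow> set Bs \<subseteq> carrier_mat d d \<Longrightarrow> msum d (As @ Bs) = msum d As + msum d Bs"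
proof (induction As)
  case Nil
  then show ?case using left_add_zero_mat[OF msum_carrier] by simp
next
  case (Cons A As)
  then show ?case using assoc_add_mat[of A d d "msum d As" "msum d Bs"] by (simp add: msum_carrier)
qed

lemma form_msum:
  assumes "v \<in> carrier_mat d 1"
  shows "set As \<subseteq> carrier_mat d d \<Longrightarrow> form (msum d As) v = (\<Sum>A\<leftarrow>As. form A v)"
proof (induction As)
  case Nil
  then show ?case using form_zero[OF assms] by simp
next
  case (Cons A As)
  then show ?case using form_add[OF _ msum_carrier assms, of A As] by simp
qed

lemma tr_add: "A \<in> carrier_mat d d \<Longrightarrow> B \<in> carrier_mat d d \<Longrightarrow> tr (A + B) = tr A + tr B"
  by (auto simp: tr_def sum.distrib)

lemma tr_minus: "A \<in> carrier_mat d d \<Longrightarrow> B \<in> carrier_mat d d \<Longrightarrow> tr (A - B) = tr A - tr B"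
  by (auto simp: tr_def sum_subtractf)

lemma tr_smult: "A \<in> carrier_mat d d \<Longrightarrow> tr (c \<cdot>\<^sub>m A) = c * tr A"
  by (auto simp: tr_def sum_distrib_left)

lemma tr_mult_commute:
  assumes "A \<in> carrier_mat a b" "B \<in> carrier_mat b a" shows "tr (A * B) = tr (B * A)"
proof -
  have "tr (A * B) = (\<Sum>i<a. \<Sum>j<b. A $$ (i,j) * B $$ (j,i))"
    unfolding tr_def using carrier_matD[OF assms(1)] by (simp add: mat_mult_entry[OF assms] del: index_mult_mat(1))
  also have "\<dots> = (\<Sum>j<b. \<Sum>i<a. B $$ (j,i) * A $$ (i,j))"
    by (subst sum.swap) (simp add: mult.commute)
  also have "\<dots> = tr (B * A)"
    unfolding tr_def using carrier_matD[OF assms(2)] by (simp add: mat_mult_entry[OF assms(2,1)] del: index_mult_mat(1))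
  finally show ?thesis .
qed

lemma tr_proj: "x \<in> carrier_mat d 1 \<Longrightarrow> tr (proj x) = complex_of_real (nsq x)"
  using carrier_matD[OF proj_carrier[of x d]] carrier_matD[of x d 1]
  by (simp add: tr_def proj_entry nsq_def complex_norm_square[symmetric] del: of_real_power)

section \<open>Weighted lists of stabilizer states\<close>

text \<open>The total weight is left free, so that statements can be proved by induction on the
  list.\<close>

definition ensemble :: "nat \<Rightarrow> (real \<times> complex mat) list \<Rightarrow> bool" where
  "ensemble n ps \<longleftrightarrow> (\<forall>(w,\<phi>)\<in>set ps. 0 \<le> w \<and> stab_state n \<phi>)"

definition ensemble_mat :: "nat \<Rightarrow> (real \<times> complex mat) list \<Rightarrow> complex mat" where
  "ensemble_mat n ps = msum (2^n) (map (\<lambda>(w,\<phi>). complex_of_real w \<cdot>\<^sub>m proj \<phi>) ps)"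

lemma mixed_stab_iff:
  "mixed_stab n \<sigma> \<longleftrightarrow> (\<exists>ps. ensemble n ps \<and> sum_list (map fst ps) = 1 \<and> \<sigma> = ensemble_mat n ps)"
proof
  assume "mixed_stab n \<sigma>"
  then obtain ws \<phi>s where *: "length ws = length \<phi>s" "\<forall>w\<in>set ws. w \<ge> 0" "sum_list ws = (1::real)"
    "\<forall>\<phi>\<in>set \<phi>s. stab_state n \<phi>" "\<sigma> = ensemble_mat n (zip ws \<phi>s)" unfolding mixed_stab_def ensemble_mat_def by blast
  have "ensemble n (zip ws \<phi>s)" unfolding ensemble_def using *(2,4) by (auto dest: set_zip_leftD set_zip_rightD)
  moreover have "sum_list (map fst (zip ws \<phi>s)) = 1" using *(1,3) by simp
  ultimately show "\<exists>ps. ensemble n ps \<and> sum_list (map fst ps) = 1 \<and> \<sigma> = ensemble_mat n ps" using *(5) by blast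
next
  assume "\<exists>ps. ensemble n ps \<and> sum_list (map fst ps) = 1 \<and> \<sigma> = ensemble_mat n ps"
  then obtain ps where *: "ensemble n ps" "sum_list (map fst ps) = 1" "\<sigma> = ensemble_mat n ps" by blast
  then show "mixed_stab n \<sigma>" unfolding mixed_stab_def
    by (intro exI[of _ "map fst ps"] exI[of _ "map snd ps"]) (auto simp: zip_map_fst_snd ensemble_mat_def ensemble_def)
qed

lemma stab_state_carrier: "stab_state n \<phi> \<Longrightarrow> \<phi> \<in> carrier_mat (2^n) 1"
  by (simp add: stab_state_def unit_ket_def)

lemma stab_state_nsq: "stab_state n \<phi> \<Longrightarrow> nsq \<phi> = 1"
  by (simp add: stab_state_def unit_ket_iff)

lemma ensemble_Cons:
  "ensemble n ((w,\<phi>) # ps) \<longleftrightarrow> 0 \<le> w \<and> stab_state n \<phi> \<and> ensemble n ps"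
  by (auto simp: ensemble_def)

lemma ensemble_mat_Cons:
  "ensemble_mat n ((w,\<phi>) # ps) = complex_of_real w \<cdot>\<^sub>m proj \<phi> + ensemble_mat n ps"
  by (simp add: ensemble_mat_def)

lemma ensemble_psd: "ensemble n ps \<Longrightarrow> psd (2^n) (ensemble_mat n ps)"
proof (induction ps)
  case Nil
  then show ?case by (simp add: ensemble_mat_def psd_zero)
next
  case (Cons p ps)
  obtain w \<phi> where p: "p = (w,\<phi>)" by (cases p)
  show ?case using Cons unfolding p ensemble_Cons ensemble_mat_Cons
    by (auto intro!: psd_add psd_smult psd_proj stab_state_carrier)
qed

lemma ensemble_tr: "ensemble n ps \<Longrightarrow> tr (ensemble_mat n ps) = complex_of_real (sum_list (map fst ps))"
proof (induction ps)
  case Nil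
  then show ?case by (simp add: ensemble_mat_def tr_def)
next
  case (Cons p ps)
  obtain w \<phi> where p: "p = (w,\<phi>)" by (cases p)
  have e: "0 \<le> w" "stab_state n \<phi>" "ensemble n ps" using Cons.prems unfolding p ensemble_Cons by auto
  have c: "proj \<phi> \<in> carrier_mat (2^n) (2^n)" by (rule proj_carrier[OF stab_state_carrier[OF e(2)]])
  show ?case
    unfolding p ensemble_mat_Cons tr_add[OF smult_carrier_mat[OF c] psd_carrier[OF ensemble_psd[OF e(3)]]]
      tr_smult[OF c] tr_proj[OF stab_state_carrier[OF e(2)]] stab_state_nsq[OF e(2)] Cons.IH[OF e(3)] by simp
qed

lemma ensemble_form_le:
  assumes v: "v \<in> carrier_mat (2^n) 1" and f: "\<And>\<phi>. stab_state n \<phi> \<Longrightarrow> (cmod (braket v \<phi>))\<^sup>2 \<le> f"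
  shows "ensemble n ps \<Longrightarrow> Re (form (ensemble_mat n ps) v) \<le> sum_list (map fst ps) * f"
proof (induction ps)
  case Nil
  then show ?case using form_zero[OF v] by (simp add: ensemble_mat_def)
next
  case (Cons p ps)
  obtain w \<phi> where p: "p = (w,\<phi>)" by (cases p)
  have e: "0 \<le> w" "stab_state n \<phi>" "ensemble n ps" using Cons.prems unfolding p ensemble_Cons by auto
  have c: "proj \<phi> \<in> carrier_mat (2^n) (2^n)" by (rule proj_carrier[OF stab_state_carrier[OF e(2)]])
  have "Re (form (ensemble_mat n (p # ps)) v) = w * (cmod (braket v \<phi>))\<^sup>2 + Re (form (ensemble_mat n ps) v)"
    unfolding p ensemble_mat_Cons form_add[OF smult_carrier_mat[OF c] psd_carrier[OF ensemble_psd[OF e(3)]] v]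
      form_smult[OF c v] form_proj[OF stab_state_carrier[OF e(2)] v] by simp
  also have "\<dots> \<le> w * f + sum_list (map fst ps) * f"
    by (intro add_mono mult_left_mono f e Cons.IH)
  finally show ?case by (simp add: p distrib_right)
qed

lemma mixed_stab_psd: "mixed_stab n \<sigma> \<Longrightarrow> psd (2^n) \<sigma>"
  unfolding mixed_stab_iff using ensemble_psd by blast

lemma mixed_stab_tr: "mixed_stab n \<sigma> \<Longrightarrow> tr \<sigma> = 1"
  unfolding mixed_stab_iff using ensemble_tr by fastforce

lemma mixed_stab_form_le:
  assumes "mixed_stab n \<sigma>" "v \<in> carrier_mat (2^n) 1" "\<And>\<phi>. stab_state n \<phi> \<Longrightarrow> (cmod (braket v \<phi>))\<^sup>2 \<le> f"
  shows "Re (form \<sigma> v) \<le> f"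
proof -
  obtain ps where "ensemble n ps" "sum_list (map fst ps) = 1" "\<sigma> = ensemble_mat n ps"
    using assms(1) unfolding mixed_stab_iff by blast
  then show ?thesis using ensemble_form_le[OF assms(2,3), of ps] by simp
qed

text \<open>Concatenated stabilizers fix the product vector with the product of their signs, and
  concatenation of words of fixed length is injective.\<close>

lemma stab_state_kron:
  assumes \<phi>: "stab_state a \<phi>" and \<chi>: "stab_state b \<chi>"
  shows "stab_state (a + b) (kron \<phi> \<chi>)"
proof -
  note c = stab_state_carrier[OF \<phi>] stab_state_carrier[OF \<chi>]
  have k: "kron \<phi> \<chi> \<in> carrier_mat (2^(a+b)) 1" using kron_carrier[OF c] by (simp add: power_add)
  have n: "nsq (kron \<phi> \<chi>) = 1" unfolding nsq_kron[OF c] using stab_state_nsq[OF \<phi>] stab_state_nsq[OF \<chi>] by simp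
  let ?f = "\<lambda>(u,w). u @ w"
  have "inj_on ?f (stabs a \<phi> \<times> stabs b \<chi>)"
  proof (rule inj_onI, clarify)
    fix u w u' w' assume "u \<in> stabs a \<phi>" "u' \<in> stabs a \<phi>" "u @ w = u' @ w'"
    moreover from this have "length u = length u'" using stabs_words length_words by metis
    ultimately show "u = u' \<and> w = w'" by simp
  qed
  moreover have "?f ` (stabs a \<phi> \<times> stabs b \<chi>) \<subseteq> stabs (a + b) (kron \<phi> \<chi>)"
  proof (rule image_subsetI, clarify)
    fix u w assume uw: "u \<in> stabs a \<phi>" "w \<in> stabs b \<chi>"
    obtain s where s: "s = 1 \<or> s = - 1" "pauli_string u * \<phi> = s \<cdot>\<^sub>m \<phi>" "u \<in> words a" using uw(1) by (rule stabsE)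
    obtain t where t: "t = 1 \<or> t = - 1" "pauli_string w * \<chi> = t \<cdot>\<^sub>m \<chi>" "w \<in> words b" using uw(2) by (rule stabsE)
    have "pauli_string (u @ w) * kron \<phi> \<chi> = (t * s) \<cdot>\<^sub>m kron \<phi> \<chi>"
      unfolding pauli_string_append kron_mult[OF pauli_string_dim[OF s(3)] c(1) pauli_string_dim[OF t(3)] c(2)] s(2) t(2)
        kron_smult_left kron_smult_right smult_smult_assoc_mat ..
    moreover have "t * s = 1 \<or> t * s = - 1" using s(1) t(1) by auto
    ultimately show "u @ w \<in> stabs (a + b) (kron \<phi> \<chi>)"
      using append_words[OF s(3) t(3)] unfolding stabs_def by blast
  qed
  ultimately have "card (stabs a \<phi> \<times> stabs b \<chi>) \<le> card (stabs (a + b) (kron \<phi> \<chi>))"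
    by (rule card_inj_on_le[OF _ _ finite_stabs])
  moreover have "2 ^ a * 2 ^ b \<le> card (stabs a \<phi>) * card (stabs b \<chi>)"
    using \<phi> \<chi> unfolding stab_state_iff by (intro mult_le_mono) auto
  ultimately show ?thesis unfolding stab_state_iff unit_ket_iff
    using k n by (simp add: card_cartesian_product power_add)
qed

definition kron_ensemble :: "(real \<times> complex mat) list \<Rightarrow> (real \<times> complex mat) list \<Rightarrow> (real \<times> complex mat) list" where
  "kron_ensemble ps qs = concat (map (\<lambda>(w,\<phi>). map (\<lambda>(x,\<chi>). (w * x, kron \<phi> \<chi>)) qs) ps)"

lemma ensemble_kron:
  assumes "ensemble a ps" "ensemble b qs" shows "ensemble (a + b) (kron_ensemble ps qs)"
  using assms unfolding ensemble_def kron_ensemble_def by (fastforce intro: stab_state_kron)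

lemma ensemble_append: "ensemble n (ps @ qs) \<longleftrightarrow> ensemble n ps \<and> ensemble n qs"
  by (auto simp: ensemble_def)

lemma ensemble_terms_carrier:
  "ensemble n ps \<Longrightarrow> set (map (\<lambda>(w,\<phi>). complex_of_real w \<cdot>\<^sub>m proj \<phi>) ps) \<subseteq> carrier_mat (2^n) (2^n)"
  by (auto simp: ensemble_def intro!: smult_carrier_mat proj_carrier dest: stab_state_carrier)

lemma ensemble_mat_append:
  assumes "ensemble n ps" "ensemble n qs"
  shows "ensemble_mat n (ps @ qs) = ensemble_mat n ps + ensemble_mat n qs"
  unfolding ensemble_mat_def map_append
  by (rule msum_append[OF ensemble_terms_carrier[OF assms(1)] ensemble_terms_carrier[OF assms(2)]])

lemma kron_zero_right: "kron A (0\<^sub>m c d) = 0\<^sub>m (dim_row A * c) (dim_col A * d)"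
proof (rule eq_matI)
  fix i j assume "i < dim_row (0\<^sub>m (dim_row A * c) (dim_col A * d))" "j < dim_col (0\<^sub>m (dim_row A * c) (dim_col A * d))"
  then have ij: "i < dim_row A * c" "j < dim_col A * d" by auto
  then show "kron A (0\<^sub>m c d) $$ (i,j) = 0\<^sub>m (dim_row A * c) (dim_col A * d) $$ (i,j)"
    using div_mod_less_mult[OF ij(1)] div_mod_less_mult[OF ij(2)] by (simp add: kron_index)
qed auto

lemma kron_zero_left: "kron (0\<^sub>m a b) A = 0\<^sub>m (a * dim_row A) (b * dim_col A)"
proof (rule eq_matI)
  fix i j assume "i < dim_row (0\<^sub>m (a * dim_row A) (b * dim_col A))" "j < dim_col (0\<^sub>m (a * dim_row A) (b * dim_col A))"
  then have ij: "i < a * dim_row A" "j < b * dim_col A" by auto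
  then show "kron (0\<^sub>m a b) A $$ (i,j) = 0\<^sub>m (a * dim_row A) (b * dim_col A) $$ (i,j)"
    using div_mod_less_mult[OF ij(1)] div_mod_less_mult[OF ij(2)] by (simp add: kron_index)
qed auto

lemma ensemble_mat_kron_single:
  assumes \<phi>: "stab_state a \<phi>"
  shows "ensemble b qs \<Longrightarrow> ensemble_mat (a + b) (map (\<lambda>(x,\<chi>). (w * x, kron \<phi> \<chi>)) qs) =
    kron (complex_of_real w \<cdot>\<^sub>m proj \<phi>) (ensemble_mat b qs)"
proof (induction qs)
  case Nil
  then show ?case using carrier_matD[OF proj_carrier[OF stab_state_carrier[OF \<phi>]]]
    by (simp add: ensemble_mat_def kron_zero_right power_add)
next
  case (Cons q qs)
  obtain x \<chi> where q: "q = (x,\<chi>)" by (cases q)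
  have e: "stab_state b \<chi>" "ensemble b qs" using Cons.prems unfolding q ensemble_Cons by auto
  note c = stab_state_carrier[OF \<phi>] stab_state_carrier[OF e(1)]
  show ?case
    unfolding q list.map case_prod_conv ensemble_mat_Cons Cons.IH[OF e(2)] proj_kron[OF c]
      kron_add_right[OF smult_carrier_mat[OF proj_carrier[OF c(2)]] psd_carrier[OF ensemble_psd[OF e(2)]]]
      kron_smult_left kron_smult_right smult_smult_assoc_mat by (simp add: mult.commute)
qed

lemma ensemble_mat_kron:
  "ensemble a ps \<Longrightarrow> ensemble b qs \<Longrightarrow> ensemble_mat (a + b) (kron_ensemble ps qs) = kron (ensemble_mat a ps) (ensemble_mat b qs)"
proof (induction ps)
  case Nil
  then show ?case using carrier_matD[OF psd_carrier[OF ensemble_psd[OF Nil(2)]]]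
    by (simp add: kron_ensemble_def ensemble_mat_def kron_zero_left power_add)
next
  case (Cons p ps)
  obtain w \<phi> where p: "p = (w,\<phi>)" by (cases p)
  have e: "0 \<le> w" "stab_state a \<phi>" "ensemble a ps" using Cons.prems unfolding p ensemble_Cons by auto
  let ?l = "map (\<lambda>(x,\<chi>). (w * x, kron \<phi> \<chi>)) qs"
  have k: "kron_ensemble ((w,\<phi>) # ps) qs = ?l @ kron_ensemble ps qs" by (simp add: kron_ensemble_def)
  have "ensemble (a + b) (?l @ kron_ensemble ps qs)"
    using ensemble_kron[OF Cons.prems] unfolding p k .
  then have el: "ensemble (a + b) ?l" "ensemble (a + b) (kron_ensemble ps qs)" unfolding ensemble_append by auto
  show ?case
    unfolding p k ensemble_mat_append[OF el] ensemble_mat_kron_single[OF e(2) Cons.prems(2)] Cons.IH[OF e(3) Cons.prems(2)]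
      ensemble_mat_Cons
    by (rule kron_add_left[OF smult_carrier_mat[OF proj_carrier[OF stab_state_carrier[OF e(2)]]]
          psd_carrier[OF ensemble_psd[OF e(3)]], symmetric])
qed

lemma weight_kron_ensemble:
  "sum_list (map fst (kron_ensemble ps qs)) = sum_list (map fst ps) * sum_list (map fst qs)"
proof (induction ps)
  case (Cons p ps)
  obtain w \<phi> where p: "p = (w,\<phi>)" by (cases p)
  have "sum_list (map fst (map (\<lambda>(x,\<chi>). (w * x, kron \<phi> \<chi>)) qs)) = w * sum_list (map fst qs)"
    by (induction qs) (auto simp: distrib_left)
  then show ?case using Cons by (simp add: p kron_ensemble_def distrib_right)
qed (simp add: kron_ensemble_def)

lemma mixed_stab_kron:
  assumes "mixed_stab a \<sigma>" "mixed_stab b \<tau>" shows "mixed_stab (a + b) (kron \<sigma> \<tau>)"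
proof -
  obtain ps qs where *: "ensemble a ps" "sum_list (map fst ps) = 1" "\<sigma> = ensemble_mat a ps"
    "ensemble b qs" "sum_list (map fst qs) = 1" "\<tau> = ensemble_mat b qs"
    using assms unfolding mixed_stab_iff by blast
  show ?thesis unfolding mixed_stab_iff
    by (intro exI[of _ "kron_ensemble ps qs"] conjI ensemble_kron *(1,4))
       (simp_all only: weight_kron_ensemble * ensemble_mat_kron[OF *(1,4)] mult_1)
qed

lemma stab_state_0: "stab_state 0 (1\<^sub>m 1)"
proof -
  have c: "1\<^sub>m 1 \<in> carrier_mat (2^0) 1" by simp
  have "nsq (1\<^sub>m 1) = 1" by (simp add: nsq_def lessThan_Suc One_nat_def)
  moreover have "[] \<in> stabs 0 (1\<^sub>m 1)" by (auto simp: stabs_def intro!: exI[of _ 1])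
  then have "card {[]::nat list} \<le> card (stabs 0 (1\<^sub>m 1))" by (intro card_mono) auto
  ultimately show ?thesis using c by (simp add: stab_state_iff unit_ket_iff)
qed

lemma mixed_stab_0: "mixed_stab 0 (1\<^sub>m 1)"
  unfolding mixed_stab_iff
proof (intro exI[of _ "[(1, 1\<^sub>m 1)]"] conjI)
  show "1\<^sub>m 1 = ensemble_mat 0 [(1, 1\<^sub>m 1)]"
    by (rule eq_matI) (auto simp: ensemble_mat_def proj_entry[of _ 1] carrier_matD[OF proj_carrier[OF one_carrier_mat[of 1]]])
qed (auto simp: ensemble_def stab_state_0)

lemma mixed_stab_kron_pow: "mixed_stab n \<sigma> \<Longrightarrow> mixed_stab (n * k) (kron_pow \<sigma> k)"
  by (induction k) (auto simp: mixed_stab_0 intro: mixed_stab_kron)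


section \<open>The maximally mixed state and the feasible set of the robustness\<close>

lemma kron_one_one_right: "kron A (1\<^sub>m 1) = A"
  by (rule eq_matI) (auto simp: kron_index)

lemma basis_ket_entry: "i < D \<Longrightarrow> basis_ket D k $$ (i,0) = (if i = k then 1 else 0)"
  by (simp add: basis_ket_def)

lemma stab_state_basis:
  assumes "k < 2" shows "stab_state 1 (basis_ket 2 k)"
proof -
  have c: "basis_ket 2 k \<in> carrier_mat (2^1) 1" by simp
  have n: "nsq (basis_ket 2 k) = 1" using assms unfolding less_2_nat by (elim disjE) (simp_all add: nsq_def basis_ket_def sum_less_2)
  have "pauli 3 * basis_ket 2 k = (if k = 0 then 1 else - 1) \<cdot>\<^sub>m basis_ket 2 k" (is "_ = ?s \<cdot>\<^sub>m _")
  proof (rule eq_matI)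
    fix i j assume "i < dim_row (?s \<cdot>\<^sub>m basis_ket 2 k)" "j < dim_col (?s \<cdot>\<^sub>m basis_ket 2 k)"
    then have i: "i < 2" and j: "j = 0" by (auto simp: basis_ket_def)
    show "(pauli 3 * basis_ket 2 k) $$ (i,j) = (?s \<cdot>\<^sub>m basis_ket 2 k) $$ (i,j)"
      unfolding j mat_basis_ket[OF pauli_carrier i assms] using i assms unfolding less_2_nat
      by (elim disjE) (simp_all add: pauli_entries basis_ket_def)
  qed (auto simp: basis_ket_def carrier_matD[OF pauli_carrier])
  then have "[3] \<in> stabs 1 (basis_ket 2 k)"
    unfolding stabs_def words_def by (auto simp: kron_one_one_right intro!: exI[of _ ?s])
  moreover have "[0] \<in> stabs 1 (basis_ket 2 k)"
    using left_mult_one_mat[OF basis_ket_carrier[of 2 k]]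
    unfolding stabs_def words_def by (auto simp: kron_one_one_right pauli_0 intro!: exI[of _ 1])
  ultimately have "card {[0::nat], [3]} \<le> card (stabs 1 (basis_ket 2 k))" by (intro card_mono) auto
  then show ?thesis using c n by (simp add: stab_state_iff unit_ket_iff)
qed

lemma mixed_stab_half: "mixed_stab 1 ((1/2) \<cdot>\<^sub>m 1\<^sub>m 2)"
  unfolding mixed_stab_iff
proof (intro exI[of _ "[(1/2, basis_ket 2 0), (1/2, basis_ket 2 1)]"] conjI)
  note p = carrier_matD[OF proj_carrier[OF basis_ket_carrier]]
  show "(1/2) \<cdot>\<^sub>m 1\<^sub>m 2 = ensemble_mat 1 [(1/2, basis_ket 2 0), (1/2, basis_ket 2 1)]"
    by (rule mat2_eqI) (auto simp: ensemble_mat_def p proj_entry[OF basis_ket_carrier] basis_ket_entry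
        intro!: add_carrier_mat smult_carrier_mat)
qed (auto simp: ensemble_def stab_state_basis)

lemma kron_pow_half: "kron_pow ((1/2) \<cdot>\<^sub>m 1\<^sub>m 2) n = (1/2)^n \<cdot>\<^sub>m 1\<^sub>m (2^n)"
  by (induction n) (auto simp: kron_smult_left kron_smult_right kron_one smult_smult_assoc_mat mult.commute)

lemma mixed_stab_maximally_mixed: "mixed_stab n ((1/2)^n \<cdot>\<^sub>m 1\<^sub>m (2^n))"
  using mixed_stab_kron_pow[OF mixed_stab_half, of n] unfolding kron_pow_half by simp

lemma form_bound:
  assumes A: "A \<in> carrier_mat D D" and v: "v \<in> carrier_mat D 1"
  shows "cmod (form A v) \<le> (\<Sum>i<D. \<Sum>j<D. cmod (A $$ (i,j))) * nsq v"
proof -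
  have e: "cmod (v $$ (i,0)) \<le> sqrt (nsq v)" if "i < D" for i
  proof (rule real_le_rsqrt)
    show "(cmod (v $$ (i,0)))\<^sup>2 \<le> nsq v"
      unfolding nsq_def using that carrier_matD[OF v]
      by (intro member_le_sum[where f="\<lambda>i. (cmod (v $$ (i,0)))\<^sup>2"]) auto
  qed
  have "cmod (form A v) \<le> (\<Sum>i<D. \<Sum>j<D. cmod (cnj (v $$ (i,0)) * A $$ (i,j) * v $$ (j,0)))"
    unfolding form_sum[OF A v] by (intro order_trans[OF norm_sum] sum_mono norm_sum)
  also have "\<dots> \<le> (\<Sum>i<D. \<Sum>j<D. cmod (A $$ (i,j)) * (sqrt (nsq v) * sqrt (nsq v)))"
  proof (intro sum_mono)
    fix i j assume ij: "i \<in> {..<D}" "j \<in> {..<D}"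
    have "cmod (v $$ (i,0)) * cmod (v $$ (j,0)) \<le> sqrt (nsq v) * sqrt (nsq v)"
      using ij by (intro mult_mono e) auto
    then have "cmod (A $$ (i,j)) * (cmod (v $$ (i,0)) * cmod (v $$ (j,0))) \<le> cmod (A $$ (i,j)) * (sqrt (nsq v) * sqrt (nsq v))"
      by (rule mult_left_mono) simp
    then show "cmod (cnj (v $$ (i,0)) * A $$ (i,j) * v $$ (j,0)) \<le> cmod (A $$ (i,j)) * (sqrt (nsq v) * sqrt (nsq v))"
      by (simp add: norm_mult mult_ac)
  qed
  also have "\<dots> = (\<Sum>i<D. \<Sum>j<D. cmod (A $$ (i,j))) * nsq v" by (simp add: sum_distrib_right)
  finally show ?thesis .
qed

text \<open>\<open>Inf\<close> is informative only for a nonempty set. The maximally mixed state has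
  full rank, so a large multiple of it dominates \<open>\<rho>\<close>.\<close>

lemma robustness_set_nonempty:
  assumes \<rho>: "psd (2^n) \<rho>"
  shows "\<exists>l \<sigma>. mixed_stab n \<sigma> \<and> psd (2^n) (complex_of_real l \<cdot>\<^sub>m \<sigma> - \<rho>)"
proof -
  note R = psd_carrier[OF \<rho>]
  \<comment> \<open>By \<open>form_bound\<close> the sum of the moduli of the entries bounds the
    form on unit vectors. The factor \<open>2^n\<close> in the next step undoes the normalization of
    the mixed state.\<close>
  define C where "C = (\<Sum>i<2^n. \<Sum>j<2^n. cmod (\<rho> $$ (i,j)))"
  have e: "complex_of_real (2^n * C) \<cdot>\<^sub>m ((1/2)^n \<cdot>\<^sub>m 1\<^sub>m (2^n)) = complex_of_real C \<cdot>\<^sub>m 1\<^sub>m (2^n)"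
    unfolding smult_smult_assoc_mat by (simp add: power_divide)
  have "psd (2^n) (complex_of_real C \<cdot>\<^sub>m 1\<^sub>m (2^n) - \<rho>)"
    unfolding psd_form
  proof (intro conjI ballI minus_carrier_mat R)
    fix v :: "complex mat" assume v: "v \<in> carrier_mat (2^n) 1"
    have f: "form (complex_of_real C \<cdot>\<^sub>m 1\<^sub>m (2^n) - \<rho>) v = complex_of_real (C * nsq v) - form \<rho> v"
      unfolding form_minus[OF smult_carrier_mat[OF one_carrier_mat] R v] form_smult[OF one_carrier_mat v]
      unfolding form_def left_mult_one_mat[OF v] braket_self[OF v] by simp
    show "Im (form (complex_of_real C \<cdot>\<^sub>m 1\<^sub>m (2^n) - \<rho>) v) = 0" unfolding f using \<rho> v by (simp add: psd_form)
    have "Re (form \<rho> v) \<le> C * nsq v"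
      using form_bound[OF R v] complex_Re_le_cmod[of "form \<rho> v"] unfolding C_def by (rule order_trans[rotated])
    then show "0 \<le> Re (form (complex_of_real C \<cdot>\<^sub>m 1\<^sub>m (2^n) - \<rho>) v)" unfolding f by simp
  qed
  then show ?thesis using mixed_stab_maximally_mixed[of n] e by metis
qed

lemma robustness_ge_1:
  assumes "density n \<rho>" "mixed_stab n \<sigma>" "psd (2^n) (complex_of_real l \<cdot>\<^sub>m \<sigma> - \<rho>)"
  shows "1 \<le> l"
proof -
  have R: "\<rho> \<in> carrier_mat (2^n) (2^n)" "tr \<rho> = 1" using assms(1) psd_carrier by (auto simp: density_def)
  have S: "\<sigma> \<in> carrier_mat (2^n) (2^n)" by (rule psd_carrier[OF mixed_stab_psd[OF assms(2)]])
  have "tr (complex_of_real l \<cdot>\<^sub>m \<sigma> - \<rho>) = complex_of_real l - 1"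
    unfolding tr_minus[OF smult_carrier_mat[OF S] R(1)] tr_smult[OF S] mixed_stab_tr[OF assms(2)] R(2) by simp
  then show ?thesis using psd_tr(2)[OF assms(3)] by simp
qed

section \<open>Tensor powers and the fidelity of several copies\<close>

lemma kron_pow_carrier:
  "A \<in> carrier_mat (2^n) (2^n) \<Longrightarrow> kron_pow A k \<in> carrier_mat (2^(n * k)) (2^(n * k))"
proof (induction k)
  case (Suc k)
  then show ?case using kron_carrier[OF Suc(2) Suc(1)[OF Suc(2)]] by (simp add: power_add)
qed simp

lemma kron_pow_psd: "psd (2^n) A \<Longrightarrow> psd (2^(n * k)) (kron_pow A k)"
proof (induction k)
  case 0
  then show ?case using psd_one[of 1] by simp
next
  case (Suc k)
  then show ?case using psd_kron[OF Suc(2) Suc(1)[OF Suc(2)]] by (simp add: power_add)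
qed

lemma kron_pow_tr:
  "A \<in> carrier_mat (2^n) (2^n) \<Longrightarrow> tr A = 1 \<Longrightarrow> tr (kron_pow A k) = 1"
proof (induction k)
  case 0
  show ?case by (simp add: tr_def lessThan_Suc One_nat_def)
next
  case (Suc k)
  then show ?case using tr_kron[OF Suc(2) kron_pow_carrier[OF Suc(2)]] by simp
qed

text \<open>Telescoping: A tensor C minus B tensor D equals A tensor (C - D) plus (A - B) tensor D,
  and both summands are positive by \<open>psd_kron\<close>.\<close>

lemma kron_pow_mono:
  assumes \<rho>: "psd (2^n) \<rho>" and \<sigma>: "psd (2^n) \<sigma>" and l: "0 \<le> l" and le: "psd (2^n) (complex_of_real l \<cdot>\<^sub>m \<sigma> - \<rho>)"
  shows "psd (2^(n * k)) (complex_of_real (l^k) \<cdot>\<^sub>m kron_pow \<sigma> k - kron_pow \<rho> k)"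
proof (induction k)
  case 0
  have "complex_of_real (l^0) \<cdot>\<^sub>m kron_pow \<sigma> 0 - kron_pow \<rho> 0 = 0\<^sub>m (2^(n*0)) (2^(n*0))"
    by (rule eq_matI) auto
  then show ?case by (simp only: psd_zero)
next
  case (Suc k)
  let ?A = "complex_of_real l \<cdot>\<^sub>m \<sigma>" and ?C = "complex_of_real (l^k) \<cdot>\<^sub>m kron_pow \<sigma> k" and ?D = "kron_pow \<rho> k"
  have A: "?A \<in> carrier_mat (2^n) (2^n)" by (rule smult_carrier_mat[OF psd_carrier[OF \<sigma>]])
  have AB: "?A - \<rho> \<in> carrier_mat (2^n) (2^n)" by (rule psd_carrier[OF le])
  note B = psd_carrier[OF \<rho>]
  have C: "?C \<in> carrier_mat (2^(n*k)) (2^(n*k))" by (rule smult_carrier_mat[OF kron_pow_carrier[OF psd_carrier[OF \<sigma>]]])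
  have D: "?D \<in> carrier_mat (2^(n*k)) (2^(n*k))" by (rule kron_pow_carrier[OF B])
  have CD: "?C - ?D \<in> carrier_mat (2^(n*k)) (2^(n*k))" by (rule psd_carrier[OF Suc.IH])
  have "psd (2^n * 2^(n*k)) (kron ?A (?C - ?D) + kron (?A - \<rho>) ?D)"
    by (intro psd_add psd_kron psd_smult \<sigma> l Suc.IH le kron_pow_psd[OF \<rho>])
  also have "kron ?A (?C - ?D) + kron (?A - \<rho>) ?D = kron ?A ?C - kron \<rho> ?D"
  proof -
    have "?C = (?C - ?D) + ?D" using carrier_matD[OF C] carrier_matD[OF D] by (intro eq_matI) auto
    then have 1: "kron ?A ?C = kron ?A (?C - ?D) + kron ?A ?D" using kron_add_right[OF CD D] by metis
    have "?A = (?A - \<rho>) + \<rho>" using carrier_matD[OF A] carrier_matD[OF B] by (intro eq_matI) auto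
    then have 2: "kron ?A ?D = kron (?A - \<rho>) ?D + kron \<rho> ?D" using kron_add_left[OF AB B] by metis
    show ?thesis unfolding 1 2
      using carrier_matD[OF kron_carrier[OF A CD]] carrier_matD[OF kron_carrier[OF AB D]] carrier_matD[OF kron_carrier[OF B D]]
      by (intro eq_matI) auto
  qed
  also have "kron ?A ?C = complex_of_real (l ^ Suc k) \<cdot>\<^sub>m kron_pow \<sigma> (Suc k)"
    by (simp add: kron_smult_left kron_smult_right smult_smult_assoc_mat mult.commute)
  finally show ?case by (simp add: power_add)
qed

lemma kron_pow_ket: "v \<in> carrier_mat (2^d) 1 \<Longrightarrow> kron_pow v m \<in> carrier_mat (2^(d * m)) 1"
proof (induction m)
  case (Suc m)
  then show ?case using kron_carrier[OF Suc(2) Suc(1)[OF Suc(2)]] by (simp add: power_add)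
qed simp

text \<open>One copy at a time is split off on the left, so the size limit concerns a single copy
  and not the tensor power.\<close>

lemma kron_pow_fidelity:
  assumes d: "d \<le> 3" and \<psi>: "\<psi> \<in> carrier_mat (2^d) 1"
    and f: "0 \<le> f" "\<And>\<phi>. stab_state d \<phi> \<Longrightarrow> (cmod (braket \<psi> \<phi>))\<^sup>2 \<le> f"
  shows "stab_state (d * m) \<phi> \<Longrightarrow> (cmod (braket (kron_pow \<psi> m) \<phi>))\<^sup>2 \<le> f ^ m"
proof (induction m arbitrary: \<phi>)
  case 0
  then have p: "stab_state 0 \<phi>" by simp
  have "(cmod (braket (1\<^sub>m 1) \<phi>))\<^sup>2 \<le> nsq (1\<^sub>m 1) * nsq \<phi>"
    using stab_state_carrier[OF p] by (intro braket_cauchy_schwarz[of _ 1]) auto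
  then show ?case using stab_state_nsq[OF p] stab_state_nsq[OF stab_state_0] by simp
next
  case (Suc m)
  have "stab_state (d + d * m) \<phi>" using Suc.prems by simp
  from stab_fidelity_bound_kron[OF d this \<psi> kron_pow_ket[OF \<psi>] f zero_le_power[OF f(1)] Suc.IH]
  show ?case by simp
qed

lemma stab_fidelity_upper:
  assumes \<psi>: "unit_ket d \<psi>" and \<phi>: "stab_state d \<phi>"
  shows "(cmod (braket \<psi> \<phi>))\<^sup>2 \<le> stab_fidelity d \<psi>"
  unfolding stab_fidelity_def
proof (rule cSUP_upper)
  show "bdd_above ((\<lambda>\<phi>. (cmod (braket \<psi> \<phi>))\<^sup>2) ` {\<phi>. stab_state d \<phi>})"
  proof (rule bdd_aboveI2)
    fix \<chi> assume "\<chi> \<in> {\<phi>. stab_state d \<phi>}"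
    then have c: "stab_state d \<chi>" by simp
    have "\<psi> \<in> carrier_mat (2^d) 1" "nsq \<psi> = 1" using \<psi> by (auto simp: unit_ket_iff)
    then show "(cmod (braket \<psi> \<chi>))\<^sup>2 \<le> 1"
      using braket_cauchy_schwarz[of \<psi> "2^d" \<chi>] stab_state_carrier[OF c] stab_state_nsq[OF c] by simp
  qed
qed (use \<phi> in simp)

text \<open>The greedy extension started from the identity word, with all \<open>d\<close>
  generators missing, already guarantees \<open>greedy_const d\<close>.\<close>

lemma stab_fidelity_pos:
  assumes \<psi>: "unit_ket d \<psi>" shows "0 < stab_fidelity d \<psi>"
proof -
  have v: "\<psi> \<in> carrier_mat (2^d) 1" "nsq \<psi> = 1" using \<psi> by (auto simp: unit_ket_iff)
  have f: "0 \<le> stab_fidelity d \<psi>"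
  proof -
    \<comment> \<open>Weights with sum 1 cannot form the empty list, so some stabilizer state
      exists.\<close>
    obtain ps where "ensemble d ps" "sum_list (map fst ps) = 1"
      using mixed_stab_maximally_mixed[of d] unfolding mixed_stab_iff by blast
    then obtain \<phi> where "stab_state d \<phi>" by (cases ps) (auto simp: ensemble_def)
    from order_trans[OF zero_le_power2 stab_fidelity_upper[OF \<psi> this]] show ?thesis .
  qed
  have "zeros d \<in> stabs d \<psi>" using word_group_stabs[OF v(1) unit_ket_nonzero[OF \<psi>]] by (simp add: word_group_def)
  then have "card (stabs d \<psi>) > 0" by (auto simp: card_gt_0_iff)
  then have "2 ^ d \<le> card (stabs d \<psi>) * 2 ^ d" by simp
  from stab_overlap_bound[OF v(1) v(1) this refl f stab_fidelity_upper[OF \<psi>]]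
  have "greedy_const d \<le> stab_fidelity d \<psi>" by (simp add: v(2))
  then show ?thesis using greedy_const_pos[of d] by (rule less_le_trans[rotated])
qed

text \<open>The hypotheses bound \<open>ln y\<close> by \<open>ln L + ln (c / p)\<close> and 0 by
  \<open>ln L + ln ((1 - c) / (1 - p))\<close>. Weighted with \<open>p\<close> and
  \<open>1 - p\<close> and estimated by \<open>ln t \<le> t - 1\<close>, they leave the corrections
  \<open>c - p\<close> and \<open>p - c\<close>, which cancel.\<close>

lemma gibbs_two_point:
  fixes p c y L :: real
  assumes p: "0 < p" "p \<le> 1" and y: "0 < y" and c: "c \<le> 1" and L: "1 \<le> L"
    and 1: "p * y \<le> L * c" and 2: "1 - p \<le> L * (1 - c)"
  shows "p * ln y \<le> ln L"
proof -
  have "0 < L * c" using mult_pos_pos[OF p(1) y] 1 by (rule less_le_trans)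
  then have c0: "0 < c" using L by (simp add: zero_less_mult_iff)
  have "y \<le> L * (c / p)" using p 1 by (simp add: field_simps)
  then have "ln y \<le> ln (L * (c / p))" using y by (intro ln_mono)
  also have "\<dots> = ln L + ln (c / p)" using p c0 L by (intro ln_mult_pos) auto
  also have "\<dots> \<le> ln L + (c / p - 1)" using p c0 by (intro add_left_mono ln_le_minus_one) simp
  finally have "p * ln y \<le> p * (ln L + (c / p - 1))" using p by (intro mult_left_mono) auto
  also have "\<dots> = p * ln L + (c - p)" using p by (simp add: field_simps)
  finally have a: "p * ln y \<le> p * ln L + (c - p)" .
  have b: "0 \<le> (1 - p) * ln L + (p - c)"
  \<comment> \<open>At \<open>p = 1\<close> the second quotient degenerates, and the claim reduces
    to \<open>c \<le> 1\<close>.\<close>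
  proof (cases "p = 1")
    case True
    then show ?thesis using c by simp
  next
    case False
    then have q: "0 < 1 - p" using p by simp
    have "0 < L * (1 - c)" using q 2 by (rule less_le_trans)
    then have c1: "0 < 1 - c" using L by (simp add: zero_less_mult_iff)
    have "1 \<le> L * ((1 - c) / (1 - p))" using q 2 by (simp add: field_simps)
    then have "ln 1 \<le> ln (L * ((1 - c) / (1 - p)))" by (intro ln_mono) simp_all
    also have "\<dots> = ln L + ln ((1 - c) / (1 - p))" using q c1 L by (intro ln_mult_pos) auto
    also have "\<dots> \<le> ln L + ((1 - c) / (1 - p) - 1)" using q c1 by (intro add_left_mono ln_le_minus_one) simp
    finally have "0 \<le> (1 - p) * (ln L + ((1 - c) / (1 - p) - 1))" using q by (intro mult_nonneg_nonneg) auto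
    also have "\<dots> = (1 - p) * ln L + (p - c)" using q by (simp add: field_simps)
    finally show ?thesis .
  qed
  show ?thesis using a b by (simp add: algebra_simps)
qed


section \<open>Kraus maps and the conversion bounds\<close>

lemma tr_form: "A \<in> carrier_mat D D \<Longrightarrow> tr A = (\<Sum>i<D. form A (basis_ket D i))"
  unfolding tr_def form_def using carrier_matD[of A D D] by (intro sum.cong) (auto simp: psd_entry)

lemma form_le:
  assumes S: "S \<in> carrier_mat D D" and R: "R \<in> carrier_mat D D"
    and le: "psd D (complex_of_real l \<cdot>\<^sub>m S - R)" and v: "v \<in> carrier_mat D 1"
  shows "Re (form R v) \<le> l * Re (form S v)"
proof -
  have "form (complex_of_real l \<cdot>\<^sub>m S - R) v = complex_of_real l * form S v - form R v"
    unfolding form_minus[OF smult_carrier_mat[OF S] R v] form_smult[OF S v] ..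
  moreover have "0 \<le> Re (form (complex_of_real l \<cdot>\<^sub>m S - R) v)" using le v unfolding psd_form by blast
  ultimately show ?thesis by simp
qed

lemma Re_sum_list: "Re (\<Sum>x\<leftarrow>xs. f x) = (\<Sum>x\<leftarrow>xs. Re (f x))"
  by (induction xs) auto

lemma kraus_terms_carrier:
  "set L \<subseteq> carrier_mat a b \<Longrightarrow> X \<in> carrier_mat b b \<Longrightarrow> set (map (\<lambda>K. K * X * adj K) L) \<subseteq> carrier_mat a a"
  by (auto intro!: sandwich_carrier)

lemma form_kraus:
  assumes L: "set L \<subseteq> carrier_mat a b" and X: "X \<in> carrier_mat b b" and v: "v \<in> carrier_mat a 1"
  shows "form (kraus_apply a L X) v = (\<Sum>K\<leftarrow>L. form X (adj K * v))"
proof -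
  have "form (K * X * adj K) v = form X (adj K * v)" if "K \<in> set L" for K
    using form_sandwich[OF _ X v] that L by blast
  then show ?thesis
    unfolding kraus_apply_def form_msum[OF v kraus_terms_carrier[OF L X]] map_map comp_def
    by (intro arg_cong[where f=sum_list] map_cong refl)
qed

lemma form_kraus_le:
  assumes L: "set L \<subseteq> carrier_mat a b" and S: "S \<in> carrier_mat b b" and R: "R \<in> carrier_mat b b"
    and le: "psd b (complex_of_real l \<cdot>\<^sub>m S - R)" and v: "v \<in> carrier_mat a 1"
  shows "Re (form (kraus_apply a L R) v) \<le> l * Re (form (kraus_apply a L S) v)"
proof -
  have "Re (form R (adj K * v)) \<le> l * Re (form S (adj K * v))" if "K \<in> set L" for K
    by (rule form_le[OF S R le]) (use that L v in \<open>meson adj_carrier mult_carrier_mat subsetD\<close>)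
  then have "(\<Sum>K\<leftarrow>L. Re (form R (adj K * v))) \<le> (\<Sum>K\<leftarrow>L. l * Re (form S (adj K * v)))"
    by (rule sum_list_mono)
  then show ?thesis unfolding form_kraus[OF L S v] form_kraus[OF L R v] Re_sum_list sum_list_const_mult .
qed

lemma kraus_carrier:
  "set L \<subseteq> carrier_mat a b \<Longrightarrow> X \<in> carrier_mat b b \<Longrightarrow> kraus_apply a L X \<in> carrier_mat a a"
  unfolding kraus_apply_def by (intro msum_carrier kraus_terms_carrier)

lemma tr_kraus_le:
  assumes L: "set L \<subseteq> carrier_mat a b" and S: "S \<in> carrier_mat b b" and R: "R \<in> carrier_mat b b"
    and le: "psd b (complex_of_real l \<cdot>\<^sub>m S - R)"
  shows "Re (tr (kraus_apply a L R)) \<le> l * Re (tr (kraus_apply a L S))"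
  unfolding tr_form[OF kraus_carrier[OF L S]] tr_form[OF kraus_carrier[OF L R]] Re_sum sum_distrib_left
  by (intro sum_mono form_kraus_le[OF L S R le] basis_ket_carrier)

text \<open>Monotonicity for the comparison of \<open>X\<close> with the zero matrix at factor
  1.\<close>

lemma tr_kraus_nonneg:
  assumes L: "set L \<subseteq> carrier_mat a b" and X: "psd b X"
  shows "0 \<le> Re (tr (kraus_apply a L X))"
proof -
  have "psd b (complex_of_real 1 \<cdot>\<^sub>m X - 0\<^sub>m b b)"
  proof -
    have "complex_of_real 1 \<cdot>\<^sub>m X - 0\<^sub>m b b = X" using carrier_matD[OF psd_carrier[OF X]] by (intro eq_matI) auto
    then show ?thesis using X by simp
  qed
  from tr_kraus_le[OF L psd_carrier[OF X] zero_carrier_mat this]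
  have "Re (tr (kraus_apply a L (0\<^sub>m b b))) \<le> Re (tr (kraus_apply a L X))" by simp
  moreover have "form (kraus_apply a L (0\<^sub>m b b)) v = 0" if v: "v \<in> carrier_mat a 1" for v
  proof -
    have "form (0\<^sub>m b b) (adj K * v) = 0" if "K \<in> set L" for K
      by (rule form_zero) (use that L v in \<open>meson adj_carrier mult_carrier_mat subsetD\<close>)
    then have "(\<Sum>K\<leftarrow>L. form (0\<^sub>m b b) (adj K * v)) = (\<Sum>K\<leftarrow>L. 0)"
      by (intro arg_cong[where f=sum_list] map_cong refl)
    then show ?thesis unfolding form_kraus[OF L zero_carrier_mat v] by simp
  qed
  then have "tr (kraus_apply a L (0\<^sub>m b b)) = 0"
    unfolding tr_form[OF kraus_carrier[OF L zero_carrier_mat]] by simp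
  ultimately show ?thesis by simp
qed

text \<open>By cyclicity of the trace, the output trace depends on the Kraus list only through its
  effect. For a complete list the effect is the identity, so the trace is preserved.\<close>

lemma tr_kraus_effect:
  assumes X: "X \<in> carrier_mat b b"
  shows "set L \<subseteq> carrier_mat a b \<Longrightarrow> tr (kraus_apply a L X) = tr (msum b (map (\<lambda>K. adj K * K) L) * X)"
proof (induction L)
  case Nil
  have "0\<^sub>m b b * X = 0\<^sub>m b b" using carrier_matD[OF X] by simp
  then show ?case by (simp add: kraus_apply_def tr_def)
next
  case (Cons K L)
  then have K: "K \<in> carrier_mat a b" and L: "set L \<subseteq> carrier_mat a b" by auto
  have E: "adj K * K \<in> carrier_mat b b" by (rule mult_carrier_mat[OF adj_carrier[OF K] K])
  have M: "msum b (map (\<lambda>K. adj K * K) L) \<in> carrier_mat b b"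
    using L by (intro msum_carrier) (auto intro!: mult_carrier_mat[OF adj_carrier])
  have KX: "K * X \<in> carrier_mat a b" by (rule mult_carrier_mat[OF K X])
  have "tr (kraus_apply a (K # L) X) = tr (K * X * adj K) + tr (kraus_apply a L X)"
    using tr_add[OF sandwich_carrier[OF K X] kraus_carrier[OF L X]] by (simp add: kraus_apply_def)
  also have "tr (K * X * adj K) = tr (adj K * (K * X))" by (rule tr_mult_commute[OF KX adj_carrier[OF K]])
  also have "adj K * (K * X) = adj K * K * X" by (rule assoc_mult_mat[OF adj_carrier[OF K] K X, symmetric])
  also have "tr (adj K * K * X) + tr (kraus_apply a L X) = tr ((adj K * K + msum b (map (\<lambda>K. adj K * K) L)) * X)"
    unfolding Cons.IH[OF L] add_mult_distrib_mat[OF E M X]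
    by (rule tr_add[OF mult_carrier_mat[OF E X] mult_carrier_mat[OF M X], symmetric])
  finally show ?case by simp
qed

lemma tr_kraus_append:
  assumes "set L \<subseteq> carrier_mat a b" "set L' \<subseteq> carrier_mat a b" "X \<in> carrier_mat b b"
  shows "tr (kraus_apply a (L @ L') X) = tr (kraus_apply a L X) + tr (kraus_apply a L' X)"
  unfolding kraus_apply_def map_append msum_append[OF kraus_terms_carrier[OF assms(1,3)] kraus_terms_carrier[OF assms(2,3)]]
  by (rule tr_add[OF msum_carrier[OF kraus_terms_carrier[OF assms(1,3)]] msum_carrier[OF kraus_terms_carrier[OF assms(2,3)]]])

lemma conversion_bounds:
  fixes n d k m :: nat and \<rho> \<psi> \<tau> :: "complex mat" and Ks :: "complex mat list" and p \<epsilon> l :: real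
  assumes \<rho>: "density n \<rho>"
    and d: "d \<le> 3" and \<psi>: "unit_ket d \<psi>"
    and p: "0 < p"
    and op: "prob_stab_op (n * k) (d * m) Ks"
    and out: "kraus_apply (2^(d * m)) Ks (kron_pow \<rho> k) = complex_of_real p \<cdot>\<^sub>m \<tau>"
    and \<tau>: "density (d * m) \<tau>"
    and fid: "Re (braket (kron_pow \<psi> m) (\<tau> * kron_pow \<psi> m)) \<ge> 1 - \<epsilon>"
    and \<sigma>: "mixed_stab n \<sigma>" and le: "psd (2^n) (complex_of_real l \<cdot>\<^sub>m \<sigma> - \<rho>)"
  shows "\<exists>c. c \<le> 1 \<and> p * (1 - \<epsilon>) \<le> l^k * c * stab_fidelity d \<psi> ^ m \<and> 1 - p \<le> l^k * (1 - c)"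
proof -
  let ?a = "2^(d * m) :: nat" and ?b = "2^(n * k) :: nat"
  let ?R = "kron_pow \<rho> k" and ?S = "kron_pow \<sigma> k" and ?v = "kron_pow \<psi> m"
  have Ks: "set Ks \<subseteq> carrier_mat ?a ?b" using op by (auto simp: prob_stab_op_def kraus_ops_def)
  obtain Kss where Kss: "\<And>L. L \<in> set Kss \<Longrightarrow> set L \<subseteq> carrier_mat ?a ?b"
    and full: "msum ?b (map (\<lambda>K. adj K * K) (Ks @ concat Kss)) = 1\<^sub>m ?b"
    using op unfolding prob_stab_op_def kraus_ops_def concat.simps by blast
  \<comment> \<open>All other branches are merged into one Kraus list; only its output trace, the
    failure probability, enters the argument.\<close>
  let ?L = "concat Kss"
  have L: "set ?L \<subseteq> carrier_mat ?a ?b" using Kss by auto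
  have KL: "set (Ks @ ?L) \<subseteq> carrier_mat ?a ?b" using Ks L by simp
  have r: "psd (2^n) \<rho>" "tr \<rho> = 1" using \<rho> by (auto simp: density_def)
  note s = mixed_stab_psd[OF \<sigma>]
  have l1: "1 \<le> l" by (rule robustness_ge_1[OF \<rho> \<sigma> le])
  have R: "?R \<in> carrier_mat ?b ?b" by (rule kron_pow_carrier[OF psd_carrier[OF r(1)]])
  have mS: "mixed_stab (n * k) ?S" by (rule mixed_stab_kron_pow[OF \<sigma>])
  have S: "?S \<in> carrier_mat ?b ?b" by (rule psd_carrier[OF mixed_stab_psd[OF mS]])
  have lek: "psd ?b (complex_of_real (l^k) \<cdot>\<^sub>m ?S - ?R)"
    by (rule kron_pow_mono[OF r(1) s _ le]) (use l1 in simp)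
  have v: "?v \<in> carrier_mat ?a 1" using \<psi> by (intro kron_pow_ket) (simp add: unit_ket_iff)
  obtain c \<omega> where c: "0 \<le> c" and \<omega>: "mixed_stab (d * m) \<omega>" and Sout: "kraus_apply ?a Ks ?S = complex_of_real c \<cdot>\<^sub>m \<omega>"
    using op mS unfolding prob_stab_op_def stab_preserving_def by blast
  have O: "\<omega> \<in> carrier_mat ?a ?a" by (rule psd_carrier[OF mixed_stab_psd[OF \<omega>]])
  have T: "\<tau> \<in> carrier_mat ?a ?a" "tr \<tau> = 1" using \<tau> psd_carrier by (auto simp: density_def)
  have total: "tr (kraus_apply ?a Ks X) + tr (kraus_apply ?a ?L X) = tr X" if X: "X \<in> carrier_mat ?b ?b" for X
    unfolding tr_kraus_append[OF Ks L X, symmetric] tr_kraus_effect[OF X KL] full left_mult_one_mat[OF X] ..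
  have trS: "tr (kraus_apply ?a Ks ?S) = complex_of_real c"
    unfolding Sout tr_smult[OF O] mixed_stab_tr[OF \<omega>] by simp
  have trR: "tr (kraus_apply ?a Ks ?R) = complex_of_real p"
    unfolding out tr_smult[OF T(1)] T(2) by simp
  have restS: "Re (tr (kraus_apply ?a ?L ?S)) = 1 - c"
    using arg_cong[OF total[OF S], of Re] unfolding trS mixed_stab_tr[OF mS] by simp
  have restR: "Re (tr (kraus_apply ?a ?L ?R)) = 1 - p"
    using arg_cong[OF total[OF R], of Re] unfolding trR kron_pow_tr[OF psd_carrier[OF r(1)] r(2)] by simp
  have "c \<le> 1" using tr_kraus_nonneg[OF L mixed_stab_psd[OF mS]] unfolding restS by simp
  moreover have "1 - p \<le> l^k * (1 - c)"
    using tr_kraus_le[OF L S R lek] unfolding restS restR .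
  moreover have "p * (1 - \<epsilon>) \<le> l^k * c * stab_fidelity d \<psi> ^ m"
  proof -
    have "p * (1 - \<epsilon>) \<le> p * Re (form \<tau> ?v)"
      using fid p unfolding form_def by (intro mult_left_mono) auto
    also have "\<dots> = Re (form (kraus_apply ?a Ks ?R) ?v)" unfolding out form_smult[OF T(1) v] by simp
    also have "\<dots> \<le> l^k * Re (form (kraus_apply ?a Ks ?S) ?v)" by (rule form_kraus_le[OF Ks S R lek v])
    also have "\<dots> = l^k * c * Re (form \<omega> ?v)" unfolding Sout form_smult[OF O v] by simp
    also have "\<dots> \<le> l^k * c * stab_fidelity d \<psi> ^ m"
    proof (rule mult_left_mono)
      show "Re (form \<omega> ?v) \<le> stab_fidelity d \<psi> ^ m"
      proof (rule mixed_stab_form_le[OF \<omega> v])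
        fix \<phi> assume "stab_state (d * m) \<phi>"
        then show "(cmod (braket ?v \<phi>))\<^sup>2 \<le> stab_fidelity d \<psi> ^ m"
          using \<psi> by (intro kron_pow_fidelity[OF d] less_imp_le[OF stab_fidelity_pos] stab_fidelity_upper)
            (auto simp: unit_ket_iff)
      qed
    qed (use l1 c in simp)
    finally show ?thesis .
  qed
  ultimately show ?thesis by blast
qed

text \<open>In exponential form the bounds say that \<open>exp (x / real k)\<close> lies below every
  feasible \<open>l\<close>, hence below the infimum.\<close>

lemma ln_gen_robustness_bound:
  assumes \<rho>: "density n \<rho>" and k: "0 < k"
    and b: "\<And>l \<sigma>. mixed_stab n \<sigma> \<Longrightarrow> psd (2^n) (complex_of_real l \<cdot>\<^sub>m \<sigma> - \<rho>) \<Longrightarrow> x \<le> real k * ln l"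
  shows "x / ln (gen_robustness n \<rho>) \<le> real k"
proof -
  let ?S = "{l::real. \<exists>\<sigma>. mixed_stab n \<sigma> \<and> psd (2^n) (complex_of_real l \<cdot>\<^sub>m \<sigma> - \<rho>)}"
  have ne: "?S \<noteq> {}" using robustness_set_nonempty[of n \<rho>] \<rho> unfolding density_def by blast
  have ge1: "1 \<le> l" if "l \<in> ?S" for l using that robustness_ge_1[OF \<rho>] by blast
  have g1: "1 \<le> gen_robustness n \<rho>" unfolding gen_robustness_def by (rule cInf_greatest[OF ne ge1])
  have "exp (x / real k) \<le> gen_robustness n \<rho>"
    unfolding gen_robustness_def
  proof (rule cInf_greatest[OF ne])
    fix l assume l: "l \<in> ?S"
    then have "x \<le> real k * ln l" using b by blast
    then have "x / real k \<le> ln l" using k by (simp add: divide_le_eq mult.commute)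
    then show "exp (x / real k) \<le> l" using ge1[OF l] by (simp add: ln_ge_iff)
  qed
  then have "x / real k \<le> ln (gen_robustness n \<rho>)" using g1 by (simp add: ln_ge_iff)
  then have x: "x \<le> real k * ln (gen_robustness n \<rho>)" using k by (simp add: divide_le_eq mult.commute)
  have "0 \<le> ln (gen_robustness n \<rho>)" using g1 by simp
  \<comment> \<open>For robustness 1 the logarithm is 0, and the quotient is 0 because division by
    zero yields zero.\<close>
  then show ?thesis using x by (cases "ln (gen_robustness n \<rho>) = 0") (simp_all add: divide_le_eq)
qed

theorem theorem7:
  fixes n d k m :: nat and \<rho> \<psi> \<tau> :: "complex mat" and Ks :: "complex mat list" and p \<epsilon> :: real
  assumes "density n \<rho>"
    and "d \<le> 3" and "unit_ket d \<psi>"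
    and "k > 0" and "m > 0"
    and "0 < p" and "p \<le> 1" and "0 \<le> \<epsilon>" and "\<epsilon> < 1"
    and "prob_stab_op (n * k) (d * m) Ks"
    and "kraus_apply (2^(d * m)) Ks (kron_pow \<rho> k) = complex_of_real p \<cdot>\<^sub>m \<tau>"
    and "density (d * m) \<tau>"
    and "Re (braket (kron_pow \<psi> m) (\<tau> * kron_pow \<psi> m)) \<ge> 1 - \<epsilon>"
  shows "real k \<ge> (ln p + ln (1 - \<epsilon>) + real m * ln (1 / stab_fidelity d \<psi>)) / ln (gen_robustness n \<rho>)
    \<and> real k \<ge> p * ((ln (1 - \<epsilon>) + real m * ln (1 / stab_fidelity d \<psi>)) / ln (gen_robustness n \<rho>))"
proof -
  let ?F = "stab_fidelity d \<psi>"
  define y where "y = (1 - \<epsilon>) / ?F ^ m"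
  have F: "0 < ?F" by (rule stab_fidelity_pos[OF assms(3)])
  have y: "0 < y" using F assms(9) by (simp add: y_def)
  have lny: "ln y = ln (1 - \<epsilon>) + real m * ln (1 / ?F)"
    using F assms(9) by (simp add: y_def ln_div ln_realpow)
  have bounds: "ln p + ln y \<le> real k * ln l \<and> p * ln y \<le> real k * ln l"
    if \<sigma>: "mixed_stab n \<sigma>" and le: "psd (2^n) (complex_of_real l \<cdot>\<^sub>m \<sigma> - \<rho>)" for l \<sigma>
  proof -
    have l1: "1 \<le> l" by (rule robustness_ge_1[OF assms(1) \<sigma> le])
    then have L: "1 \<le> l ^ k" by simp
    obtain c where c: "c \<le> 1" "p * (1 - \<epsilon>) \<le> l^k * c * ?F ^ m" "1 - p \<le> l^k * (1 - c)"
      using conversion_bounds[OF assms(1-3,6,10-13) \<sigma> le] by blast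
    have py: "p * y \<le> l^k * c" using c(2) F by (simp add: y_def field_simps)
    have lnL: "ln (l ^ k) = real k * ln l" using l1 by (simp add: ln_realpow)
    \<comment> \<open>The first bound uses the success branch alone, with \<open>c\<close> replaced
      by 1.\<close>
    have "p * y \<le> l^k * 1" using py mult_left_mono[OF c(1), of "l^k"] L by linarith
    then have "ln (p * y) \<le> ln (l ^ k)" using assms(6) y by (intro ln_mono) auto
    moreover have "ln (p * y) = ln p + ln y" using assms(6) y by (rule ln_mult_pos)
    moreover have "p * ln y \<le> ln (l ^ k)"
      by (rule gibbs_two_point[OF assms(6,7) y c(1) L py c(3)])
    ultimately show ?thesis unfolding lnL by simp
  qed
  have "(ln p + ln y) / ln (gen_robustness n \<rho>) \<le> real k"
    using bounds by (intro ln_gen_robustness_bound[OF assms(1,4)]) blast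
  moreover have "p * ln y / ln (gen_robustness n \<rho>) \<le> real k"
    using bounds by (intro ln_gen_robustness_bound[OF assms(1,4)]) blast
  ultimately show ?thesis unfolding lny by (simp add: add.assoc)
qed

end
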